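(* Let $n\ge 2$, $q=2^n$, $h(y)=y^{q/2}+y^{q/4}+\dots+y^2+y$, and let $Y_2=\mathbb{F}_{q^2}(x,y)$ be the function field over $\mathbb{F}_{q^2}$ defined by $h(y)=x^{q+1}$. For an integer $m\ge 0$ let $C_m=C(\mathcal{D},mP_\infty)$ be the one-point code described in the context. Then: (1) If $0\le m\le q/2-1$ or $m\ge (q^3+q^2-3q-2)/2$, then $\mathrm{Aut}(C_m)\cong S_{q^3/2}$, the full symmetric group on $q^3/2$ letters. (2) If $q/2\le m\le q$ or $(q^3+q^2-4q-4)/2\le m\le (q^3+q^2-3q-4)/2$, then $\mathrm{Aut}(C_m)\cong (S_{q/2})^{q^2}\rtimes \mathrm{Aff}_1(\mathbb{F}_{q^2})$, the semidirect product in which the direct product $(S_{q/2})^{q^2}$ of $q^2$ copies of $S_{q/2}$ (with factors indexed by the elements of $\mathbb{F}_{q^2}$) is normal and the group $\mathrm{Aff}_1(\mathbb{F}_{q^2})=\{t\mapsto \alpha t+\beta:\alpha\in\mathbb{F}_{q^2}^*,\beta\in\mathbb{F}_{q^2}\}$ of affine transformations of $\mathbb{F}_{q^2}$ permutes the factors via its action on $\mathbb{F}_{q^2}$. (3) If $q+1\le m\le q^3/4-1$ or $(q^3+2q^2-4q-4)/4\le m\le (q^3+q^2-4q-6)/2$, then $\mathrm{Aut}(C_m)\cong \mathrm{Aut}(Y_2/\mathbb{F}_{q^2})$.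
   Context: $P_\infty$ is the unique common pole of $x$ and $y$ (a rational place). Enumerate $\mathbb{F}_{q^2}=\{x_1,\dots,x_{q^2}\}$; for each $j$ there are exactly $q/2$ elements $y_{j,1},\dots,y_{j,q/2}\in\mathbb{F}_{q^2}$ with $h(y_{j,\ell})=x_j^{q+1}$, and $P_{j,\ell}$ denotes the common zero of $x-x_j$ and $y-y_{j,\ell}$ in $Y_2$; these $q^3/2$ places together with $P_\infty$ are all rational places of $Y_2$. $\mathcal{D}=(P_{1,1},\dots,P_{1,q/2},P_{2,1},\dots,P_{q^2,q/2})$. For a divisor $G$, $\mathcal{L}(G)=\{f\in Y_2^*:(f)+G\ge 0\}\cup\{0\}$. The code is $C(\mathcal{D},mP_\infty)=\{(f(P))_{P\in\mathcal{D}} : f\in\mathcal{L}(mP_\infty)\}\subseteq\mathbb{F}_{q^2}^{q^3/2}$. For a code $C\subseteq\mathbb{F}_{q^2}^{N}$, $\mathrm{Aut}(C)=\{\tau\in S_N:\tau(C)=C\}$, where $\tau(c_1,\dots,c_N)=(c_{\tau(1)},\dots,c_{\tau(N)})$. $\mathrm{Aut}(Y_2/\mathbb{F}_{q^2})$ is the group of $\mathbb{F}_{q^2}$-automorphisms of $Y_2$. *)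

theory Defs
  imports
    "HOL-Library.Cardinality"
    "HOL-Computational_Algebra.Polynomial"
    "HOL-Combinatorics.Permutations"
    "HOL-Algebra.Sym_Groups"
    "HOL-Algebra.Product_Groups"
begin

text \<open>
  A function field \<open>F/K\<close> is given by two field types \<open>'k\<close>, \<open>'f\<close> and an embedding
  \<open>emb\<close> of \<open>'k\<close> into \<open>'f\<close>, so that \<open>K = range emb\<close>.
\<close>

definition field_embedding :: "('k::field \<Rightarrow> 'f::field) \<Rightarrow> bool" where
  "field_embedding emb \<longleftrightarrow>
     emb 1 = 1 \<and>
     (\<forall>a b. emb (a + b) = emb a + emb b) \<and>
     (\<forall>a b. emb (a * b) = emb a * emb b)"

definition is_subring :: "'f::field set \<Rightarrow> bool" where
  "is_subring R \<longleftrightarrow>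
     0 \<in> R \<and> 1 \<in> R \<and> (\<forall>a\<in>R. \<forall>b\<in>R. a - b \<in> R \<and> a * b \<in> R)"

definition is_subfield :: "'f::field set \<Rightarrow> bool" where
  "is_subfield S \<longleftrightarrow> is_subring S \<and> (\<forall>a\<in>S. inverse a \<in> S)"

definition field_adjoin :: "('k::field \<Rightarrow> 'f::field) \<Rightarrow> 'f set \<Rightarrow> 'f set" where
  "field_adjoin emb A = \<Inter>{S. is_subfield S \<and> range emb \<union> A \<subseteq> S}"

definition transcendental_over :: "('k::field \<Rightarrow> 'f::field) \<Rightarrow> 'f \<Rightarrow> bool" where
  "transcendental_over emb z \<longleftrightarrow>
     (\<forall>p :: 'k poly. p \<noteq> 0 \<longrightarrow> poly (map_poly emb p) z \<noteq> 0)"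

definition h_poly :: "nat \<Rightarrow> 'a::field \<Rightarrow> 'a" where
  "h_poly n z = (\<Sum>i<n. z ^ (2 ^ i))"

text \<open>
  The equation \<open>h(Y) = x^(q+1)\<close> is irreducible over \<open>K(x)\<close> (its degree \<open>q/2\<close> in \<open>Y\<close> is
  coprime to \<open>q + 1\<close>), so the following determines \<open>F/K\<close> up to isomorphism as the function
  field defined by that equation.
\<close>

definition Y2_function_field ::
    "nat \<Rightarrow> ('k::field \<Rightarrow> 'f::field) \<Rightarrow> 'f \<Rightarrow> 'f \<Rightarrow> bool" where
  "Y2_function_field n emb x y \<longleftrightarrow>
     field_embedding emb \<and>
     transcendental_over emb x \<and>
     h_poly n y = x ^ (2 ^ n + 1) \<and>
     field_adjoin emb {x, y} = UNIV"


subsection \<open>Places, valuations, divisors\<close>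

definition valuation_ring :: "('k::field \<Rightarrow> 'f::field) \<Rightarrow> 'f set \<Rightarrow> bool" where
  "valuation_ring emb R \<longleftrightarrow>
     is_subring R \<and> range emb \<subset> R \<and> R \<subset> UNIV \<and> (\<forall>z. z \<in> R \<or> inverse z \<in> R)"

text \<open>A place is the set of non-units (the maximal ideal) of a valuation ring of \<open>F/K\<close>.\<close>

definition is_place :: "('k::field \<Rightarrow> 'f::field) \<Rightarrow> 'f set \<Rightarrow> bool" where
  "is_place emb P \<longleftrightarrow>
     (\<exists>R. valuation_ring emb R \<and> P = {z \<in> R. \<not> (\<exists>w\<in>R. z * w = 1)})"

text \<open>
  The valuation ring of a place \<open>P\<close> is recovered as the set of all \<open>z\<close> with \<open>1/z\<close> not in \<open>P\<close>;
  zero is listed separately because \<open>inverse 0 = 0\<close> lies in \<open>P\<close>.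
\<close>

definition place_ring :: "'f::field set \<Rightarrow> 'f set" where
  "place_ring P = {z. z = 0 \<or> inverse z \<notin> P}"

text \<open>
  Normalised discrete valuation at \<open>P\<close>: here \<open>t\<close> is a local parameter and \<open>u\<close> a unit of the
  valuation ring. Meaningful for \<open>z \<noteq> 0\<close> only.
\<close>

definition place_val :: "'f::field set \<Rightarrow> 'f \<Rightarrow> int" where
  "place_val P z =
     (THE k. \<exists>t u. P = (\<lambda>a. t * a) ` place_ring P \<and>
                   u \<in> place_ring P \<and> (\<exists>w\<in>place_ring P. u * w = 1) \<and>
                   z = t powi k * u)"

definition zero_at :: "'f::field set \<Rightarrow> 'f \<Rightarrow> bool" where
  "zero_at P z \<longleftrightarrow> z \<noteq> 0 \<and> place_val P z > 0"

definition pole_at :: "'f::field set \<Rightarrow> 'f \<Rightarrow> bool" where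
  "pole_at P z \<longleftrightarrow> z \<noteq> 0 \<and> place_val P z < 0"

text \<open>Residue at a rational place, where the residue field is identified with \<open>K\<close>.\<close>

definition place_eval :: "('k::field \<Rightarrow> 'f::field) \<Rightarrow> 'f set \<Rightarrow> 'f \<Rightarrow> 'k" where
  "place_eval emb P f = (THE a. f - emb a \<in> P)"

definition RR_space :: "('k::field \<Rightarrow> 'f::field) \<Rightarrow> ('f set \<Rightarrow> int) \<Rightarrow> 'f set" where
  "RR_space emb G =
     {f. f \<noteq> 0 \<and> (\<forall>P. is_place emb P \<longrightarrow> place_val P f + G P \<ge> 0)} \<union> {0}"

definition single_divisor :: "int \<Rightarrow> 'f::field set \<Rightarrow> 'f set \<Rightarrow> int" where
  "single_divisor m Q = (\<lambda>P. if P = Q then m else 0)"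

definition P_infty :: "('k::field \<Rightarrow> 'f::field) \<Rightarrow> 'f \<Rightarrow> 'f \<Rightarrow> 'f set" where
  "P_infty emb x y = (THE P. is_place emb P \<and> pole_at P x \<and> pole_at P y)"

definition P_affine ::
    "('k::field \<Rightarrow> 'f::field) \<Rightarrow> 'f \<Rightarrow> 'f \<Rightarrow> 'k \<Rightarrow> 'k \<Rightarrow> 'f set" where
  "P_affine emb x y a b =
     (THE P. is_place emb P \<and> zero_at P (x - emb a) \<and> zero_at P (y - emb b))"


subsection \<open>Codes\<close>

text \<open>Codewords are lists of length \<open>N\<close>, with positions \<open>0, \<dots>, N - 1\<close>.\<close>

definition AG_code ::
    "('k::field \<Rightarrow> 'f::field) \<Rightarrow> 'f set list \<Rightarrow> ('f set \<Rightarrow> int) \<Rightarrow> 'k list set" where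
  "AG_code emb D G = (\<lambda>f. map (\<lambda>P. place_eval emb P f) D) ` RR_space emb G"

definition Y2_places ::
    "nat \<Rightarrow> ('k::field \<Rightarrow> 'f::field) \<Rightarrow> 'f \<Rightarrow> 'f \<Rightarrow> (nat \<Rightarrow> 'k) \<Rightarrow> (nat \<Rightarrow> nat \<Rightarrow> 'k)
      \<Rightarrow> 'f set list" where
  "Y2_places q emb x y xs ys =
     concat (map (\<lambda>j. map (\<lambda>l. P_affine emb x y (xs j) (ys j l)) [1..<q div 2 + 1])
                 [1..<q ^ 2 + 1])"

definition Y2_code ::
    "nat \<Rightarrow> ('k::field \<Rightarrow> 'f::field) \<Rightarrow> 'f \<Rightarrow> 'f \<Rightarrow> (nat \<Rightarrow> 'k) \<Rightarrow> (nat \<Rightarrow> nat \<Rightarrow> 'k)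
      \<Rightarrow> nat \<Rightarrow> 'k list set" where
  "Y2_code q emb x y xs ys m =
     AG_code emb (Y2_places q emb x y xs ys) (single_divisor (int m) (P_infty emb x y))"


subsection \<open>Groups\<close>

text \<open>\<^term>\<open>permute_list \<tau>\<close> sends \<open>(c\<^sub>i)\<^sub>i\<close> to the tuple whose \<open>i\<close>-th entry is \<open>c\<close> at \<open>\<tau> i\<close>.\<close>

definition code_aut :: "nat \<Rightarrow> 'k list set \<Rightarrow> (nat \<Rightarrow> nat) monoid" where
  "code_aut N C =
     \<lparr> carrier = {\<tau>. \<tau> permutes {..<N} \<and> permute_list \<tau> ` C = C},
       mult = (\<circ>), one = id \<rparr>"

definition field_aut :: "('k::field \<Rightarrow> 'f::field) \<Rightarrow> ('f \<Rightarrow> 'f) monoid" where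
  "field_aut emb =
     \<lparr> carrier = {\<sigma>. bij \<sigma> \<and>
                     (\<forall>a b. \<sigma> (a + b) = \<sigma> a + \<sigma> b) \<and>
                     (\<forall>a b. \<sigma> (a * b) = \<sigma> a * \<sigma> b) \<and>
                     (\<forall>c. \<sigma> (emb c) = emb c)},
       mult = (\<circ>), one = id \<rparr>"

definition affine_group :: "('k::field \<Rightarrow> 'k) monoid" where
  "affine_group =
     \<lparr> carrier = {\<lambda>t. \<alpha> * t + \<beta> | \<alpha> \<beta>. \<alpha> \<noteq> 0}, mult = (\<circ>), one = id \<rparr>"

definition semidirect_product ::
    "('a, 'm) monoid_scheme \<Rightarrow> ('b, 'n) monoid_scheme \<Rightarrow> ('b \<Rightarrow> 'a \<Rightarrow> 'a) \<Rightarrow> ('a \<times> 'b) monoid"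
  where
  "semidirect_product N H \<phi> =
     \<lparr> carrier = carrier N \<times> carrier H,
       mult = (\<lambda>(a, g) (b, k). (a \<otimes>\<^bsub>N\<^esub> \<phi> g b, g \<otimes>\<^bsub>H\<^esub> k)),
       one = (\<one>\<^bsub>N\<^esub>, \<one>\<^bsub>H\<^esub>) \<rparr>"

text \<open>
  The affine map \<open>\<sigma>\<close> moves the factor with index \<open>t\<close> to the factor with index \<open>\<sigma> t\<close>, that is,
  it sends the family \<open>s\<close> to \<open>s \<circ> \<sigma>\<^sup>-\<^sup>1\<close>.
\<close>

definition sym_affine_group :: "nat \<Rightarrow> (('k::field \<Rightarrow> nat \<Rightarrow> nat) \<times> ('k \<Rightarrow> 'k)) monoid" where
  "sym_affine_group r =
     semidirect_product (product_group UNIV (\<lambda>_. sym_group r)) affine_group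
       (\<lambda>\<sigma> s. s \<circ> inv_into UNIV \<sigma>)"

end

theory Submission
  imports Defs
begin

text \<open>
  Write \<open>r = q/2\<close>. Because \<open>h' = 1\<close>, the coordinate ring \<open>A = K[x, y]\<close> is unramified over \<open>K[x]\<close>: modulo
  \<open>w = x\<^sup>W - x\<close>, with \<open>W\<close> a power of \<open>q\<^sup>2\<close>, raising to the power \<open>W\<^sup>2\<close> is the identity on \<open>A\<close>. Hence \<open>w\<close> is a
  local parameter at each finite place where it vanishes, and \<open>A\<close> consists of the functions regular away
  from \<open>P\<^sub>\<infinity>\<close>. At \<open>P\<^sub>\<infinity>\<close> the element \<open>x\<^sup>2/y\<close> is a local parameter and the monomials \<open>x\<^sup>i y\<^sup>j\<close> with
  \<open>j < r\<close> have pairwise distinct pole orders \<open>i r + j (2 r + 1)\<close>, so those of order at most \<open>m\<close> form a basis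
  of the Riemann--Roch space of \<open>m P\<^sub>\<infinity>\<close>.

  The sum over all rational affine points kills every function of pole order less than that of
  \<open>x\<close> to the \<open>q\<^sup>2 - 1\<close> times \<open>y\<close> to the \<open>r - 1\<close>, which makes \<open>C\<^sub>m\<close> the dual of \<open>C\<^sub>m\<^sub>'\<close> with
  \<open>m + m' = (q\<^sup>3 + q\<^sup>2 - 2q - 4)/2\<close>; it therefore suffices to treat small \<open>m\<close>. If \<open>2m < q\<^sup>3/2\<close>, then a
  permutation preserving \<open>C\<^sub>m\<close> acts on the Riemann--Roch space and respects products lying in it. Comparing
  pole orders of powers, it sends \<open>x\<close> to \<open>\<alpha>x + \<beta>\<close> and, for \<open>m > q\<close>, sends \<open>y\<close> into \<open>\<langle>1, x, x\<^sup>2, y\<rangle>\<close> in such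
  a way that the curve equation is preserved, so it comes from an automorphism of the function field.
  Conversely, every automorphism fixes \<open>P\<^sub>\<infinity>\<close>, since no affine rational place is the only pole of a
  function with pole order \<open>r\<close>.
\<close>

subsection \<open>Valuation rings\<close>

text \<open>The thresholds come from the pole orders \<open>r\<close> of \<open>x\<close> and
  \<open>2 * r + 1\<close> of \<open>y\<close>. Below \<open>r\<close> only constants occur, which
  every permutation preserves; up to \<open>2 * r\<close> only polynomials in \<open>x\<close>
  occur, which cannot see how points move inside a fibre of \<open>x\<close>; from
  \<open>2 * r + 1\<close> on, \<open>y\<close> separates the points and a permutation becomes
  rigid. Rigidity needs products of two functions of \<open>L m\<close> to be determined by their
  values at the \<open>4 * r ^ 3\<close> points, whence the bound on \<open>2 * m\<close>. The main
  obstacle is that places are arbitrary valuation rings, and neither their existence nor the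
  irreducibility of the curve equation can be read off the definition. Places are produced by
  extending subrings; their uniqueness follows from exponents and residues that are fixed before the
  place is chosen. The coordinates \<open>x\<close> and \<open>y\<close> are parameters throughout,
  so that moving a point to the origin, or replacing the coordinates by their images under a
  permutation, reuses the whole theory instead of repeating it.\<close>

lemma is_subring_closed:
  assumes "is_subring R"
  shows "0 \<in> R" "1 \<in> R" "a \<in> R \<Longrightarrow> b \<in> R \<Longrightarrow> a - b \<in> R" "a \<in> R \<Longrightarrow> b \<in> R \<Longrightarrow> a * b \<in> R"
    "a \<in> R \<Longrightarrow> - a \<in> R" "a \<in> R \<Longrightarrow> b \<in> R \<Longrightarrow> a + b \<in> R" "a \<in> R \<Longrightarrow> a ^ k \<in> R"
proof -
  show 0: "0 \<in> R" and 1: "1 \<in> R" and d: "\<And>a b. a \<in> R \<Longrightarrow> b \<in> R \<Longrightarrow> a - b \<in> R"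
    and m: "\<And>a b. a \<in> R \<Longrightarrow> b \<in> R \<Longrightarrow> a * b \<in> R"
    using assms by (auto simp: is_subring_def)
  show n: "\<And>a. a \<in> R \<Longrightarrow> - a \<in> R" using d[OF 0] by force
  show "a \<in> R \<Longrightarrow> b \<in> R \<Longrightarrow> a + b \<in> R" using d[OF _ n, of a b] by simp
  show "a \<in> R \<Longrightarrow> a ^ k \<in> R" by (induction k) (auto simp: 1 m)
qed

lemma is_subring_sum: "is_subring R \<Longrightarrow> (\<And>i. i \<in> I \<Longrightarrow> f i \<in> R) \<Longrightarrow> sum f I \<in> R"
  by (induction I rule: infinite_finite_induct) (auto simp: is_subring_closed)

lemma is_subring_prod: "is_subring R \<Longrightarrow> (\<And>i. i \<in> I \<Longrightarrow> f i \<in> R) \<Longrightarrow> prod f I \<in> R"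
  by (induction I rule: infinite_finite_induct) (auto simp: is_subring_closed)

definition max_ideal :: "'f::field set \<Rightarrow> 'f set" where
  "max_ideal R = {z \<in> R. \<not> (\<exists>w\<in>R. z * w = 1)}"

text \<open>The condition \<open>u \<noteq> 0\<close> is separate because
  \<open>inverse 0 = 0\<close> lies in every subring.\<close>

definition unit_of :: "'f::field set \<Rightarrow> 'f \<Rightarrow> bool" where
  "unit_of R u \<longleftrightarrow> u \<noteq> 0 \<and> u \<in> R \<and> inverse u \<in> R"

locale val_ring =
  fixes emb :: "'k::field \<Rightarrow> 'f::field" and R :: "'f set"
  assumes vr: "valuation_ring emb R"
begin

abbreviation "P \<equiv> max_ideal R"

lemma sub: "is_subring R" using vr by (simp add: valuation_ring_def)
lemmas R_closed = is_subring_closed[OF sub]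
lemma emb_in: "emb c \<in> R" using vr by (auto simp: valuation_ring_def)
lemma total: "z \<in> R \<or> inverse z \<in> R" using vr by (simp add: valuation_ring_def)

lemma P_iff: "z \<in> P \<longleftrightarrow> z = 0 \<or> inverse z \<notin> R"
proof (cases "z = 0")
  case False
  have "(\<exists>w\<in>R. z * w = 1) \<longleftrightarrow> inverse z \<in> R"
    using False by (metis inverse_unique right_inverse)
  then show ?thesis using False total[of z] by (auto simp: max_ideal_def)
qed (auto simp: max_ideal_def R_closed)

lemma P_R: "z \<in> P \<Longrightarrow> z \<in> R" by (simp add: max_ideal_def)

lemma unit_iff: "unit_of R u \<longleftrightarrow> u \<in> R \<and> u \<notin> P"
  by (auto simp: unit_of_def P_iff)

lemma place_ring_P: "place_ring P = R"
  unfolding place_ring_def by (auto simp: P_iff R_closed)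

lemma one_notin: "1 \<notin> P" by (simp add: P_iff R_closed)
lemma P_zero: "0 \<in> P" by (simp add: P_iff)

lemma P_mult: assumes "a \<in> P" "b \<in> R" shows "a * b \<in> P"
proof (rule ccontr)
  assume "a * b \<notin> P"
  then have h: "a * b \<noteq> 0" "inverse (a * b) \<in> R" by (auto simp: P_iff)
  then have "b * inverse (a * b) \<in> R" using assms by (simp add: R_closed)
  then have "inverse a \<in> R" using h by (simp add: field_simps)
  then show False using assms h by (auto simp: P_iff)
qed

lemma P_mult2: "a \<in> R \<Longrightarrow> b \<in> P \<Longrightarrow> a * b \<in> P"
  using P_mult[of b a] by (simp add: mult.commute)

lemma P_uminus: "a \<in> P \<Longrightarrow> - a \<in> P" using P_mult[of a "-1"] by (simp add: R_closed)

lemma P_add: assumes "a \<in> P" "b \<in> P" shows "a + b \<in> P"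
proof -
  \<comment> \<open>One of \<open>a / b\<close> and \<open>b / a\<close> lies in \<open>R\<close>;
    factoring out its denominator leaves an element of \<open>P\<close> times an element of
    \<open>R\<close>.\<close>
  have *: "c + d \<in> P" if "c \<in> P" "d \<in> P" "d \<noteq> 0" "c / d \<in> R" for c d
  proof -
    have "c + d = d * (c / d + 1)" using that by (simp add: field_simps)
    moreover have "c / d + 1 \<in> R" using that by (simp add: R_closed)
    ultimately show ?thesis using P_mult that by metis
  qed
  show ?thesis
  proof (cases "a = 0 \<or> b = 0")
    case False
    then show ?thesis using *[of a b] *[of b a] total[of "a/b"] assms
      by (auto simp: add.commute)
  qed (use assms in auto)
qed

lemma P_diff: "a \<in> P \<Longrightarrow> b \<in> P \<Longrightarrow> a - b \<in> P"
  using P_add[of a "-b"] P_uminus by simp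

lemma P_sum: "(\<And>i. i \<in> I \<Longrightarrow> f i \<in> P) \<Longrightarrow> sum f I \<in> P"
  by (induction I rule: infinite_finite_induct) (auto simp: P_zero P_add)

lemma P_prime: "a * b \<in> P \<Longrightarrow> a \<in> R \<Longrightarrow> b \<in> R \<Longrightarrow> a \<in> P \<or> b \<in> P"
  by (auto simp: P_iff R_closed)

lemma P_prime_power: "a ^ k \<in> P \<Longrightarrow> a \<in> R \<Longrightarrow> a \<in> P"
proof (induction k)
  case (Suc k) then show ?case using P_prime[of a "a ^ k"] R_closed by auto
qed (simp add: one_notin)

lemma P_power: "a \<in> P \<Longrightarrow> k > 0 \<Longrightarrow> a ^ k \<in> P"
  by (cases k) (auto intro: P_mult R_closed P_R)

lemma P_prime_prod: "finite I \<Longrightarrow> (\<Prod>i\<in>I. f i) \<in> P \<Longrightarrow> (\<And>i. i \<in> I \<Longrightarrow> f i \<in> R) \<Longrightarrow> \<exists>i\<in>I. f i \<in> P"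
proof (induction I rule: finite_induct)
  case (insert i I)
  then show ?case using P_prime[of "f i" "prod f I"] is_subring_prod[OF sub, of I f] by auto
qed (simp add: one_notin)

lemma R_integral: assumes "a ^ k \<in> R" "k > 0" shows "a \<in> R"
proof (rule ccontr)
  assume "a \<notin> R"
  then have "inverse a \<in> P" by (auto simp: P_iff)
  then have "inverse a ^ k \<in> P" using P_power assms by blast
  then show False using assms \<open>a \<notin> R\<close> by (auto simp: P_iff power_inverse R_closed)
qed

lemma unit_1: "unit_of R 1" by (simp add: unit_of_def R_closed)
lemma unit_mult: "unit_of R a \<Longrightarrow> unit_of R b \<Longrightarrow> unit_of R (a * b)"
  by (auto simp: unit_of_def R_closed)
lemma unit_inverse: "unit_of R a \<Longrightarrow> unit_of R (inverse a)"
  by (auto simp: unit_of_def)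
lemma unit_power: "unit_of R a \<Longrightarrow> unit_of R (a ^ k)"
  by (induction k) (auto simp: unit_1 unit_mult)
lemma unit_add_P: "unit_of R u \<Longrightarrow> a \<in> P \<Longrightarrow> unit_of R (u + a)"
  unfolding unit_iff using P_R R_closed P_diff[of "u + a" a] by auto

lemma unit_powi: "unit_of R a \<Longrightarrow> unit_of R (a powi k)"
  by (auto simp: power_int_def unit_power unit_inverse)

end

text \<open>Asking for the form \<open>t powi k * u\<close> of every non-zero element makes the
  valuation discrete of rank one; a valuation ring whose maximal ideal is merely principal may have
  larger rank.\<close>

definition is_unif :: "'f::field set \<Rightarrow> 'f \<Rightarrow> bool" where
  "is_unif R t \<longleftrightarrow> t \<noteq> 0 \<and> t \<in> max_ideal R \<and>
     (\<forall>z. z \<noteq> 0 \<longrightarrow> (\<exists>k u. unit_of R u \<and> z = t powi k * u))"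

locale dvr = val_ring +
  fixes t
  assumes unif: "is_unif R t"
begin

lemma t0: "t \<noteq> 0" and tP: "t \<in> P" and tR: "t \<in> R" using unif P_R by (auto simp: is_unif_def)

lemma ex_form: "z \<noteq> 0 \<Longrightarrow> \<exists>k u. unit_of R u \<and> z = t powi k * u"
  using unif by (auto simp: is_unif_def)

lemma t_powi_P: "k > 0 \<Longrightarrow> t powi k \<in> P"
  by (simp add: power_int_def P_power tP)

lemma t_unit_P: assumes "unit_of R u" shows "t powi k * u \<in> P \<longleftrightarrow> k > 0"
proof
  assume a: "t powi k * u \<in> P"
  show "k > 0"
  proof (rule ccontr)
    assume "\<not> k > 0"
    then have "t powi (-k) \<in> R" by (simp add: power_int_def R_closed tR)
    then have "t powi k * u * t powi (-k) \<in> P" using a P_mult by blast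
    moreover have "t powi k * u * t powi (-k) = u" using t0 by (simp add: power_int_minus)
    ultimately show False using assms by (simp add: unit_iff)
  qed
qed (use assms t_powi_P P_mult in \<open>auto simp: unit_of_def\<close>)

lemma t_unit_R: assumes "unit_of R u" shows "t powi k * u \<in> R \<longleftrightarrow> k \<ge> 0"
proof -
  have "t powi k * u \<in> R \<longleftrightarrow> inverse (t powi k * u) \<notin> P"
    using assms t0 by (auto simp: P_iff unit_of_def)
  also have "inverse (t powi k * u) = t powi (-k) * inverse u" by (simp add: power_int_minus)
  finally show ?thesis using t_unit_P[OF unit_inverse[OF assms], of "-k"] by auto
qed

lemma t_powi_unit: assumes "unit_of R (t powi k)" shows "k = 0"
proof -
  have "t powi k \<in> R" "t powi k \<notin> P" using assms by (auto simp: unit_iff)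
  then show ?thesis using t_unit_P[OF unit_1, of k] t_unit_R[OF unit_1, of k] by auto
qed

lemma P_eq: "P = (\<lambda>a. t * a) ` R"
proof
  show "(\<lambda>a. t * a) ` R \<subseteq> P" using P_mult tP by auto
  show "P \<subseteq> (\<lambda>a. t * a) ` R"
  proof
    fix z assume z: "z \<in> P"
    show "z \<in> (\<lambda>a. t * a) ` R"
    proof (cases "z = 0")
      case True then show ?thesis using R_closed by (auto intro: image_eqI[of _ _ 0])
    next
      case False
      then obtain k u where ku: "unit_of R u" "z = t powi k * u" using ex_form by blast
      then have "k > 0" using z t_unit_P by blast
      then have "t powi (k-1) * u \<in> R" using ku(1) t_unit_R by auto
      moreover have "z = t * (t powi (k-1) * u)"
        using ku t0 by (simp add: power_int_diff)
      ultimately show ?thesis by blast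
    qed
  qed
qed

text \<open>\<open>place_val\<close> quantifies over all generators of \<open>P\<close>, so the
  exponent must not depend on the chosen one: two generators divide each other and differ by a unit,
  and no power of \<open>t\<close> with non-zero exponent is a unit.\<close>

lemma place_val_form: assumes u: "unit_of R u" shows "place_val P (t powi k * u) = k"
  unfolding place_val_def place_ring_P
proof (rule the_equality)
  show "\<exists>t' u'. P = (*) t' ` R \<and> u' \<in> R \<and> (\<exists>w\<in>R. u' * w = 1) \<and> t powi k * u = t' powi k * u'"
    using P_eq u by (intro exI[of _ t] exI[of _ u]) (auto simp: unit_of_def intro: bexI[of _ "inverse u"])
next
  fix k' assume "\<exists>t' u'. P = (*) t' ` R \<and> u' \<in> R \<and> (\<exists>w\<in>R. u' * w = 1) \<and> t powi k * u = t' powi k' * u'"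
  then obtain t' u' w where h: "P = (*) t' ` R" "u' \<in> R" "w \<in> R" "u' * w = 1"
      "t powi k * u = t' powi k' * u'" by blast
  have u': "unit_of R u'" using h unfolding unit_of_def
    by (metis inverse_unique mult_zero_left zero_neq_one)
  have "t' \<in> P" using h(1) R_closed(2) by (metis image_eqI mult.right_neutral)
  then obtain a where a: "a \<in> R" "t' = t * a" using P_eq by auto
  obtain b where b: "b \<in> R" "t = t' * b" using h(1) tP by auto
  have "a * b = 1" "a \<noteq> 0" using a b t0 by (auto simp: mult.commute)
  then have ua: "unit_of R a" using a b unfolding unit_of_def by (metis inverse_unique)
  have "t' powi k' = t powi k' * a powi k'" by (simp add: a(2) power_int_mult_distrib)
  then have "t powi k * u = t powi k' * (a powi k' * u')" using h(5) by simp
  moreover have "u \<noteq> 0" using u by (simp add: unit_of_def)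
  ultimately have "t powi (k - k') = a powi k' * u' * inverse u"
    using t0 by (simp add: power_int_diff field_simps)
  moreover have "unit_of R (a powi k' * u' * inverse u)"
    using ua u u' by (intro unit_mult unit_powi unit_inverse)
  ultimately have "k - k' = 0" using t_powi_unit by metis
  then show "k' = k" by simp
qed

lemma val_mult: "a \<noteq> 0 \<Longrightarrow> b \<noteq> 0 \<Longrightarrow> place_val P (a * b) = place_val P a + place_val P b"
proof -
  assume "a \<noteq> 0" "b \<noteq> 0"
  then obtain k u l w where "unit_of R u" "a = t powi k * u" "unit_of R w" "b = t powi l * w"
    using ex_form by metis
  moreover from this have "a * b = t powi (k + l) * (u * w)" using t0 by (simp add: power_int_add)
  ultimately show ?thesis using place_val_form unit_mult by metis
qed

lemma val_power: "a \<noteq> 0 \<Longrightarrow> place_val P (a ^ k) = int k * place_val P a"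
proof (induction k)
  case 0 show ?case using place_val_form[OF unit_1, of 0] by simp
next
  case (Suc k) then show ?case by (simp add: val_mult algebra_simps)
qed

lemma val_R: "z \<noteq> 0 \<Longrightarrow> z \<in> R \<longleftrightarrow> place_val P z \<ge> 0"
  using ex_form place_val_form t_unit_R by metis

lemma val_P: "z \<noteq> 0 \<Longrightarrow> z \<in> P \<longleftrightarrow> place_val P z > 0"
  using ex_form place_val_form t_unit_P by metis

lemma val_unit: "unit_of R u \<Longrightarrow> place_val P u = 0"
  using place_val_form[of u 0] by simp

lemma val_t: "place_val P t = 1"
  using place_val_form[OF unit_1, of 1] by simp

lemma zero_at_iff: "zero_at P z \<longleftrightarrow> z \<noteq> 0 \<and> z \<in> P"
  using val_P by (auto simp: zero_at_def)

lemma pole_at_iff: "pole_at P z \<longleftrightarrow> z \<notin> R"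
  using val_R[of z] R_closed(1) by (cases "z = 0") (auto simp: pole_at_def)

text \<open>Lets \<open>ww 1\<close> be exchanged for \<open>x - emb a\<close> as local parameter at
  a rational point.\<close>

lemma unif_associate:
  assumes "unit_of R u" shows "is_unif R (t * u)"
  unfolding is_unif_def
proof (intro conjI allI impI)
  show "t * u \<noteq> 0" "t * u \<in> P" using assms t0 tP P_mult by (auto simp: unit_of_def)
  fix z :: 'b assume "z \<noteq> 0"
  then obtain k w where "unit_of R w" "z = t powi k * w" using ex_form by blast
  then have "unit_of R (inverse u powi k * w) \<and> z = (t * u) powi k * (inverse u powi k * w)"
    using assms unit_mult unit_powi unit_inverse
    by (auto simp: power_int_mult_distrib power_int_inverse unit_of_def)
  then show "\<exists>k w. unit_of R w \<and> z = (t * u) powi k * w" by blast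
qed

end

subsection \<open>Existence of valuation rings\<close>

lemma poly_altdef_le:
  fixes c :: "'a::comm_ring_1"
  shows "degree p \<le> d \<Longrightarrow> poly p c = (\<Sum>i\<le>d. coeff p i * c ^ i)"
  unfolding poly_altdef by (rule sum.mono_neutral_left) (auto simp: coeff_eq_0)

lemma adjoin_subring:
  fixes c :: "'f::field"
  assumes sM: "is_subring M"
  defines "S \<equiv> {poly p c | p. \<forall>i. coeff p i \<in> M}"
  shows "is_subring S" "M \<subseteq> S" "c \<in> S"
proof -
  note cl = is_subring_closed[OF sM]
  show "is_subring S"
    unfolding is_subring_def
  proof (intro conjI ballI)
    show "0 \<in> S" unfolding S_def using cl by (auto intro!: exI[of _ 0])
    show "1 \<in> S" unfolding S_def using cl by (auto intro!: exI[of _ 1] simp: coeff_1)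
    fix a b assume "a \<in> S" "b \<in> S"
    then obtain p p' where p: "a = poly p c" "b = poly p' c" "\<forall>i. coeff p i \<in> M" "\<forall>i. coeff p' i \<in> M"
      by (auto simp: S_def)
    then show "a - b \<in> S" unfolding S_def using cl by (auto intro!: exI[of _ "p - p'"])
    have "\<forall>i. coeff (p * p') i \<in> M" using p cl
      by (auto simp: coeff_mult intro!: is_subring_sum[OF sM])
    then show "a * b \<in> S" unfolding S_def using p by (auto intro!: exI[of _ "p * p'"])
  qed
  show "M \<subseteq> S"
  proof
    fix a assume "a \<in> M"
    then show "a \<in> S" unfolding S_def using cl(1)
      by (auto intro!: exI[of _ "[:a:]"] simp: coeff_pCons split: nat.splits)
  qed
  show "c \<in> S" unfolding S_def using cl
    by (auto intro!: exI[of _ "[:0,1:]"] simp: coeff_pCons split: nat.splits)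
qed

text \<open>Chevalley's extension argument: a subring maximal among those that contain
  \<open>B\<close> and avoid \<open>inverse z\<close> is a valuation ring. The existence of the
  place at infinity and of the finite places rests on it.\<close>

lemma valuation_ring_exists:
  fixes emb :: "'k::field \<Rightarrow> 'f::field"
  assumes emb: "field_embedding emb" and B: "is_subring B" "range emb \<subseteq> B" "z \<in> B" "inverse z \<notin> B"
  obtains R where "valuation_ring emb R" "B \<subseteq> R" "inverse z \<notin> R"
proof -
  define \<S> where "\<S> = {S. is_subring S \<and> B \<subseteq> S \<and> inverse z \<notin> S}"
  have "B \<in> \<S>" using B by (simp add: \<S>_def)
  have "\<exists>M\<in>\<S>. \<forall>X\<in>\<S>. M \<subseteq> X \<longrightarrow> X = M"
  proof (rule subset_Zorn_nonempty)
    show "\<S> \<noteq> {}" using \<open>B \<in> \<S>\<close> by blast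
    fix C assume C: "C \<noteq> {}" "subset.chain \<S> C"
    have sub: "S \<in> C \<Longrightarrow> S \<in> \<S>" for S using C by (auto simp: subset.chain_def)
    have "is_subring (\<Union>C)"
      unfolding is_subring_def
    proof (intro conjI ballI)
      show "0 \<in> \<Union>C" "1 \<in> \<Union>C" using C(1) sub by (auto simp: \<S>_def is_subring_def)
      fix a b assume "a \<in> \<Union>C" "b \<in> \<Union>C"
      then obtain S T where ST: "S \<in> C" "T \<in> C" "a \<in> S" "b \<in> T" by blast
      then have "S \<subseteq> T \<or> T \<subseteq> S" using C(2) by (auto simp: subset.chain_def)
      then obtain U where "U \<in> C" "a \<in> U" "b \<in> U" using ST by blast
      then show "a - b \<in> \<Union>C" "a * b \<in> \<Union>C" using sub[of U] by (auto simp: \<S>_def is_subring_def)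
    qed
    then show "\<Union>C \<in> \<S>" using C(1) sub by (auto simp: \<S>_def)
  qed
  then obtain M where M: "M \<in> \<S>" and max: "\<And>X. X \<in> \<S> \<Longrightarrow> M \<subseteq> X \<Longrightarrow> X = M" by blast
  have sM: "is_subring M" and BM: "B \<subseteq> M" and zM: "inverse z \<notin> M" using M by (auto simp: \<S>_def)
  note cl = is_subring_closed[OF sM]
  have z: "z \<in> M" "z \<noteq> 0" using B BM zM cl by auto
  \<comment> \<open>Expressions in \<open>c\<close> over \<open>M\<close> with a bound on the
    degree, as needed for the minimality argument in \<open>key\<close>.\<close>
  define G where "G c d = {poly p c | p. (\<forall>i. coeff p i \<in> M) \<and> degree p \<le> d}" for c d
  have G_add: "a + b \<in> G c d" if ab: "a \<in> G c d" "b \<in> G c d" for a b c d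
  proof -
    obtain p p' where "a = poly p c" "b = poly p' c" "\<forall>i. coeff p i \<in> M" "\<forall>i. coeff p' i \<in> M"
      "degree p \<le> d" "degree p' \<le> d" using ab unfolding G_def by blast
    then show ?thesis unfolding G_def using cl
      by (auto intro!: exI[of _ "p + p'"] degree_add_le)
  qed
  have G_mono: "a * c ^ i \<in> G c d" if "a \<in> M" "i \<le> d" for a c i d
    unfolding G_def using that cl
    by (auto intro!: exI[of _ "monom a i"] simp: poly_monom coeff_monom intro: order.trans[OF degree_monom_le])
  have G_sum: "sum f I \<in> G c d" if "\<And>i. i \<in> I \<Longrightarrow> f i \<in> G c d" for f c d and I :: "nat set"
  proof -
    have "0 \<in> G c d" using G_mono[of 0 0 d c] cl by simp
    then show ?thesis using that
      by (induction I rule: infinite_finite_induct) (auto simp: G_add)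
  qed
  have adjoin: "\<exists>d. inverse z \<in> G c d" if "c \<notin> M" for c
  proof -
    define S where "S = {poly p c | p. \<forall>i. coeff p i \<in> M}"
    note S = adjoin_subring[OF sM, of c, folded S_def]
    then have "S \<notin> \<S>" using max[of S] that by blast
    then have "inverse z \<in> S" using S BM by (auto simp: \<S>_def)
    then show ?thesis by (auto simp: S_def G_def)
  qed
  \<comment> \<open>Puts \<open>z\<close> into the Jacobson radical of \<open>M\<close>: clearing
    denominators in an expression of \<open>inverse z\<close> through \<open>inverse s\<close> gives
    an element \<open>inverse z * s ^ k\<close> of \<open>M\<close>; but \<open>s ^ k\<close> is 1
    modulo \<open>z\<close>, so \<open>inverse z\<close> itself would lie in
    \<open>M\<close>.\<close>
  have local: "inverse s \<in> M" if s: "s = 1 - w * z" "w \<in> M" for s w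
  proof (rule ccontr)
    assume "inverse s \<notin> M"
    then obtain d where "inverse z \<in> G (inverse s) d" using adjoin by blast
    then obtain p where p: "inverse z = poly p (inverse s)" "\<forall>i. coeff p i \<in> M"
      by (auto simp: G_def)
    have sM: "s \<in> M" using s cl z by simp
    have s0: "s \<noteq> 0"
    proof
      assume "s = 0"
      then have "w = inverse z" using s z by (simp add: field_simps)
      then show False using s zM by simp
    qed
    have "inverse z * s ^ degree p = (\<Sum>i\<le>degree p. coeff p i * s ^ (degree p - i))"
      unfolding p(1) poly_altdef sum_distrib_right
      using s0 by (intro sum.cong) (auto simp: field_simps simp flip: power_add)
    also have "\<dots> \<in> M" using p cl sM by (intro is_subring_sum) (auto simp: \<open>is_subring M\<close>)
    finally have a: "inverse z * s ^ degree p \<in> M" .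
    have "\<exists>w'\<in>M. s ^ k = 1 - w' * z" for k
    proof (induction k)
      case 0 show ?case using cl by (auto intro: bexI[of _ 0])
    next
      case (Suc k)
      then obtain w' where "w' \<in> M" "s ^ k = 1 - w' * z" by blast
      moreover from this have "s ^ Suc k = (1 - w * z) * (1 - w' * z)" by (simp add: s(1))
      then have "s ^ Suc k = 1 - (w' + w - w * w' * z) * z" by (simp add: algebra_simps)
      moreover have "w' + w - w * w' * z \<in> M" using s z calculation(1) by (simp add: cl)
      ultimately show ?case by blast
    qed
    then obtain w' where "w' \<in> M" "s ^ degree p = 1 - w' * z" by blast
    then have "inverse z * s ^ degree p + w' = inverse z" using z by (simp add: field_simps)
    then show False using a \<open>w' \<in> M\<close> cl zM by metis
  qed
  \<comment> \<open>Two expressions of \<open>inverse z\<close> are played off against each other: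
    one in \<open>c\<close> of minimal degree \<open>d\<close>, one in \<open>inverse c\<close> of
    degree \<open>e \<le> d\<close>. Since \<open>1 - coeff p' 0 * z\<close> is invertible, the
    second writes \<open>c ^ d\<close> through lower powers of \<open>c\<close>, which lowers the
    degree of the first.\<close>
  have key: False if c: "c \<noteq> 0" "c \<notin> M" "inverse z \<in> G c d" "inverse z \<in> G (inverse c) e" "e \<le> d"
    "\<And>d'. inverse z \<in> G c d' \<Longrightarrow> d \<le> d'" for c d e
  proof -
    obtain p where p: "inverse z = poly p c" "\<forall>i. coeff p i \<in> M" "degree p \<le> d" using c
      by (auto simp: G_def)
    obtain p' where p': "inverse z = poly p' (inverse c)" "\<forall>i. coeff p' i \<in> M" "degree p' \<le> e"
      using c by (auto simp: G_def)
    have e: "inverse z = (\<Sum>i\<le>d. coeff p i * c ^ i)" unfolding p(1) using p(3)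
      by (rule poly_altdef_le)
    have e': "inverse z = (\<Sum>i\<le>e. coeff p' i * inverse c ^ i)" unfolding p'(1) using p'(3)
      by (rule poly_altdef_le)
    have "d \<noteq> 0" using e p(2) zM by (intro notI) auto
    define s where "s = 1 - coeff p' 0 * z"
    have si: "inverse s \<in> M" using local[of s "coeff p' 0"] p'(2) by (simp add: s_def)
    have s0: "s \<noteq> 0"
    proof
      assume "s = 0"
      then have "coeff p' 0 = inverse z" using z by (simp add: s_def field_simps)
      then show False using p'(2) zM by metis
    qed
    have "inverse z = coeff p' 0 + (\<Sum>i=1..e. coeff p' i * inverse c ^ i)"
      unfolding e' by (simp add: atMost_atLeast0 sum.atLeast_Suc_atMost)
    then have "s = z * (\<Sum>i=1..e. coeff p' i * inverse c ^ i)"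
      using z by (simp add: s_def field_simps)
    then have "1 = inverse s * (z * (\<Sum>i=1..e. coeff p' i * inverse c ^ i))" using s0
      by (metis left_inverse)
    then have "c ^ d = inverse s * (z * (\<Sum>i=1..e. coeff p' i * inverse c ^ i)) * c ^ d" by simp
    also have "\<dots> = (\<Sum>i=1..e. inverse s * z * coeff p' i * (inverse c ^ i * c ^ d))"
      unfolding sum_distrib_left sum_distrib_right by (intro sum.cong) (simp_all only: mult.assoc)
    also have "\<dots> = (\<Sum>i=1..e. inverse s * z * coeff p' i * c ^ (d - i))"
      using \<open>e \<le> d\<close> \<open>c \<noteq> 0\<close> by (intro sum.cong) (auto simp: power_inverse power_diff field_simps)
    finally have cd: "c ^ d = (\<Sum>i=1..e. inverse s * z * coeff p' i * c ^ (d - i))" .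
    have "inverse z = (\<Sum>i<d. coeff p i * c ^ i) + coeff p d * c ^ d"
      unfolding e by (simp add: lessThan_Suc_atMost[symmetric])
    also have "coeff p d * c ^ d = (\<Sum>i=1..e. coeff p d * inverse s * z * coeff p' i * c ^ (d - i))"
      unfolding cd by (simp add: sum_distrib_left mult.assoc)
    finally have "inverse z = (\<Sum>i<d. coeff p i * c ^ i) +
      (\<Sum>i=1..e. coeff p d * inverse s * z * coeff p' i * c ^ (d - i))" .
    moreover have "\<dots> \<in> G c (d - 1)"
      using \<open>d \<noteq> 0\<close> p(2) p'(2) si z cl by (intro G_add G_sum G_mono) auto
    ultimately have "inverse z \<in> G c (d - 1)" by simp
    then show False using c(6)[of "d - 1"] \<open>d \<noteq> 0\<close> by simp
  qed
  have tot: "c \<in> M \<or> inverse c \<in> M" for c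
  proof (rule ccontr)
    assume c: "\<not> (c \<in> M \<or> inverse c \<in> M)"
    then have c0: "c \<noteq> 0" using cl by auto
    define d where "d = (LEAST d. inverse z \<in> G c d)"
    define e where "e = (LEAST d. inverse z \<in> G (inverse c) d)"
    have d: "inverse z \<in> G c d" "\<And>d'. inverse z \<in> G c d' \<Longrightarrow> d \<le> d'"
      using adjoin[of c] c unfolding d_def by (auto intro: LeastI_ex Least_le)
    have e: "inverse z \<in> G (inverse c) e" "\<And>d'. inverse z \<in> G (inverse c) d' \<Longrightarrow> e \<le> d'"
      using adjoin[of "inverse c"] c unfolding e_def by (auto intro: LeastI_ex Least_le)
    show False
      using key[of c d e] key[of "inverse c" e d] d e c c0 by (cases "e \<le> d") auto
  qed
  have "valuation_ring emb M"
    unfolding valuation_ring_def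
  proof (intro conjI allI)
    \<comment> \<open>Makes \<open>range emb\<close> a proper subset of \<open>M\<close>, with
      \<open>z\<close> as witness: the inverse of a constant would lie in \<open>B\<close>.\<close>
    have "z \<notin> range emb"
    proof
      assume "z \<in> range emb"
      then obtain c where c: "z = emb c" by blast
      have "emb 0 = 0" using emb unfolding field_embedding_def by (metis add_cancel_right_right)
      then have "c \<noteq> 0" using c z by auto
      then have "emb (inverse c) * z = 1" using emb unfolding field_embedding_def c
        by (metis left_inverse)
      then have "emb (inverse c) = inverse z" using z by (metis inverse_unique mult.commute)
      then show False using zM B BM by (metis rangeI subsetD)
    qed
    then show "range emb \<subset> M" using B BM z by blast
    show "M \<subset> UNIV" using zM by auto
  qed (use sM tot in auto)
  then show ?thesis using that BM zM by blast
qed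

subsection \<open>Additive polynomials in characteristic two\<close>

lemma char2_neg:
  fixes a :: "'a::comm_ring_1"
  assumes "(1::'a) + 1 = 0"
  shows "a + a = 0" "- a = a" "a - b = a + b"
proof -
  show *: "a + a = 0" for a :: 'a using assms
    by (metis distrib_left mult.right_neutral mult_zero_right)
  show "- a = a" for a :: 'a using *[of a] by (metis minus_unique)
  then show "a - b = a + b" by (metis add_uminus_conv_diff)
qed

lemma char2_frobenius:
  fixes a b :: "'a::comm_ring_1"
  assumes "(1::'a) + 1 = 0"
  shows "(a + b) ^ (2 ^ k) = a ^ (2 ^ k) + b ^ (2 ^ k)"
proof (induction k)
  case (Suc k)
  have *: "(c + d)\<^sup>2 = c\<^sup>2 + d\<^sup>2" for c d :: 'a
    using char2_neg(1)[OF assms, of "c * d"] by (simp add: power2_eq_square algebra_simps)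
  have "(a + b) ^ (2 ^ Suc k) = ((a + b) ^ (2 ^ k))\<^sup>2" by (simp add: mult.commute flip: power_mult)
  also have "\<dots> = a ^ (2 ^ Suc k) + b ^ (2 ^ Suc k)" unfolding Suc *
    by (simp add: mult.commute flip: power_mult)
  finally show ?case .
qed simp

lemma char2_frobenius_sum:
  fixes f :: "'i \<Rightarrow> 'a::comm_ring_1"
  assumes "(1::'a) + 1 = 0"
  shows "(\<Sum>i\<in>I. f i) ^ (2 ^ k) = (\<Sum>i\<in>I. f i ^ (2 ^ k))"
  by (induction I rule: infinite_finite_induct) (auto simp: char2_frobenius[OF assms] power_0_left)

lemma h_poly_add:
  fixes a b :: "'a::field"
  assumes "(1::'a) + 1 = 0"
  shows "h_poly n (a + b) = h_poly n a + h_poly n b"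
  by (simp add: h_poly_def char2_frobenius[OF assms] sum.distrib)

lemma h_poly_square:
  fixes a :: "'a::field"
  assumes "(1::'a) + 1 = 0"
  shows "h_poly n (a ^ 2) = h_poly n a ^ 2"
  using char2_frobenius_sum[OF assms, of "\<lambda>i. a ^ 2 ^ i" "{..<n}" 1]
  by (simp add: h_poly_def mult.commute flip: power_mult)

text \<open>Squaring shifts the summands of \<open>h\<close> by one place, so the sum telescopes. In
  particular zeros of \<open>h\<close> are fixed by the power \<open>2 ^ n\<close>; this drives both
  \<open>frobenius_cong\<close> and \<open>translate\<close>.\<close>

lemma h_poly_telescope:
  fixes a :: "'a::field"
  assumes c2: "(1::'a) + 1 = 0"
  shows "h_poly n a ^ 2 + h_poly n a = a ^ (2 ^ n) + a"
proof (induction n)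
  case 0 show ?case using char2_neg[OF c2, of a] by (simp add: h_poly_def)
next
  case (Suc n)
  have "h_poly (Suc n) a = h_poly n a + a ^ 2 ^ n" by (simp add: h_poly_def)
  then have "h_poly (Suc n) a ^ 2 + h_poly (Suc n) a =
    (h_poly n a ^ 2 + h_poly n a) + (a ^ 2 ^ Suc n + a ^ 2 ^ n)"
    using char2_frobenius[OF c2, of "h_poly n a" "a ^ 2 ^ n" 1, unfolded power_one_right]
    by (simp only: mult.commute add_ac power_Suc flip: power_mult)
  also have "\<dots> = a ^ 2 ^ Suc n + a + (a ^ 2 ^ n + a ^ 2 ^ n)" unfolding Suc by (simp add: add_ac)
  finally show ?case by (simp add: char2_neg[OF c2])
qed

lemma finite_field_char2:
  assumes "CARD('k::{field,finite}) = 2 ^ k"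
  shows "(1::'k) + 1 = 0"
proof -
  \<comment> \<open>Translation by 1 permutes the field, so the sum of all elements equals itself
    plus \<open>CARD('k)\<close> copies of 1.\<close>
  have "(\<Sum>a\<in>(UNIV::'k set). a) = (\<Sum>a\<in>(UNIV::'k set). a + 1)"
    by (rule sum.reindex_bij_witness[of _ "\<lambda>a. a + 1" "\<lambda>a. a - 1"]) auto
  then have "of_nat CARD('k) = (0::'k)" by (simp add: sum.distrib)
  then have "(2::'k) ^ k = 0" by (simp add: assms)
  then have "(2::'k) = 0" by simp
  then show ?thesis by simp
qed

lemma power_card_UNIV:
  fixes a :: "'k::{field,finite}"
  shows "a ^ CARD('k) = a"
proof (cases "a = 0")
  case False
  have "(\<Prod>b\<in>UNIV - {0}. b) = (\<Prod>b\<in>UNIV - {0}. a * b)"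
    by (rule prod.reindex_bij_witness[of _ "\<lambda>b. a * b" "\<lambda>b. b / a"]) (use False in auto)
  also have "\<dots> = a ^ (CARD('k) - 1) * (\<Prod>b\<in>UNIV - {0}. b)"
    by (simp add: prod.distrib card_Diff_singleton)
  finally have "a ^ (CARD('k) - 1) = 1" by simp
  then show ?thesis
    by (metis One_nat_def Suc_pred finite_UNIV_card_ge_0 finite mult.right_neutral power_Suc)
qed simp

subsection \<open>The curve and its affine coordinate ring\<close>

text \<open>The generators are parameters so that the locale can be interpreted again at other
  coordinates of the same field. \<open>r\<close> stands for \<open>q / 2\<close>. The last
  assumption, that every value of \<open>x\<close> has the full number of rational points above it,
  comes in the theorem from the enumeration \<open>ys\<close>.\<close>

locale Y2_curve =
  fixes n r :: nat and emb :: "'k::{field,finite} \<Rightarrow> 'f::field" and x y :: 'f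
  assumes n2: "n \<ge> 2" and r_eq: "r = 2 ^ (n - 1)" and card_K: "CARD('k) = (2 * r)\<^sup>2"
    and Y2: "Y2_function_field n emb x y"
    and fib: "\<And>a::'k. card {b. h_poly n b = a ^ (2 * r + 1)} = r"
begin

lemma two_r: "2 ^ n = 2 * r" using n2 r_eq by (simp add: power_Suc[symmetric] Suc_diff_le)
lemma r2: "r \<ge> 2"
proof -
  have "2 ^ 1 \<le> (2::nat) ^ (n - 1)" using n2 by (intro power_increasing) auto
  then show ?thesis using r_eq by simp
qed

definition Q :: nat where "Q = CARD('k)"

lemma Q_pow2: "Q = 2 ^ (2 * n)"
  unfolding Q_def card_K two_r[symmetric] by (simp only: mult.commute flip: power_mult)
lemma Q_eq: "Q = 4 * r * r" by (simp add: Q_def card_K power2_eq_square)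

lemma c2K: "(1::'k) + 1 = 0" using finite_field_char2[of "2 * n"] Q_pow2 by (simp add: Q_def)

lemma emb: "field_embedding emb" and trans: "transcendental_over emb x"
  and eqn: "h_poly n y = x ^ (2 * r + 1)" and gen: "field_adjoin emb {x, y} = UNIV"
  using Y2 by (auto simp: Y2_function_field_def two_r)

lemma emb_1 [simp]: "emb 1 = 1" and emb_add: "emb (a + b) = emb a + emb b"
  and emb_mult: "emb (a * b) = emb a * emb b"
  using emb by (auto simp: field_embedding_def)
lemma emb_0 [simp]: "emb 0 = 0" using emb_add[of 0 0] by (metis add_cancel_right_right)
lemma emb_uminus: "emb (- a) = - emb a" using emb_add[of a "-a"]
  by (simp add: eq_neg_iff_add_eq_0 add.commute)
lemma emb_diff: "emb (a - b) = emb a - emb b" using emb_add[of a "-b"] by (simp add: emb_uminus)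
lemma emb_power: "emb (a ^ k) = emb a ^ k" by (induction k) (auto simp: emb_mult)
lemma emb_inverse: "emb (inverse a) = inverse (emb a)"
proof (cases "a = 0")
  case False
  then have "emb a * emb (inverse a) = 1" using emb_mult[of a "inverse a"] by simp
  then show ?thesis by (metis inverse_unique)
qed simp
lemma emb_eq_0 [simp]: "emb a = 0 \<longleftrightarrow> a = 0"
proof
  assume "emb a = 0"
  then show "a = 0" using emb_mult[of a "inverse a"] by (cases "a = 0") auto
qed simp
lemma emb_eq [simp]: "emb a = emb b \<longleftrightarrow> a = b"
  using emb_eq_0[of "a - b"] by (simp add: emb_diff)
lemma emb_sum: "emb (sum f I) = (\<Sum>i\<in>I. emb (f i))"
  by (induction I rule: infinite_finite_induct) (auto simp: emb_add)
lemma c2F: "(1::'f) + 1 = 0" using emb_add[of 1 1] by (simp only: c2K emb_1 emb_0)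
lemmas char2 = char2_neg[OF c2F]
lemma h_emb: "h_poly n (emb a) = emb (h_poly n a)" by (simp add: h_poly_def emb_sum emb_power)

lemma emb_Q: "emb a ^ Q = emb a"
  using power_card_UNIV[of a] by (simp add: Q_def flip: emb_power)

lemma h_lead: "h_poly n (z::'f) = z ^ r + (\<Sum>i<n-1. z ^ 2 ^ i)"
proof -
  have "n = Suc (n - 1)" using n2 by simp
  then have "{..<n} = insert (n - 1) {..<n-1}" by auto
  then show ?thesis unfolding h_poly_def r_eq by simp
qed

sublocale V: vector_space "\<lambda>c f. emb c * f"
  by unfold_locales (auto simp: emb_add emb_mult algebra_simps)

definition mon :: "nat \<times> nat \<Rightarrow> 'f" where "mon p = x ^ fst p * y ^ snd p"
text \<open>Turns out to be the pole order at infinity, to which \<open>x\<close> contributes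
  \<open>r\<close> and \<open>y\<close> contributes \<open>2 * r + 1\<close>.\<close>

definition wt :: "nat \<times> nat \<Rightarrow> nat" where "wt p = fst p * r + snd p * (2 * r + 1)"
definition red :: "(nat \<times> nat) set" where "red = {p. snd p < r}"
definition A :: "'f set" where "A = V.span (mon ` red)"

text \<open>The bound is an integer because the dual of a code may belong to a negative order, where
  the space is zero.\<close>

definition L :: "int \<Rightarrow> 'f set" where "L m = V.span (mon ` {p \<in> red. int (wt p) \<le> m})"

lemma wt_inj: assumes "p \<in> red" "p' \<in> red" "wt p = wt p'" shows "p = p'"
proof -
  have "wt s = snd s + (fst s + 2 * snd s) * r" for s by (simp add: wt_def algebra_simps)
  then have "wt s mod r = snd s \<and> wt s div r = fst s + 2 * snd s" if "s \<in> red" for s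
    using that by (auto simp: red_def)
  then show ?thesis using assms by (metis add_right_cancel prod.expand)
qed

lemma A_0: "0 \<in> A" and A_add: "a \<in> A \<Longrightarrow> b \<in> A \<Longrightarrow> a + b \<in> A" and A_scale: "a \<in> A \<Longrightarrow> emb c * a \<in> A"
  and A_diff: "a \<in> A \<Longrightarrow> b \<in> A \<Longrightarrow> a - b \<in> A"
  by (auto simp: A_def V.span_zero V.span_add V.span_scale V.span_diff)

lemma A_induct [consumes 1, case_names zero step]:
  assumes "f \<in> A" "Pr 0" "\<And>c p g. p \<in> red \<Longrightarrow> g \<in> A \<Longrightarrow> Pr g \<Longrightarrow> Pr (emb c * mon p + g)"
  shows "Pr f"
proof -
  have "f \<in> A \<and> Pr f"
    using assms(1) unfolding A_def
  proof (induction rule: V.span_induct_alt)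
    case base then show ?case using assms(2) V.span_zero by auto
  next
    case (step c m g)
    then show ?case using assms(3)[of _ g c]
      by (auto simp: A_def intro!: V.span_add V.span_scale intro: V.span_base)
  qed
  then show ?thesis ..
qed

lemma mon_A: "p \<in> red \<Longrightarrow> mon p \<in> A" by (simp add: A_def V.span_base)

lemma A_x: "f \<in> A \<Longrightarrow> x * f \<in> A"
proof (induction rule: A_induct)
  case (step c p g)
  have "x * mon p = mon (Suc (fst p), snd p)" by (simp add: mon_def)
  moreover have "(Suc (fst p), snd p) \<in> red" using step by (simp add: red_def)
  ultimately have "x * mon p \<in> A" using mon_A by metis
  then have "emb c * (x * mon p) + x * g \<in> A" using step A_add A_scale by blast
  then show ?case by (simp add: algebra_simps)
qed (simp add: A_0)

lemma A_xpow: "f \<in> A \<Longrightarrow> x ^ k * f \<in> A"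
  by (induction k) (auto simp: A_x mult.assoc)

lemma A_sum: "(\<And>i. i \<in> I \<Longrightarrow> f i \<in> A) \<Longrightarrow> sum f I \<in> A"
  by (induction I rule: infinite_finite_induct) (auto simp: A_0 A_add)

lemma pow_less_r: "i < n - 1 \<Longrightarrow> 2 ^ i < r" by (simp add: r_eq)

lemma y_r: "y ^ r = x ^ (2 * r + 1) - (\<Sum>i<n-1. y ^ 2 ^ i)"
  using eqn h_lead[of y] by (simp add: algebra_simps)

text \<open>The curve equation is monic of degree \<open>r\<close> in \<open>y\<close>, so it
  reduces the exponent as soon as it reaches \<open>r\<close>; this makes the span of the reduced
  monomials a ring.\<close>

lemma A_y: "f \<in> A \<Longrightarrow> y * f \<in> A"
proof (induction rule: A_induct)
  case (step c p g)
  have "y * mon p \<in> A"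
  proof (cases "Suc (snd p) < r")
    case True
    then have "mon (fst p, Suc (snd p)) \<in> A" by (intro mon_A) (simp add: red_def)
    then show ?thesis by (simp add: mon_def mult_ac)
  next
    case False
    then have "Suc (snd p) = r" using step by (simp add: red_def)
    then have "y * mon p = x ^ fst p * y ^ r" by (auto simp: mon_def)
    also have "\<dots> = x ^ fst p * (mon (2 * r + 1, 0) - (\<Sum>i<n-1. mon (0, 2 ^ i)))"
      unfolding y_r by (simp add: mon_def)
    also have "\<dots> \<in> A" using r2 pow_less_r
      by (intro A_xpow A_diff A_sum mon_A) (auto simp: red_def)
    finally show ?thesis .
  qed
  then have "emb c * (y * mon p) + y * g \<in> A" using step A_add A_scale by blast
  then show ?case by (simp add: algebra_simps)
qed (simp add: A_0)

lemma A_ypow: "f \<in> A \<Longrightarrow> y ^ k * f \<in> A"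
  by (induction k) (auto simp: A_y mult.assoc)

lemma A_mult: "f \<in> A \<Longrightarrow> g \<in> A \<Longrightarrow> f * g \<in> A"
proof (induction rule: A_induct)
  case (step c p f)
  have "mon p * g \<in> A" using A_xpow[OF A_ypow[OF step(4)]] by (simp add: mon_def mult.assoc)
  then have "emb c * (mon p * g) + f * g \<in> A" using step A_add A_scale by blast
  then show ?case by (simp add: algebra_simps)
qed (simp add: A_0)

lemma A_1: "1 \<in> A" using mon_A[of "(0,0)"] r2 by (simp add: mon_def red_def)
lemma A_subring: "is_subring A" by (simp add: is_subring_def A_0 A_1 A_diff A_mult)
lemmas A_closed = is_subring_closed[OF A_subring]
lemma A_emb: "emb c \<in> A" using A_scale[OF A_1] by simp
lemma xA: "x \<in> A" using A_x[OF A_1] by simp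
lemma yA: "y \<in> A" using A_y[OF A_1] by simp
lemma h_subring: "is_subring B \<Longrightarrow> z \<in> B \<Longrightarrow> h_poly n z \<in> B"
  unfolding h_poly_def by (intro is_subring_sum) (auto simp: is_subring_closed)

lemma A_minimal:
  assumes "is_subring B" "range emb \<subseteq> B" "x \<in> B" "y \<in> B" shows "A \<subseteq> B"
proof
  fix f assume "f \<in> A"
  then show "f \<in> B"
  proof (induction rule: A_induct)
    case (step c p g)
    moreover have "emb c \<in> B" using assms(2) by blast
    ultimately show ?case using assms by (simp add: mon_def is_subring_closed)
  qed (simp add: is_subring_closed[OF assms(1)])
qed

lemma subfield_UNIV:
  assumes "is_subfield B" "range emb \<subseteq> B" "x \<in> B" "y \<in> B" shows "B = UNIV"
proof -
  have "B \<in> {S. is_subfield S \<and> range emb \<union> {x, y} \<subseteq> S}" using assms by blast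
  then have "field_adjoin emb {x, y} \<subseteq> B" unfolding field_adjoin_def by (rule Inter_lower)
  then show ?thesis using gen by auto
qed

text \<open>The fractions of \<open>A\<close> form a subfield containing the generators, hence they
  are the whole field.\<close>

lemma frac_A: obtains g d where "g \<in> A" "d \<in> A" "d \<noteq> 0" "z = g / d"
proof -
  let ?B = "{g / d | g d. g \<in> A \<and> d \<in> A \<and> d \<noteq> 0}"
  have AB: "A \<subseteq> ?B" using A_1 by (smt (verit) div_by_1 mem_Collect_eq one_neq_zero subsetI)
  have "is_subfield ?B"
    unfolding is_subfield_def is_subring_def
  proof (intro conjI ballI)
    show "0 \<in> ?B" "1 \<in> ?B" using AB A_0 A_1 by blast+
    fix a assume "a \<in> ?B"
    then obtain g d where gd: "a = g / d" "g \<in> A" "d \<in> A" "d \<noteq> 0" by blast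
    show "inverse a \<in> ?B"
    proof (cases "g = 0")
      case True then show ?thesis using gd AB A_0 by auto
    next
      case False
      then have "inverse a = d / g" using gd by simp
      then show ?thesis using gd False by blast
    qed
    fix b assume "b \<in> ?B"
    then obtain g' d' where gd': "b = g' / d'" "g' \<in> A" "d' \<in> A" "d' \<noteq> 0" by blast
    have "a - b = (g * d' - g' * d) / (d * d')" "a * b = (g * g') / (d * d')"
      using gd gd' by (auto simp: field_simps)
    then show "a - b \<in> ?B" "a * b \<in> ?B" using gd gd' by (auto simp: A_closed intro!: exI)
  qed
  then have "?B = UNIV" using AB A_emb xA yA by (intro subfield_UNIV) auto
  then show ?thesis using that by blast
qed

lemma span_wt_bound:
  assumes "f \<in> V.span (mon ` I)" shows "\<exists>k. f \<in> V.span (mon ` {p \<in> I. wt p < k})"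
  using assms
proof (induction rule: V.span_induct_alt)
  case base then show ?case using V.span_zero by blast
next
  case (step c m g)
  then obtain k p where k: "g \<in> V.span (mon ` {p \<in> I. wt p < k})" "m = mon p" "p \<in> I" by auto
  define l where "l = max k (Suc (wt p))"
  have "g \<in> V.span (mon ` {p \<in> I. wt p < l})"
    using V.span_mono[of "mon ` {p \<in> I. wt p < k}" "mon ` {p \<in> I. wt p < l}"] k
      by (force simp: l_def)
  moreover have "m \<in> V.span (mon ` {p \<in> I. wt p < l})"
    using k by (intro V.span_base) (auto simp: l_def)
  ultimately show ?case using V.span_add V.span_scale by blast
qed

text \<open>Distinct weights give each non-zero combination a single monomial of largest weight. The
  index set is left open because it is applied to bounded boxes as well as to all of
  \<open>red\<close>.\<close>

lemma lead_term:
  assumes "f \<in> V.span (mon ` I)" "I \<subseteq> red" "f \<noteq> 0"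
  obtains p c where "p \<in> I" "c \<noteq> 0" "f - emb c * mon p \<in> V.span (mon ` {p' \<in> I. wt p' < wt p})"
proof -
  obtain k where "f \<in> V.span (mon ` {p \<in> I. wt p < k})" using span_wt_bound assms by blast
  then have "\<exists>p\<in>I. \<exists>c. c \<noteq> 0 \<and> f - emb c * mon p \<in> V.span (mon ` {p' \<in> I. wt p' < wt p})"
  proof (induction k)
    case 0 then show ?case using assms by simp
  next
    case (Suc k)
    show ?case
    proof (cases "\<exists>p\<in>I. wt p = k")
      case True
      then obtain p where p: "p \<in> I" "wt p = k" by blast
      have "{p \<in> I. wt p < Suc k} = insert p {p' \<in> I. wt p' < k}"
        using p assms(2) by (auto simp: less_Suc_eq dest: wt_inj)
      then have "f \<in> V.span (insert (mon p) (mon ` {p' \<in> I. wt p' < k}))" using Suc.prems by simp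
      then obtain c where c: "f - emb c * mon p \<in> V.span (mon ` {p' \<in> I. wt p' < k})"
        using V.span_breakdown_eq by blast
      show ?thesis
      proof (cases "c = 0")
        case True then show ?thesis using c Suc.IH by simp
      next
        case False then show ?thesis using c p by auto
      qed
    next
      case False
      then have "{p \<in> I. wt p < Suc k} = {p \<in> I. wt p < k}" by (auto simp: less_Suc_eq)
      then show ?thesis using Suc by simp
    qed
  qed
  then show ?thesis using that by blast
qed

subsection \<open>The place at infinity\<close>

text \<open>The pole orders \<open>2 * r\<close> of \<open>x ^ 2\<close> and
  \<open>2 * r + 1\<close> of \<open>y\<close> differ by one, so the quotient has a simple zero at
  infinity.\<close>

definition tinf :: 'f where "tinf = x ^ 2 * inverse y"

lemma x0: "x \<noteq> 0"
proof
  assume "x = 0"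
  have "poly (map_poly emb [:0, 1:]) x \<noteq> 0" using trans unfolding transcendental_over_def
    by (metis one_neq_zero pCons_eq_0_iff)
  then show False using \<open>x = 0\<close> by (simp add: map_poly_pCons)
qed
lemma y0: "y \<noteq> 0"
proof
  assume "y = 0"
  then have "h_poly n y = 0" by (simp add: h_poly_def power_0_left)
  then show False using eqn x0 by simp
qed
lemma tinf0: "tinf \<noteq> 0" using x0 y0 by (simp add: tinf_def)
lemma y_tinf: "y * tinf = x ^ 2" using y0 by (simp add: tinf_def)

text \<open>At a pole of \<open>z\<close> the top power \<open>z ^ r\<close> dominates
  \<open>h\<close>: the other summands divided by it are positive powers of
  \<open>inverse z\<close>.\<close>

lemma h_lead_inverse:
  assumes "valuation_ring emb R" "z \<notin> R"
  shows "h_poly n z * inverse z ^ r - 1 \<in> max_ideal R"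
proof -
  interpret val_ring emb R using assms by unfold_locales
  have z0: "z \<noteq> 0" using assms R_closed by auto
  have iz: "inverse z \<in> P" using assms by (simp add: P_iff)
  have "h_poly n z * inverse z ^ r = 1 + (\<Sum>i<n-1. z ^ 2 ^ i * inverse z ^ r)"
    unfolding h_lead using z0 by (simp add: algebra_simps sum_distrib_left power_inverse)
  then have "h_poly n z * inverse z ^ r - 1 = (\<Sum>i<n-1. z ^ 2 ^ i * inverse z ^ r)" by simp
  also have "\<dots> = (\<Sum>i<n-1. inverse z ^ (r - 2 ^ i))"
  proof (rule sum.cong)
    fix i assume "i \<in> {..<n-1}"
    then have "2 ^ i \<le> r" using pow_less_r[of i] by simp
    then have "inverse z ^ r = inverse z ^ (r - 2 ^ i) * inverse z ^ (2 ^ i)"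
      by (simp flip: power_add)
    then show "z ^ 2 ^ i * inverse z ^ r = inverse z ^ (r - 2 ^ i)" using z0
      by (simp add: power_inverse)
  qed simp
  also have "\<dots> \<in> P" using iz pow_less_r by (intro P_sum P_power) auto
  finally show ?thesis .
qed

context
  fixes R assumes vr: "valuation_ring emb R" and xR: "x \<notin> R"
begin

interpretation val_ring emb R using vr by unfold_locales

lemma yR: "y \<notin> R"
proof
  assume "y \<in> R"
  then have "x ^ (2 * r + 1) \<in> R" using h_subring[OF sub] eqn by metis
  then show False using R_integral[of x "2 * r + 1"] xR by simp
qed

lemma eq1_mult: "a - 1 \<in> P \<Longrightarrow> b - 1 \<in> P \<Longrightarrow> a * b - 1 \<in> P"
proof -
  assume a: "a - 1 \<in> P" "b - 1 \<in> P"
  have "a * b - 1 = (a - 1) * (b - 1) + (a - 1) + (b - 1)" by (simp add: algebra_simps)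
  then show ?thesis using a P_add P_mult P_R by metis
qed

lemma eq1_power: "a - 1 \<in> P \<Longrightarrow> a ^ k - 1 \<in> P"
  by (induction k) (auto simp: P_zero eq1_mult)

lemma eq1_unit: "a - 1 \<in> P \<Longrightarrow> unit_of R a" using unit_add_P[OF unit_1, of "a - 1"] by simp

text \<open>The product is \<open>x ^ (2 * r + 1) / y ^ r\<close>, that is
  \<open>h(y) / y ^ r\<close>, which is 1 modulo \<open>P\<close> because \<open>y\<close> has a
  pole.\<close>

lemma x_tinf: "x * tinf ^ r - 1 \<in> P"
proof -
  have "x * tinf ^ r = x ^ (2 * r + 1) * inverse y ^ r"
    by (simp add: tinf_def power_mult_distrib power_mult)
  then show ?thesis using h_lead_inverse[OF vr yR] unfolding eqn by metis
qed

lemma mon_tinf: "mon p * tinf ^ wt p - 1 \<in> P"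
proof -
  \<comment> \<open>One factor \<open>tinf\<close> turns \<open>y\<close> into \<open>x ^ 2\<close>;
    the remaining \<open>2 * r\<close> complete the square of \<open>x * tinf ^ r\<close>.\<close>
  have "y * tinf ^ (2 * r + 1) = (x * tinf ^ r) ^ 2"
    by (simp add: y_tinf[symmetric] power_mult_distrib mult_ac flip: power_mult)
  then have "y * tinf ^ (2 * r + 1) - 1 \<in> P" using eq1_power[OF x_tinf] by metis
  moreover have "mon p * tinf ^ wt p = (x * tinf ^ r) ^ fst p * (y * tinf ^ (2 * r + 1)) ^ snd p"
    by (simp add: mon_def wt_def power_mult_distrib power_add mult_ac flip: power_mult)
  ultimately show ?thesis using eq1_power[OF x_tinf] eq1_power eq1_mult by metis
qed

lemma tinf_P: "tinf \<in> P"
proof -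
  have "inverse x \<in> P" using xR by (simp add: P_iff)
  moreover have "x * tinf ^ r \<in> R" using eq1_unit[OF x_tinf] by (simp add: unit_of_def)
  ultimately have "inverse x * (x * tinf ^ r) \<in> P" using P_mult by blast
  moreover have "inverse x * (x * tinf ^ r) = tinf ^ r" using x0
    by (simp add: mult.assoc[symmetric])
  ultimately have "tinf ^ r \<in> P" by metis
  then show ?thesis using P_prime_power R_integral[of tinf r] P_R r2 by auto
qed

lemma span_lower_P:
  assumes "f \<in> V.span (mon ` {p \<in> I. wt p < D})" shows "f * tinf ^ D \<in> P"
  using assms
proof (induction rule: V.span_induct_alt)
  case (step c m g)
  then obtain p where p: "m = mon p" "wt p < D" by auto
  have "mon p * tinf ^ wt p \<in> R" using eq1_unit[OF mon_tinf] by (simp add: unit_of_def)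
  moreover have "tinf ^ (D - wt p) \<in> P" using tinf_P P_power p by simp
  ultimately have "mon p * tinf ^ wt p * tinf ^ (D - wt p) \<in> P" using P_mult2 by blast
  then have "m * tinf ^ D \<in> P" using p by (simp add: mult.assoc flip: power_add)
  then have "emb c * (m * tinf ^ D) + g * tinf ^ D \<in> P"
    using step P_add P_mult2 emb_in by blast
  then show ?case by (simp add: algebra_simps)
qed (simp add: P_zero)

lemma lead_unit:
  assumes "c \<noteq> 0" "f - emb c * mon p \<in> V.span (mon ` {p' \<in> I. wt p' < wt p})"
  shows "unit_of R (f * tinf ^ wt p)" "f * tinf ^ wt p - emb c \<in> P"
proof -
  have "f * tinf ^ wt p - emb c = (f - emb c * mon p) * tinf ^ wt p + emb c * (mon p * tinf ^ wt p - 1)"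
    by (simp add: algebra_simps)
  also have "\<dots> \<in> P" using span_lower_P[OF assms(2)] mon_tinf P_add P_mult2 emb_in by blast
  finally show *: "f * tinf ^ wt p - emb c \<in> P" .
  have "unit_of R (emb c)" using assms emb_in by (metis unit_of_def emb_eq_0 emb_inverse)
  then show "unit_of R (f * tinf ^ wt p)" using unit_add_P[OF _ *] by fastforce
qed

end

text \<open>The exponent depends only on the leading weights of numerator and denominator, so it
  serves all valuation rings at which \<open>x\<close> has a pole at once. This uniformity is what
  makes the place at infinity unique.\<close>

lemma inf_form:
  assumes "z \<noteq> 0"
  obtains k :: int where
    "\<And>R. valuation_ring emb R \<Longrightarrow> x \<notin> R \<Longrightarrow> \<exists>u. unit_of R u \<and> z = tinf powi k * u"
proof -
  obtain g d where gd: "g \<in> A" "d \<in> A" "d \<noteq> 0" "z = g / d" by (rule frac_A)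
  then have "g \<noteq> 0" using assms by auto
  obtain p c where p: "c \<noteq> 0" "g - emb c * mon p \<in> V.span (mon ` {p' \<in> red. wt p' < wt p})"
    using lead_term[of g red] gd \<open>g \<noteq> 0\<close> unfolding A_def by blast
  obtain p' c' where p': "c' \<noteq> 0" "d - emb c' * mon p' \<in> V.span (mon ` {p'' \<in> red. wt p'' < wt p'})"
    using lead_term[of d red] gd unfolding A_def by blast
  show ?thesis
  proof (rule that[of "int (wt p') - int (wt p)"])
    fix R assume R: "valuation_ring emb R" "x \<notin> R"
    interpret val_ring emb R using R by unfold_locales
    have "unit_of R (g * tinf ^ wt p)" "unit_of R (d * tinf ^ wt p')"
      using lead_unit(1)[OF R] p p' by blast+
    then have "unit_of R (g * tinf ^ wt p * inverse (d * tinf ^ wt p'))"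
      using unit_mult unit_inverse by blast
    moreover have "z = tinf powi (int (wt p') - int (wt p)) * (g * tinf ^ wt p * inverse (d * tinf ^ wt p'))"
      using tinf0 gd by (simp add: power_int_diff field_simps)
    ultimately show "\<exists>u. unit_of R u \<and> z = tinf powi (int (wt p') - int (wt p)) * u" by blast
  qed
qed

lemma inf_unif: assumes "valuation_ring emb R" "x \<notin> R" shows "is_unif R tinf"
  unfolding is_unif_def
  using inf_form assms tinf0 tinf_P[OF assms] by metis

lemma inf_unique:
  assumes "valuation_ring emb R" "x \<notin> R" "valuation_ring emb R'" "x \<notin> R'" shows "R = R'"
proof -
  interpret a: dvr emb R tinf by unfold_locales (use assms inf_unif in auto)
  interpret b: dvr emb R' tinf by unfold_locales (use assms inf_unif in auto)
  have "z \<in> R \<longleftrightarrow> z \<in> R'" for z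
  proof (cases "z = 0")
    case False
    then obtain k where "\<And>R. valuation_ring emb R \<Longrightarrow> x \<notin> R \<Longrightarrow> \<exists>u. unit_of R u \<and> z = tinf powi k * u"
      using inf_form by metis
    then show ?thesis using assms a.t_unit_R b.t_unit_R by metis
  qed (simp add: a.R_closed b.R_closed)
  then show ?thesis by blast
qed

lemma span_powers:
  assumes "f \<in> V.span ((\<lambda>i. z ^ i) ` {..<k})" shows "\<exists>c. f = (\<Sum>i<k. emb (c i) * z ^ i)"
  using assms
proof (induction rule: V.span_induct_alt)
  case base show ?case by (intro exI[of _ "\<lambda>_. 0"]) simp
next
  case (step c m g)
  then obtain d i where d: "g = (\<Sum>i<k. emb (d i) * z ^ i)" "m = z ^ i" "i < k" by auto
  have "(\<Sum>j<k. emb ((d(i := d i + c)) j) * z ^ j) = (\<Sum>j<k. emb (d j) * z ^ j + (if j = i then emb c * z ^ i else 0))"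
    by (intro sum.cong) (auto simp: emb_add algebra_simps)
  also have "\<dots> = emb c * m + g" using d by (simp add: sum.distrib)
  finally show ?case by metis
qed

lemma transcendental_powers:
  assumes "transcendental_over emb z" shows "z ^ k \<notin> V.span ((\<lambda>i. z ^ i) ` {..<k})"
proof
  assume "z ^ k \<in> V.span ((\<lambda>i. z ^ i) ` {..<k})"
  then obtain c where c: "z ^ k = (\<Sum>i<k. emb (c i) * z ^ i)" using span_powers by blast
  \<comment> \<open>The coefficient -1 at \<open>k\<close> turns the relation into a non-zero
    polynomial that vanishes at \<open>z\<close>.\<close>
  define c' where "c' = c(k := -1)"
  define p where "p = (\<Sum>i\<le>k. monom (c' i) i)"
  have cp: "coeff p i = (if i \<le> k then c' i else 0)" for i
    by (auto simp: p_def coeff_sum coeff_monom)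
  then have "p \<noteq> 0"
    by (metis c'_def fun_upd_same coeff_0 neg_equal_0_iff_equal one_neq_zero order_refl)
  have "degree (map_poly emb p) \<le> k" by (rule degree_le) (auto simp: coeff_map_poly cp)
  then have "poly (map_poly emb p) z = (\<Sum>i\<le>k. emb (c' i) * z ^ i)"
    by (simp add: poly_altdef_le coeff_map_poly cp)
  also have "\<dots> = (\<Sum>i<k. emb (c i) * z ^ i) + emb (c' k) * z ^ k"
    by (simp add: lessThan_Suc_atMost[symmetric] c'_def)
  also have "\<dots> = 0" using c by (simp add: c'_def emb_uminus)
  finally show False using assms \<open>p \<noteq> 0\<close> by (auto simp: transcendental_over_def)
qed

text \<open>The ring \<open>K[1/x]\<close> does not contain \<open>x\<close>: otherwise, after
  clearing denominators, a power of \<open>x\<close> would be a combination of lower ones, against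
  transcendence. Extending this ring gives a valuation ring without \<open>x\<close>.\<close>

lemma inf_exists: "\<exists>R. valuation_ring emb R \<and> x \<notin> R"
proof -
  define B where "B = V.span (range (\<lambda>k. inverse x ^ k))"
  have "x \<notin> B"
  proof
    assume "x \<in> B"
    have "\<exists>D. f \<in> V.span ((\<lambda>k. inverse x ^ k) ` {..D})" if "f \<in> B" for f
      using that unfolding B_def
    proof (induction rule: V.span_induct_alt)
      case base show ?case using V.span_zero by blast
    next
      case (step c m g)
      then obtain D k where D: "g \<in> V.span ((\<lambda>k. inverse x ^ k) ` {..D})" "m = inverse x ^ k"
        by blast
      have "g \<in> V.span ((\<lambda>k. inverse x ^ k) ` {..max D k})"
        using D V.span_mono[of "(\<lambda>k. inverse x ^ k) ` {..D}" "(\<lambda>k. inverse x ^ k) ` {..max D k}"]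
          by force
      moreover have "m \<in> V.span ((\<lambda>k. inverse x ^ k) ` {..max D k})" using D
        by (intro V.span_base) auto
      ultimately show ?case using V.span_add V.span_scale by blast
    qed
    then obtain D where D: "x \<in> V.span ((\<lambda>k. inverse x ^ k) ` {..D})" using \<open>x \<in> B\<close> by blast
    have "f * x ^ D \<in> V.span ((\<lambda>i. x ^ i) ` {..<Suc D})"
      if "f \<in> V.span ((\<lambda>k. inverse x ^ k) ` {..D})" for f
      using that
    proof (induction rule: V.span_induct_alt)
      case base show ?case using V.span_zero by simp
    next
      case (step c m g)
      then obtain k where k: "m = inverse x ^ k" "k \<le> D" by auto
      then have "m * x ^ D = x ^ (D - k)" using x0
        by (simp add: power_inverse power_diff field_simps)
      then have "m * x ^ D \<in> V.span ((\<lambda>i. x ^ i) ` {..<Suc D})" by (intro V.span_base) auto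
      then have "emb c * (m * x ^ D) + g * x ^ D \<in> V.span ((\<lambda>i. x ^ i) ` {..<Suc D})"
        using step V.span_add V.span_scale by blast
      then show ?case by (simp add: algebra_simps)
    qed
    from this[OF D] have "x ^ Suc D \<in> V.span ((\<lambda>i. x ^ i) ` {..<Suc D})" by simp
    then show False using transcendental_powers[OF trans] by blast
  qed
  have one: "1 \<in> B" unfolding B_def by (intro V.span_base) (auto intro: image_eqI[of _ _ 0])
  have "is_subring B" unfolding is_subring_def
  proof (intro conjI ballI)
    show "0 \<in> B" "1 \<in> B" using one by (auto simp: B_def V.span_zero)
    fix a b assume ab: "a \<in> B" "b \<in> B"
    then show "a - b \<in> B" by (auto simp: B_def V.span_diff)
    have *: "inverse x ^ k * b \<in> B" for k
      using ab(2) unfolding B_def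
    proof (induction rule: V.span_induct_alt)
      case base show ?case using V.span_zero by simp
    next
      case (step c m g)
      then have "inverse x ^ k * m \<in> range (\<lambda>k. inverse x ^ k)" by (auto simp flip: power_add)
      then have "emb c * (inverse x ^ k * m) + inverse x ^ k * g \<in> V.span (range (\<lambda>k. inverse x ^ k))"
        by (intro V.span_add V.span_scale V.span_base step.IH)
      then show ?case by (simp add: algebra_simps)
    qed
    show "a * b \<in> B" using ab(1) unfolding B_def
    proof (induction rule: V.span_induct_alt)
      case base show ?case using V.span_zero by simp
    next
      case (step c m g)
      then have "m * b \<in> B" using * by auto
      then have "emb c * (m * b) + g * b \<in> V.span (range (\<lambda>k. inverse x ^ k))"
        using step V.span_add V.span_scale unfolding B_def by blast
      then show ?case by (simp add: algebra_simps)
    qed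
  qed
  moreover have "range emb \<subseteq> B" using V.span_scale[of 1 "range (\<lambda>k. inverse x ^ k)"] one
    unfolding B_def by auto
  moreover have "inverse x \<in> B" unfolding B_def
    by (intro V.span_base) (auto intro: image_eqI[of _ _ 1])
  ultimately show ?thesis
    using valuation_ring_exists[OF emb, of B "inverse x"] \<open>x \<notin> B\<close> by (metis inverse_inverse_eq)
qed

definition Rinf :: "'f set" where "Rinf = (THE R. valuation_ring emb R \<and> x \<notin> R)"

lemma Rinf: "valuation_ring emb Rinf" "x \<notin> Rinf"
proof -
  have "\<exists>!R. valuation_ring emb R \<and> x \<notin> R" using inf_exists inf_unique by blast
  from theI'[OF this] show "valuation_ring emb Rinf" "x \<notin> Rinf" unfolding Rinf_def by auto
qed

lemma Rinf_eq: "valuation_ring emb R \<Longrightarrow> x \<notin> R \<Longrightarrow> R = Rinf"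
  using inf_unique Rinf by blast

sublocale I: dvr emb Rinf tinf
  by unfold_locales (use Rinf inf_unif in auto)

lemma mon_not_lower: "p \<in> red \<Longrightarrow> mon p \<notin> V.span (mon ` {p' \<in> red. wt p' < wt p})"
proof
  assume "mon p \<in> V.span (mon ` {p' \<in> red. wt p' < wt p})"
  then have "mon p * tinf ^ wt p \<in> I.P" using span_lower_P[OF Rinf] by blast
  then show False using eq1_unit[OF Rinf mon_tinf[OF Rinf, of p]] I.unit_iff by blast
qed

lemma mon_inj: "inj_on mon red"
proof (rule inj_onI)
  have *: "\<not> wt p < wt p'" if "p \<in> red" "p' \<in> red" "mon p = mon p'" for p p'
  proof
    assume "wt p < wt p'"
    then have "mon p' \<in> V.span (mon ` {s \<in> red. wt s < wt p'})"
      using that by (intro V.span_base) (metis (mono_tags, lifting) image_eqI mem_Collect_eq)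
    then show False using mon_not_lower that by blast
  qed
  fix p p' assume "p \<in> red" "p' \<in> red" "mon p = mon p'"
  then show "p = p'" using *[of p p'] *[of p' p] wt_inj by (metis linorder_neqE_nat)
qed

text \<open>A reduced monomial has strictly larger pole order at infinity than any combination of
  lower ones. This independence takes the place of irreducibility of the curve equation over
  \<open>K(x)\<close>.\<close>

lemma mon_independent: "V.independent (mon ` red)"
proof
  have ind: "V.independent (mon ` {p \<in> red. wt p < k})" for k
  proof (induction k)
    case 0 show ?case by (simp add: V.independent_empty)
  next
    case (Suc k)
    show ?case
    proof (cases "\<exists>p\<in>red. wt p = k")
      case True
      then obtain p where p: "p \<in> red" "wt p = k" by blast
      then have "{p \<in> red. wt p < Suc k} = insert p {p' \<in> red. wt p' < k}"
        by (auto simp: less_Suc_eq dest: wt_inj)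
      then show ?thesis using V.independent_insertI[OF mon_not_lower[OF p(1)]] Suc p(2) by simp
    next
      case False
      then have "{p \<in> red. wt p < Suc k} = {p \<in> red. wt p < k}" by (auto simp: less_Suc_eq)
      then show ?thesis using Suc by simp
    qed
  qed
  assume "V.dependent (mon ` red)"
  then obtain p where p: "p \<in> red" "mon p \<in> V.span (mon ` red - {mon p})"
    by (auto simp: V.dependent_def)
  have "mon ` red - {mon p} \<subseteq> mon ` (red - {p})" by auto
  then have "mon p \<in> V.span (mon ` (red - {p}))" using p V.span_mono by blast
  then obtain k where k: "mon p \<in> V.span (mon ` {s \<in> red - {p}. wt s < k})" using span_wt_bound
    by blast
  define l where "l = max k (Suc (wt p))"
  have "mon ` {s \<in> red - {p}. wt s < k} \<subseteq> mon ` {s \<in> red. wt s < l} - {mon p}"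
    using mon_inj p(1) by (auto simp: l_def inj_on_def)
  then have "mon p \<in> V.span (mon ` {s \<in> red. wt s < l} - {mon p})" using k V.span_mono by blast
  moreover have "mon p \<in> mon ` {s \<in> red. wt s < l}" using p by (auto simp: l_def)
  ultimately show False using ind[of l] unfolding V.dependent_def by blast
qed

subsection \<open>Finite places\<close>

definition box :: "nat \<Rightarrow> (nat \<times> nat) set" where "box B = {..<B} \<times> {..<r}"

lemma box_red: "box B \<subseteq> red" by (auto simp: box_def red_def)
lemma box_mono: "B \<le> B' \<Longrightarrow> V.span (mon ` box B) \<subseteq> V.span (mon ` box B')"
  by (intro V.span_mono image_mono) (auto simp: box_def)

lemma A_box: assumes "f \<in> A" shows "\<exists>B. f \<in> V.span (mon ` box B)"
  using assms
proof (induction rule: A_induct)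
  case zero show ?case using V.span_zero by blast
next
  case (step c p g)
  then obtain B where B: "g \<in> V.span (mon ` box B)" by blast
  define B' where "B' = max B (Suc (fst p))"
  have "p \<in> box B'" using step by (cases p) (auto simp: B'_def box_def red_def)
  then have "mon p \<in> V.span (mon ` box B')" by (intro V.span_base) auto
  moreover have "g \<in> V.span (mon ` box B')" using B box_mono[of B B'] by (auto simp: B'_def)
  ultimately show ?case using V.span_add V.span_scale by blast
qed

lemma box_shift: assumes "f \<in> V.span (mon ` box B)" shows "x ^ i * f \<in> V.span (mon ` box (i + B))"
  using assms
proof (induction rule: V.span_induct_alt)
  case base show ?case using V.span_zero by simp
next
  case (step c m g)
  then obtain a b where ab: "m = mon (a, b)" "a < B" "b < r" by (auto simp: box_def)
  then have "x ^ i * m = mon (i + a, b)" by (simp add: mon_def power_add mult.assoc)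
  then have "x ^ i * m \<in> V.span (mon ` box (i + B))" using ab
    by (auto intro!: V.span_base simp: box_def)
  then have "emb c * (x ^ i * m) + x ^ i * g \<in> V.span (mon ` box (i + B))"
    using step by (intro V.span_add V.span_scale)
  then show ?case by (simp add: algebra_simps)
qed

lemma xpow_mon: "x ^ i = mon (i, 0)" by (simp add: mon_def)

text \<open>
  By a dimension count, the multiples of \<open>f\<close> of bounded degree meet \<open>K[x]\<close> nontrivially:
  this replaces the norm of \<open>f\<close>.
\<close>

lemma multiple_in_Kx:
  assumes f: "f \<in> A" "f \<noteq> 0"
  obtains g i c where "g \<in> A" "c \<in> V.span ((\<lambda>k. x ^ k) ` {..<i})" "f * g = x ^ i - c"
proof -
  have "\<exists>s. \<forall>j<k. f * y ^ j \<in> V.span (mon ` box s)" for k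
  proof (induction k)
    case (Suc k)
    then obtain s where s: "\<forall>j<k. f * y ^ j \<in> V.span (mon ` box s)" by blast
    have "f * y ^ k \<in> A" using f yA by (simp add: A_closed)
    then obtain s' where "f * y ^ k \<in> V.span (mon ` box s')" using A_box by blast
    then have "\<forall>j<Suc k. f * y ^ j \<in> V.span (mon ` box (max s s'))"
      using s box_mono[of s "max s s'"] box_mono[of s' "max s s'"] by (auto simp: less_Suc_eq)
    then show ?case by blast
  qed simp
  then obtain s where s: "\<And>j. j < r \<Longrightarrow> f * y ^ j \<in> V.span (mon ` box s)" by blast
  \<comment> \<open>Large enough that \<open>B * r\<close> multiples of \<open>f\<close> and
    \<open>B\<close> powers of \<open>x\<close> outnumber the \<open>(B + s) * r\<close> monomials
    spanning them, which needs \<open>B > s * r\<close>.\<close>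
  define B where "B = s * r + 1"
  define E where "E = (\<lambda>z. f * z) ` mon ` box B"
  define X where "X i = (\<lambda>k. x ^ k) ` {..<i}" for i :: nat
  interpret M: module_hom "\<lambda>c f. emb c * f" "\<lambda>c f. emb c * f" "\<lambda>z. f * z"
    by unfold_locales (auto simp: algebra_simps)
  have Bi: "V.independent (mon ` box B)"
    by (rule V.independent_mono[OF mon_independent image_mono[OF box_red]])
  have Ei: "V.independent E" unfolding E_def
    by (rule M.independent_injective_image[OF Bi]) (use f in \<open>auto intro: inj_onI\<close>)
  have "inj_on (\<lambda>p. f * mon p) (box B)"
    using f(2) inj_on_subset[OF mon_inj box_red] by (auto simp: inj_on_def)
  then have cardE: "card E = B * r" "finite E"
    unfolding E_def image_image by (auto simp: card_image box_def)
  have ES: "E \<subseteq> V.span (mon ` box (B + s))"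
  proof
    fix z assume "z \<in> E"
    then obtain i j where ij: "z = f * mon (i, j)" "i < B" "j < r" by (auto simp: E_def box_def)
    have "x ^ i * (f * y ^ j) \<in> V.span (mon ` box (i + s))" using box_shift s ij by blast
    then show "z \<in> V.span (mon ` box (B + s))"
      using ij box_mono[of "i + s" "B + s"] by (auto simp: mon_def mult_ac)
  qed
  have "\<exists>i<B. x ^ i \<in> V.span (E \<union> X i)"
  proof (rule ccontr)
    assume neg: "\<not> (\<exists>i<B. x ^ i \<in> V.span (E \<union> X i))"
    have "i \<le> B \<Longrightarrow> V.independent (E \<union> X i) \<and> card (E \<union> X i) = B * r + i" for i
    proof (induction i)
      case 0 show ?case using Ei cardE by (simp add: X_def)
    next
      case (Suc i)
      have XS: "E \<union> X (Suc i) = insert (x ^ i) (E \<union> X i)" by (auto simp: X_def lessThan_Suc)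
      have n: "x ^ i \<notin> V.span (E \<union> X i)" using neg Suc.prems by auto
      then have "x ^ i \<notin> E \<union> X i" using V.span_base by blast
      moreover have "finite (E \<union> X i)" using cardE by (simp add: X_def)
      ultimately show ?case unfolding XS using n Suc V.independent_insertI by simp
    qed
    from this[of B] have ind: "V.independent (E \<union> X B)" and card: "card (E \<union> X B) = B * r + B"
      by auto
    have "X B \<subseteq> V.span (mon ` box (B + s))"
    proof
      fix z assume "z \<in> X B"
      then obtain k where "k < B" "z = mon (k, 0)" by (auto simp: X_def xpow_mon)
      then show "z \<in> V.span (mon ` box (B + s))" using r2
        by (intro V.span_base) (auto simp: box_def)
    qed
    then have "card (E \<union> X B) \<le> card (mon ` box (B + s))"
      using V.independent_span_bound[OF _ ind, of "mon ` box (B + s)"] ES by (simp add: box_def)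
    also have "\<dots> \<le> card (box (B + s))" by (intro card_image_le) (simp add: box_def)
    also have "\<dots> = (B + s) * r" by (simp add: box_def)
    finally show False using card by (simp add: B_def algebra_simps)
  qed
  then obtain i where "x ^ i \<in> V.span (E \<union> X i)" by blast
  then obtain a c where ac: "a \<in> V.span E" "c \<in> V.span (X i)" "x ^ i = a + c"
    by (auto simp: V.span_Un)
  have "V.span E = (\<lambda>z. f * z) ` V.span (mon ` box B)" unfolding E_def by (rule M.span_image)
  then obtain g where "g \<in> V.span (mon ` box B)" "a = f * g" using ac by blast
  moreover from this have "g \<in> A" unfolding A_def using V.span_mono[OF image_mono[OF box_red]]
    by blast
  ultimately show ?thesis using that[of g c i] ac by (simp add: X_def)
qed

lemma finite_span: "finite E \<Longrightarrow> finite (V.span E)"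
proof (induction E rule: finite_induct)
  case (insert a E)
  have "V.span (insert a E) \<subseteq> (\<lambda>(k, z). emb k * a + z) ` (UNIV \<times> V.span E)"
  proof
    fix z assume "z \<in> V.span (insert a E)"
    then obtain k where "z - emb k * a \<in> V.span E" using V.span_breakdown_eq by blast
    then show "z \<in> (\<lambda>(k, z). emb k * a + z) ` (UNIV \<times> V.span E)"
      by (auto intro!: image_eqI[of _ _ "(k, z - emb k * a)"])
  qed
  then show ?case using insert by (metis finite_SigmaI finite finite_imageI finite_subset)
qed simp

definition ww :: "nat \<Rightarrow> 'f" where "ww s = x ^ (Q ^ s) - x"

lemma ww_A: "ww s \<in> A" by (simp add: ww_def A_closed xA)
lemma Q2: "Q \<ge> 2" using r2 by (simp add: Q_eq)
lemma Q_pow: "Q ^ s = 2 ^ (2 * n * s)" by (simp add: Q_pow2 power_mult)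

lemma frob_Q: "(a + b :: 'f) ^ (Q ^ s) = a ^ (Q ^ s) + b ^ (Q ^ s)"
  unfolding Q_pow by (rule char2_frobenius[OF c2F])
lemma frob_Q_diff: "(a - b :: 'f) ^ (Q ^ s) = a ^ (Q ^ s) - b ^ (Q ^ s)"
  by (simp add: char2 frob_Q)

lemma ww_0: assumes "s \<ge> 1" shows "ww s \<noteq> 0"
proof
  assume "ww s = 0"
  have "Q ^ 1 \<le> Q ^ s" using assms Q2 by (intro power_increasing) auto
  then have "1 < Q ^ s" using Q2 by simp
  moreover have "x ^ (Q ^ s) = x ^ 1" using \<open>ww s = 0\<close> by (simp add: ww_def)
  ultimately have "x ^ (Q ^ s) \<in> V.span ((\<lambda>k. x ^ k) ` {..<Q ^ s})"
    by (metis V.span_base imageI lessThan_iff)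
  then show False using transcendental_powers[OF trans] by blast
qed

text \<open>Modulo the monic polynomial in \<open>x\<close> supplied by
  \<open>multiple_in_Kx\<close> there are finitely many remainders, so two of the powers
  \<open>x ^ (Q ^ j)\<close> leave the same one, and by Frobenius their difference is a power of
  some \<open>ww s\<close>. Hence powers of the \<open>ww s\<close> suffice as denominators.\<close>

lemma divides_ww_power:
  assumes f: "f \<in> A" "f \<noteq> 0"
  obtains s k g where "s \<ge> 1" "g \<in> A" "f * g = ww s ^ k"
proof -
  obtain g0 i c where g0: "g0 \<in> A" "c \<in> V.span ((\<lambda>k. x ^ k) ` {..<i})" "f * g0 = x ^ i - c"
    using multiple_in_Kx[OF f] by metis
  let ?X = "V.span ((\<lambda>k. x ^ k) ` {..<i})"
  \<comment> \<open>Division with remainder by \<open>f * g0\<close>, one factor \<open>x\<close> at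
    a time.\<close>
  have "\<exists>s\<in>?X. \<exists>a\<in>A. x ^ e = s + a * (f * g0)" for e
  proof (induction e)
    case 0
    show ?case
    proof (cases "i = 0")
      case True
      then have "x ^ 0 = 0 + 1 * (f * g0)" using g0 by simp
      then show ?thesis using V.span_zero A_1 by blast
    next
      case False
      then have "1 \<in> ?X" by (intro V.span_base) (auto intro: image_eqI[of _ _ 0])
      then show ?thesis using A_0 by (intro bexI[of _ 1] bexI[of _ 0]) auto
    qed
  next
    case (Suc e)
    then obtain s a where s: "s \<in> ?X" "a \<in> A" "x ^ e = s + a * (f * g0)" by blast
    have "x * s \<in> V.span (insert (x ^ i) ((\<lambda>k. x ^ k) ` {..<i}))"
      using s(1)
    proof (induction rule: V.span_induct_alt)
      case base show ?case using V.span_zero by simp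
    next
      case (step c m g)
      then obtain k where "m = x ^ k" "k < i" by auto
      then have "x * m \<in> insert (x ^ i) ((\<lambda>k. x ^ k) ` {..<i})"
        by (cases "Suc k = i") (auto intro: image_eqI[of _ _ "Suc k"])
      then have "emb c * (x * m) + x * g \<in> V.span (insert (x ^ i) ((\<lambda>k. x ^ k) ` {..<i}))"
        using step.IH by (intro V.span_add V.span_scale) (auto intro: V.span_base)
      then show ?case by (simp add: algebra_simps)
    qed
    then obtain k where k: "x * s - emb k * x ^ i \<in> ?X" using V.span_breakdown_eq by blast
    have "x ^ Suc e = (x * s - emb k * x ^ i + emb k * c) + (x * a + emb k) * (f * g0)"
      unfolding power_Suc s(3) g0(3) by (simp add: algebra_simps)
    moreover have "x * s - emb k * x ^ i + emb k * c \<in> ?X" using k g0(2) V.span_add V.span_scale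
      by blast
    moreover have "x * a + emb k \<in> A" using s xA A_emb by (simp add: A_closed)
    ultimately show ?case by blast
  qed
  then obtain S a where Sa: "\<And>e. S e \<in> ?X" "\<And>e. a e \<in> A" "\<And>e. x ^ e = S e + a e * (f * g0)" by metis
  have "finite ?X" by (rule finite_span) simp
  then have "\<not> inj (\<lambda>j. S (Q ^ j))"
    using Sa(1) by (metis finite_imageD finite_subset image_subsetI infinite_UNIV_nat)
  then obtain j j' where j: "j < j'" "S (Q ^ j) = S (Q ^ j')" by (metis injI linorder_neqE_nat)
  define s where "s = j' - j"
  have "(a (Q ^ j') - a (Q ^ j)) * (f * g0) = x ^ (Q ^ j') - x ^ (Q ^ j)"
    using Sa(3)[of "Q ^ j"] Sa(3)[of "Q ^ j'"] j(2) by (simp add: algebra_simps)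
  also have "\<dots> = ww s ^ (Q ^ j)"
  proof -
    have "j' = s + j" using j by (simp add: s_def)
    then show ?thesis unfolding ww_def frob_Q_diff by (simp only: power_add power_mult)
  qed
  finally have "f * (g0 * (a (Q ^ j') - a (Q ^ j))) = ww s ^ (Q ^ j)" by (simp only: mult_ac)
  moreover have "g0 * (a (Q ^ j') - a (Q ^ j)) \<in> A" using g0(1) Sa(2) by (simp add: A_closed)
  moreover have "s \<ge> 1" using j by (simp add: s_def)
  ultimately show ?thesis using that by blast
qed

lemma frac_ww: obtains s k g where "s \<ge> 1" "g \<in> A" "z * ww s ^ k = g"
proof -
  obtain g d where gd: "g \<in> A" "d \<in> A" "d \<noteq> 0" "z = g / d" by (rule frac_A)
  obtain s k g' where "s \<ge> 1" "g' \<in> A" "d * g' = ww s ^ k" using divides_ww_power gd by metis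
  moreover from this have "z * ww s ^ k = g * g'" using gd
    by (metis nonzero_eq_divide_eq mult.assoc)
  ultimately show ?thesis using that gd by (metis A_mult)
qed

section \<open>Frobenius modulo \<open>ww s\<close>\<close>

definition cong_ww :: "nat \<Rightarrow> 'f \<Rightarrow> 'f \<Rightarrow> bool" where
  "cong_ww s a b \<longleftrightarrow> (\<exists>g\<in>A. a - b = ww s * g)"

lemma cong_refl: "cong_ww s a a" unfolding cong_ww_def using A_0 by (intro bexI[of _ 0]) auto
lemma cong_trans: "cong_ww s a b \<Longrightarrow> cong_ww s b c \<Longrightarrow> cong_ww s a c"
proof -
  assume "cong_ww s a b" "cong_ww s b c"
  then obtain g g' where "g \<in> A" "g' \<in> A" "a - b = ww s * g" "b - c = ww s * g'"
    by (auto simp: cong_ww_def)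
  then have "a - c = ww s * (g + g')" "g + g' \<in> A" by (auto simp: algebra_simps A_add)
  then show ?thesis by (auto simp: cong_ww_def)
qed
lemma cong_add: "cong_ww s a b \<Longrightarrow> cong_ww s c d \<Longrightarrow> cong_ww s (a + c) (b + d)"
proof -
  assume "cong_ww s a b" "cong_ww s c d"
  then obtain g g' where "g \<in> A" "g' \<in> A" "a - b = ww s * g" "c - d = ww s * g'"
    by (auto simp: cong_ww_def)
  then have "a + c - (b + d) = ww s * (g + g')" "g + g' \<in> A" by (auto simp: algebra_simps A_add)
  then show ?thesis by (auto simp: cong_ww_def)
qed
lemma cong_mult: "cong_ww s a b \<Longrightarrow> cong_ww s c d \<Longrightarrow> b \<in> A \<Longrightarrow> c \<in> A \<Longrightarrow> cong_ww s (a * c) (b * d)"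
proof -
  assume *: "cong_ww s a b" "cong_ww s c d" "b \<in> A" "c \<in> A"
  then obtain g g' where g: "g \<in> A" "g' \<in> A" "a - b = ww s * g" "c - d = ww s * g'"
    by (auto simp: cong_ww_def)
  have "a * c - b * d = (a - b) * c + b * (c - d)" by (simp add: algebra_simps)
  also have "\<dots> = ww s * (g * c + b * g')" unfolding g by (simp add: algebra_simps)
  finally show ?thesis using * g by (auto simp: cong_ww_def A_closed)
qed
lemma cong_power: "cong_ww s a b \<Longrightarrow> a \<in> A \<Longrightarrow> b \<in> A \<Longrightarrow> cong_ww s (a ^ k) (b ^ k)"
  by (induction k) (auto simp: cong_refl A_closed intro!: cong_mult)

text \<open>Modulo \<open>ww s\<close> the power \<open>W = Q ^ s\<close> fixes constants and
  \<open>x\<close>, but returns \<open>y\<close> only up to an error \<open>e\<close>. Since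
  \<open>h(e)\<close> vanishes modulo \<open>ww s\<close>, so does \<open>e ^ (2 ^ n) + e\<close>;
  thus \<open>e\<close> is itself fixed, and the second application adds \<open>e\<close> once more,
  which cancels in characteristic two. This is why the exponent is squared.\<close>

lemma frobenius_cong:
  assumes f: "f \<in> A" shows "cong_ww s (f ^ ((Q ^ s) ^ 2)) f"
proof -
  define W where "W = Q ^ s"
  have fr: "(a + b :: 'f) ^ W = a ^ W + b ^ W" for a b unfolding W_def by (rule frob_Q)
  have W2: "z ^ (W ^ 2) = (z ^ W) ^ W" for z :: 'f by (simp add: power2_eq_square power_mult)
  have cx: "cong_ww s (x ^ W) x" unfolding cong_ww_def ww_def W_def using A_1
    by (intro bexI[of _ 1]) auto
  have cxx: "cong_ww s (x ^ (W ^ 2)) x"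
    unfolding W2 using cong_trans[OF cong_power[OF cx] cx] xA by (simp add: A_closed)
  define e where "e = y ^ W + y"
  have eA: "e \<in> A" using yA by (simp add: e_def A_closed)
  have "h_poly n (y ^ W) = h_poly n y ^ W"
    unfolding h_poly_def W_def Q_pow char2_frobenius_sum[OF c2F]
    by (intro sum.cong) (simp_all add: mult.commute flip: power_mult)
  then have he: "h_poly n e = (x ^ W) ^ (2 * r + 1) + x ^ (2 * r + 1)"
    unfolding e_def h_poly_add[OF c2F] eqn by (simp only: mult.commute flip: power_mult)
  have che: "cong_ww s (h_poly n e) 0"
  proof -
    have "cong_ww s ((x ^ W) ^ (2 * r + 1) + x ^ (2 * r + 1)) (x ^ (2 * r + 1) + x ^ (2 * r + 1))"
      using cx xA by (intro cong_add cong_power cong_refl) (auto simp: A_closed)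
    then show ?thesis unfolding he by (simp only: char2)
  qed
  have hA: "h_poly n e \<in> A" using eA h_subring[OF A_subring] by blast
  have "cong_ww s (h_poly n e ^ 2 + h_poly n e) (0 ^ 2 + 0)"
    using che hA A_0 by (intro cong_add cong_power)
  then have "cong_ww s (e ^ 2 ^ n + e) 0" by (simp add: h_poly_telescope[OF c2F])
  from cong_add[OF this cong_refl[of s e]] have ce: "cong_ww s (e ^ 2 ^ n) e"
    by (simp only: add.assoc char2 add_0_right add_0_left)
  have "cong_ww s (e ^ ((2 ^ n) ^ k)) e" for k
  proof (induction k)
    case (Suc k)
    have "e ^ ((2 ^ n) ^ Suc k) = (e ^ 2 ^ n) ^ ((2 ^ n) ^ k)" by (simp add: power_mult)
    moreover have "cong_ww s ((e ^ 2 ^ n) ^ ((2 ^ n) ^ k)) (e ^ ((2 ^ n) ^ k))"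
      using ce eA by (intro cong_power) (auto simp: A_closed)
    ultimately show ?case using Suc cong_trans by metis
  qed (simp add: cong_refl)
  \<comment> \<open>\<open>Q\<close> is the square of \<open>2 ^ n\<close>, whence
    \<open>2 * s\<close> iterations for \<open>Q ^ s\<close>.\<close>
  from this[of "2 * s"] have ceW: "cong_ww s (e ^ W) e"
    unfolding W_def Q_pow by (simp add: mult_ac flip: power_mult)
  have "y + e = y ^ W + (y + y)" by (simp only: e_def add_ac)
  then have "y ^ W = y + e" by (simp only: char2 add_0_right)
  then have "y ^ (W ^ 2) = y + e + e ^ W" unfolding W2 by (metis fr)
  moreover have "cong_ww s (y + e + e ^ W) (y + e + e)" by (intro cong_add cong_refl ceW)
  ultimately have cy: "cong_ww s (y ^ (W ^ 2)) y" by (simp only: add.assoc char2 add_0_right)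
  show ?thesis using f unfolding W_def[symmetric]
  proof (induction rule: A_induct)
    case zero show ?case using cong_refl[of s 0] Q2 by (simp add: W_def power_0_left)
  next
    case (step c p g)
    have "emb c ^ W = emb c" for c unfolding W_def
      by (induction s) (auto simp: power_mult emb_Q)
    then have "emb c ^ (W ^ 2) = emb c" unfolding W2 by simp
    moreover have "(emb c * mon p + g) ^ (W ^ 2) = (emb c * mon p) ^ (W ^ 2) + g ^ (W ^ 2)"
      unfolding W2 fr ..
    moreover have "mon p ^ (W ^ 2) = (x ^ (W ^ 2)) ^ fst p * (y ^ (W ^ 2)) ^ snd p"
      by (simp add: mon_def power_mult_distrib mult.commute flip: power_mult)
    moreover have "cong_ww s ((x ^ (W ^ 2)) ^ fst p * (y ^ (W ^ 2)) ^ snd p) (mon p)"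
      unfolding mon_def using xA yA by (intro cong_mult cong_power cxx cy) (auto simp: A_closed)
    moreover have "mon p \<in> A" using step mon_A by blast
    ultimately show ?case using step
      by (auto simp: power_mult_distrib A_emb A_closed mult.assoc intro!: cong_add cong_mult cong_refl)
         (metis A_closed(7) xA yA A_mult)
  qed
qed

text \<open>Modulo \<open>ww s\<close> the ring \<open>A\<close> is reduced, some power map being
  the identity there, so no power of \<open>g\<close> is divisible by \<open>ww s\<close>. Therefore
  \<open>g / ww s\<close> is missing from \<open>A[ww s / g]\<close>: an expression for it, cleared
  of denominators, would make a power of \<open>g\<close> divisible. Extending this ring gives the
  place.\<close>

lemma ww_not_dvd_place:
  assumes g: "g \<in> A" "\<not> cong_ww s g 0" and s: "s \<ge> 1"
  obtains R where "valuation_ring emb R" "A \<subseteq> R" "g / ww s \<notin> R"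
proof -
  define z where "z = ww s / g"
  have g0: "g \<noteq> 0" using g cong_refl by auto
  have iz: "inverse z = g / ww s" using g0 by (simp add: z_def)
  define B where "B = {poly p z | p. \<forall>i. coeff p i \<in> A}"
  note B = adjoin_subring[OF A_subring, of z, folded B_def]
  have "inverse z \<notin> B"
  proof
    assume "inverse z \<in> B"
    then obtain p where p: "inverse z = poly p z" "\<forall>i. coeff p i \<in> A" by (auto simp: B_def)
    define d where "d = degree p"
    have "g = ww s * poly p z" using iz p ww_0[OF s] by (metis nonzero_eq_divide_eq mult.commute)
    then have "g ^ Suc d = ww s * (poly p z * g ^ d)" by (metis mult.assoc power_Suc)
    also have "poly p z * g ^ d = (\<Sum>i\<le>d. coeff p i * ww s ^ i * g ^ (d - i))"
      unfolding poly_altdef d_def[symmetric] sum_distrib_right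
      using g0 by (intro sum.cong) (auto simp: z_def power_divide power_diff field_simps)
    finally have gd: "g ^ Suc d = ww s * (\<Sum>i\<le>d. coeff p i * ww s ^ i * g ^ (d - i))" .
    have "(\<Sum>i\<le>d. coeff p i * ww s ^ i * g ^ (d - i)) \<in> A"
      using p g ww_A by (intro A_sum) (auto simp: A_closed)
    then have c0: "cong_ww s (g ^ Suc d) 0" using gd by (auto simp: cong_ww_def)
    define U where "U = (Q ^ s) ^ 2"
    have U: "cong_ww s (g ^ (U ^ k)) g" for k
    proof (induction k)
      case (Suc k)
      have "g ^ (U ^ Suc k) = (g ^ U) ^ (U ^ k)" by (simp add: power_mult)
      moreover have "cong_ww s ((g ^ U) ^ (U ^ k)) (g ^ (U ^ k))"
        using frobenius_cong[OF g(1), of s] g by (intro cong_power) (auto simp: A_closed U_def)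
      ultimately show ?case using Suc cong_trans by metis
    qed (simp add: cong_refl)
    have "U \<ge> 2" using Q2 s unfolding U_def
      by (metis self_le_power le_trans pos2 one_le_numeral zero_less_one less_le_trans)
    \<comment> \<open>An iterated Frobenius exponent beyond \<open>Suc d\<close> makes
      \<open>g\<close> congruent to a multiple of \<open>g ^ Suc d\<close>, and so to 0.\<close>
    then have "Suc d < U ^ Suc d" by (intro power_gt_expt) simp
    then have "g ^ (U ^ Suc d) = g ^ (U ^ Suc d - Suc d) * g ^ Suc d"
      by (metis le_add_diff_inverse2 less_imp_le power_add)
    moreover have "cong_ww s (g ^ (U ^ Suc d - Suc d) * g ^ Suc d) (g ^ (U ^ Suc d - Suc d) * 0)"
      using g by (intro cong_mult cong_refl c0) (auto simp: A_closed)
    ultimately have "cong_ww s (g ^ (U ^ Suc d)) 0" by simp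
    moreover have "cong_ww s g (g ^ (U ^ Suc d))"
    proof -
      obtain a where "a \<in> A" "g ^ (U ^ Suc d) - g = ww s * a" using U[of "Suc d"]
        by (auto simp: cong_ww_def)
      then have "g - g ^ (U ^ Suc d) = ww s * (- a)" "- a \<in> A"
        by (auto simp: A_closed algebra_simps)
      then show ?thesis unfolding cong_ww_def by blast
    qed
    ultimately show False using g(2) cong_trans by blast
  qed
  moreover have "range emb \<subseteq> B" using B A_emb by auto
  ultimately obtain R where "valuation_ring emb R" "B \<subseteq> R" "inverse z \<notin> R"
    using valuation_ring_exists[OF emb B(1) _ B(3)] by metis
  then show ?thesis using that B iz by auto
qed

text \<open>The zeros of \<open>ww s\<close> persist, as simple factors, in \<open>ww\<close> at
  multiples of \<open>s\<close>: the cofactor is 1 at each of them. This allows different values of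
  \<open>s\<close> to be compared locally.\<close>

lemma ww_multiple: "\<exists>c\<in>A. ww (s * Suc j) = ww s * (1 + ww s * c)"
proof (cases "s = 0")
  case True then show ?thesis using A_0 by (simp add: ww_def) (blast intro: A_0)
next
  case False
  show ?thesis
  proof (induction j)
    case 0 show ?case using A_0 by (intro bexI[of _ 0]) auto
  next
    case (Suc j)
    then obtain c where c: "c \<in> A" "ww (s * Suc j) = ww s * (1 + ww s * c)" by blast
    let ?c = "1 + ww s * c"
    have "2 \<le> Q ^ s" using Q2 False by (metis self_le_power le_trans neq0_conv one_le_numeral)
    then have e: "Q ^ s = 2 + (Q ^ s - 2)" by simp
    have "ww (s * Suc (Suc j)) = (x ^ (Q ^ (s * Suc j)) - x) ^ (Q ^ s) + ww s"
      unfolding ww_def frob_Q_diff by (simp add: power_add mult.commute flip: power_mult)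
    also have "\<dots> = (ww s * ?c) ^ (Q ^ s) + ww s" using c(2) by (simp add: ww_def)
    also have "(ww s * ?c) ^ (Q ^ s) = ww s * (ww s * (ww s ^ (Q ^ s - 2) * ?c ^ (Q ^ s)))"
      unfolding power_mult_distrib using e by (metis mult.assoc power2_eq_square power_add)
    finally have "ww (s * Suc (Suc j)) = ww s * (1 + ww s * (ww s ^ (Q ^ s - 2) * ?c ^ (Q ^ s)))"
      by (simp add: algebra_simps)
    moreover have "ww s ^ (Q ^ s - 2) * ?c ^ (Q ^ s) \<in> A" using c ww_A A_1 by (simp add: A_closed)
    ultimately show ?case by blast
  qed
qed

section \<open>Local structure of the coordinate ring at finite places\<close>

lemma fin_A: assumes "valuation_ring emb R" "x \<in> R" shows "A \<subseteq> R"
proof -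
  interpret val_ring emb R using assms by unfold_locales
  have "y \<in> R"
  proof (rule ccontr)
    assume y: "y \<notin> R"
    then have "inverse y \<in> P" by (simp add: P_iff)
    \<comment> \<open>This element is \<open>h(y) / y ^ r\<close>, which would have to be 1 modulo
      \<open>P\<close> if \<open>y\<close> had a pole.\<close>
    then have "x ^ (2 * r + 1) * inverse y ^ r \<in> P" using assms r2
      by (intro P_mult2 P_power) (auto intro: R_closed)
    then show False using P_diff[OF _ h_lead_inverse[OF assms(1) y]] one_notin unfolding eqn
      by force
  qed
  then show ?thesis using A_minimal[OF sub] assms emb_in by auto
qed

context
  fixes R assumes vr: "valuation_ring emb R" and xR: "x \<in> R"
begin

interpretation val_ring emb R using vr by unfold_locales

text \<open>An element outside \<open>R\<close> has a power of some \<open>ww s\<close> as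
  denominator, so that \<open>ww s\<close> cannot be a unit of \<open>R\<close>.\<close>

lemma fin_ww_P: "\<exists>s\<ge>1. ww s \<in> P"
proof -
  obtain z where z: "z \<notin> R" using vr by (auto simp: valuation_ring_def)
  obtain s k g where s: "s \<ge> 1" "g \<in> A" "z * ww s ^ k = g" by (rule frac_ww)
  have "ww s \<in> P"
  proof (rule ccontr)
    assume "ww s \<notin> P"
    then have "inverse (ww s) \<in> R" by (auto simp: P_iff)
    then have "g * inverse (ww s) ^ k \<in> R" using s fin_A[OF vr xR] by (auto intro: R_closed)
    moreover have "z = g * inverse (ww s) ^ k" using s ww_0 by (auto simp: field_simps)
    ultimately show False using z by simp
  qed
  then show ?thesis using s by blast
qed

text \<open>If \<open>f\<close> lies in \<open>P\<close>, then \<open>f ^ (U - 1) - 1\<close> does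
  not, while its product with \<open>f\<close> is divisible by \<open>ww s\<close>. So one factor
  \<open>ww s\<close> splits off up to local units, and this can be repeated only finitely often
  because \<open>f\<close> divides a power of \<open>ww s\<close> up to local units.\<close>

lemma fin_local_form:
  assumes s: "s \<ge> 1" "ww s \<in> P" and f: "f \<in> A" "f \<noteq> 0"
  obtains j a b where "a \<in> A - P" "b \<in> A - P" "f * a = ww s ^ j * b"
proof -
  have AR: "a \<in> A \<Longrightarrow> a \<in> R" for a using fin_A[OF vr xR] by blast
  have key: "\<exists>j. \<exists>a\<in>A - P. \<exists>b\<in>A - P. f * a = ww s ^ j * b"
    if "f \<in> A" "g \<in> A" "a \<in> A - P" "f * g = ww s ^ k * a" for k f g a
    using that
  proof (induction k arbitrary: f g a)
    case 0
    then have "f \<notin> P" using P_mult AR by auto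
    then show ?case using 0 A_1 one_notin by (intro exI[of _ 0] bexI[of _ 1] bexI[of _ f]) auto
  next
    case (Suc k)
    show ?case
    proof (cases "f \<in> P")
      case False
      then show ?thesis using Suc A_1 one_notin
        by (intro exI[of _ 0] bexI[of _ 1] bexI[of _ f]) auto
    next
      case True
      define U where "U = (Q ^ s) ^ 2"
      have "2 \<le> U" using Q2 s unfolding U_def
        by (metis self_le_power le_trans pos2 one_le_numeral zero_less_one less_le_trans)
      obtain g1 where g1: "g1 \<in> A" "f ^ U - f = ww s * g1"
        using frobenius_cong[OF Suc.prems(1), of s] by (auto simp: cong_ww_def U_def)
      define s' where "s' = f ^ (U - 1) - 1"
      have "f ^ (U - 1) \<in> P" using True \<open>2 \<le> U\<close> by (intro P_power) auto
      then have s'P: "s' \<notin> P" using P_diff[of "f ^ (U - 1)" s'] one_notin by (auto simp: s'_def)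
      have s'A: "s' \<in> A" using Suc.prems A_1 by (simp add: s'_def A_closed)
      have "U = Suc (U - 1)" using \<open>2 \<le> U\<close> by simp
      then have fs: "f * s' = ww s * g1" using g1
        by (metis s'_def power_Suc right_diff_distrib mult.right_neutral)
      have "ww s * (g1 * g) = s' * (f * g)" using fs by (simp add: mult_ac)
      also have "\<dots> = ww s * (ww s ^ k * (s' * a))" using Suc.prems by (simp add: mult_ac)
      finally have "g1 * g = ww s ^ k * (s' * a)" using ww_0[OF s(1)] by simp
      moreover have "s' * a \<in> A - P"
        using s'A s'P Suc.prems AR P_prime[of s' a] by (auto simp: A_closed)
      ultimately obtain j a1 b1 where j: "a1 \<in> A - P" "b1 \<in> A - P" "g1 * a1 = ww s ^ j * b1"
        using Suc.IH g1 Suc.prems by blast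
      have "f * (s' * a1) = ww s * (g1 * a1)" using fs by (simp add: mult.assoc[symmetric])
      then have "f * (s' * a1) = ww s ^ Suc j * b1" using j by (simp add: mult.assoc)
      moreover have "s' * a1 \<in> A - P" using s'A s'P j AR P_prime[of s' a1] by (auto simp: A_closed)
      ultimately show ?thesis using j by blast
    qed
  qed
  obtain s1 k g where g: "s1 \<ge> 1" "g \<in> A" "f * g = ww s1 ^ k" using divides_ww_power[OF f] by metis
  \<comment> \<open>The power that \<open>f\<close> divides may belong to another index
    \<open>s1\<close>. Both \<open>ww s\<close> and \<open>ww s1\<close> divide
    \<open>ww (s * s1)\<close>, and the cofactor of \<open>ww s\<close> is a unit at the
    place.\<close>
  obtain c where c: "c \<in> A" "ww (s * s1) = ww s * (1 + ww s * c)"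
    using ww_multiple[of s "s1 - 1"] g(1) by auto
  obtain c' where c': "c' \<in> A" "ww (s * s1) = ww s1 * (1 + ww s1 * c')"
    using ww_multiple[of s1 "s - 1"] s(1) by (auto simp: mult.commute)
  have "f * (g * (1 + ww s1 * c') ^ k) = ww s ^ k * (1 + ww s * c) ^ k"
  proof -
    have "f * (g * (1 + ww s1 * c') ^ k) = (ww s1 * (1 + ww s1 * c')) ^ k"
      using g(3) by (simp only: power_mult_distrib mult.assoc[symmetric])
    then show ?thesis unfolding c'(2)[symmetric] c(2) by (simp only: power_mult_distrib)
  qed
  moreover have "1 + ww s * c \<notin> P"
  proof
    assume "1 + ww s * c \<in> P"
    moreover have "ww s * c \<in> P" using s c AR P_mult by blast
    ultimately show False using P_diff one_notin by fastforce
  qed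
  then have "(1 + ww s * c) ^ k \<in> A - P" using c ww_A A_1 AR P_prime_power[of "1 + ww s * c" k]
    by (auto simp: A_closed)
  moreover have "g * (1 + ww s1 * c') ^ k \<in> A" using g c' ww_A A_1 by (simp add: A_closed)
  ultimately have "\<exists>j. \<exists>a\<in>A - P. \<exists>b\<in>A - P. f * a = ww s ^ j * b" using key[OF f(1)] by blast
  then show ?thesis using that by blast
qed

lemma fin_unit: "a \<in> A - P \<Longrightarrow> unit_of R a" using fin_A[OF vr xR] by (auto simp: unit_iff)

lemma fin_frac_form:
  assumes s: "s \<ge> 1" "ww s \<in> P" and z: "z \<noteq> 0"
  obtains k :: int and a b where "a \<in> A - P" "b \<in> A - P" "z = ww s powi k * (a * inverse b)"
proof -
  obtain g d where gd: "g \<in> A" "d \<in> A" "d \<noteq> 0" "z = g / d" by (rule frac_A)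
  then have "g \<noteq> 0" using z by auto
  obtain j a b where j: "a \<in> A - P" "b \<in> A - P" "g * a = ww s ^ j * b"
    using fin_local_form[OF s gd(1) \<open>g \<noteq> 0\<close>] by metis
  obtain j' a' b' where j': "a' \<in> A - P" "b' \<in> A - P" "d * a' = ww s ^ j' * b'"
    using fin_local_form[OF s gd(2,3)] by metis
  have nz: "a \<noteq> 0" "b \<noteq> 0" "a' \<noteq> 0" "b' \<noteq> 0" using j j' P_zero by auto
  have pr: "c * c' \<in> A - P" if "c \<in> A - P" "c' \<in> A - P" for c c'
    using that P_prime[of c c'] fin_A[OF vr xR] by (auto simp: A_closed)
  have e: "g = ww s ^ j * b / a" "d = ww s ^ j' * b' / a'"
    using j j' nz by (auto simp: nonzero_eq_divide_eq)
  have "z = ww s powi (int j - int j') * (b * a' * inverse (a * b'))"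
    unfolding gd(4) e using nz ww_0[OF s(1)] by (simp add: power_int_diff field_simps)
  then show ?thesis using that[of "b * a'" "a * b'"] pr j j' by blast
qed

lemma fin_unif: assumes "s \<ge> 1" "ww s \<in> P" shows "is_unif R (ww s)"
  unfolding is_unif_def
proof (intro conjI allI impI)
  show "ww s \<noteq> 0" "ww s \<in> P" using assms ww_0 by auto
  fix z :: 'f assume "z \<noteq> 0"
  then obtain k a b where "a \<in> A - P" "b \<in> A - P" "z = ww s powi k * (a * inverse b)"
    using fin_frac_form[OF assms] by metis
  then show "\<exists>k u. unit_of R u \<and> z = ww s powi k * u" using fin_unit unit_mult unit_inverse by blast
qed

end

text \<open>In \<open>fin_frac_form\<close> the factors are tested only for membership in
  \<open>A\<close> and \<open>P\<close>, so the ideal cut out in \<open>A\<close> determines all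
  orders and with them the place.\<close>

lemma fin_unique:
  assumes R: "valuation_ring emb R" "x \<in> R" and R': "valuation_ring emb R'" "x \<in> R'"
    and P: "A \<inter> max_ideal R = A \<inter> max_ideal R'"
  shows "R = R'"
proof -
  obtain s where s: "s \<ge> 1" "ww s \<in> max_ideal R" using fin_ww_P[OF R] by blast
  then have s': "ww s \<in> max_ideal R'" using P ww_A by blast
  interpret a: dvr emb R "ww s" by unfold_locales (use R fin_unif s in auto)
  interpret b: dvr emb R' "ww s" by unfold_locales (use R' fin_unif s s' in auto)
  have "z \<in> R \<longleftrightarrow> z \<in> R'" for z
  proof (cases "z = 0")
    case False
    then obtain k c d where k: "c \<in> A - max_ideal R" "d \<in> A - max_ideal R" "z = ww s powi k * (c * inverse d)"
      using fin_frac_form[OF R s] by metis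
    have kk: "c \<in> A - max_ideal R'" "d \<in> A - max_ideal R'" using k P by auto
    have "unit_of R (c * inverse d)" "unit_of R' (c * inverse d)"
      by (intro a.unit_mult a.unit_inverse fin_unit[OF R] k(1,2)) (intro b.unit_mult b.unit_inverse fin_unit[OF R'] kk)
    then show ?thesis using k(3) a.t_unit_R b.t_unit_R by simp
  qed (simp add: a.R_closed b.R_closed)
  then show ?thesis by blast
qed

text \<open>Write \<open>z\<close> over a power of \<open>ww s\<close> and cancel one factor at a
  time; a factor that failed to cancel would yield, through \<open>ww_not_dvd_place\<close>, a
  finite place where \<open>z\<close> has a pole.\<close>

lemma A_normal:
  assumes "\<And>R. valuation_ring emb R \<Longrightarrow> x \<in> R \<Longrightarrow> z \<in> R" shows "z \<in> A"
proof -
  obtain s k g where s: "s \<ge> 1" "g \<in> A" "z * ww s ^ k = g" by (rule frac_ww)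
  then have "z * ww s ^ k \<in> A" by simp
  then show "z \<in> A"
  proof (induction k)
    case (Suc k)
    have "cong_ww s (z * ww s ^ Suc k) 0"
    proof (rule ccontr)
      assume "\<not> cong_ww s (z * ww s ^ Suc k) 0"
      then obtain R where R: "valuation_ring emb R" "A \<subseteq> R" "z * ww s ^ Suc k / ww s \<notin> R"
        using ww_not_dvd_place[OF Suc.prems _ s(1)] by metis
      interpret val_ring emb R using R by unfold_locales
      have "x \<in> R" "ww s \<in> R" using R xA ww_A by auto
      then have "z * ww s ^ k \<in> R" using assms[OF R(1)] by (simp add: R_closed)
      then show False using R(3) ww_0[OF s(1)] by simp
    qed
    then obtain a where "a \<in> A" "z * ww s ^ Suc k = ww s * a" by (auto simp: cong_ww_def)
    then have "z * ww s ^ k = a" using ww_0[OF s(1)] by (simp add: mult_ac)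
    then show ?case using Suc.IH \<open>a \<in> A\<close> by simp
  qed simp
qed

subsection \<open>Riemann--Roch spaces of multiples of the place at infinity\<close>

abbreviation vinf :: "'f \<Rightarrow> int" where "vinf z \<equiv> place_val (max_ideal Rinf) z"

lemma lead_val:
  assumes "c \<noteq> 0" "f - emb c * mon p \<in> V.span (mon ` {p' \<in> I. wt p' < wt p})"
  shows "vinf f = - int (wt p)"
proof -
  have u: "unit_of Rinf (f * tinf ^ wt p)" by (rule lead_unit(1)[OF Rinf assms])
  have e: "tinf powi (- int (wt p)) * (f * tinf ^ wt p) = f"
    using tinf0 by (simp add: power_int_minus)
  show ?thesis using I.place_val_form[OF u, of "- int (wt p)"] unfolding e .
qed

lemma span_val:
  assumes "f \<in> V.span (mon ` J)" "J \<subseteq> red" "f \<noteq> 0" shows "\<exists>p\<in>J. vinf f = - int (wt p)"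
proof -
  obtain p c where p: "p \<in> J" "c \<noteq> 0" "f - emb c * mon p \<in> V.span (mon ` {p' \<in> J. wt p' < wt p})"
    by (rule lead_term[OF assms])
  then show ?thesis using lead_val[OF p(2,3)] by blast
qed

lemma A_val: "f \<in> A \<Longrightarrow> f \<noteq> 0 \<Longrightarrow> \<exists>p\<in>red. vinf f = - int (wt p)"
  using span_val[of f red] by (simp add: A_def)

lemma L_A: "f \<in> L m \<Longrightarrow> f \<in> A"
  unfolding L_def A_def using V.span_mono[of "mon ` {p \<in> red. int (wt p) \<le> m}" "mon ` red"] by blast

text \<open>Distinct weights exclude cancellation at infinity, so bounding the pole order bounds
  every monomial of the expansion. This turns the span into a Riemann-Roch space.\<close>

lemma L_iff: "f \<in> L m \<longleftrightarrow> f \<in> A \<and> (f = 0 \<or> vinf f \<ge> - m)"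
proof
  assume f: "f \<in> L m"
  then show "f \<in> A \<and> (f = 0 \<or> vinf f \<ge> - m)"
    using L_A span_val[of f "{p \<in> red. int (wt p) \<le> m}"] by (fastforce simp: L_def)
next
  assume f: "f \<in> A \<and> (f = 0 \<or> vinf f \<ge> - m)"
  show "f \<in> L m"
  proof (cases "f = 0")
    case True then show ?thesis by (simp add: L_def V.span_zero)
  next
    case False
    then obtain p c where p: "p \<in> red" "c \<noteq> 0" "f - emb c * mon p \<in> V.span (mon ` {p' \<in> red. wt p' < wt p})"
      using lead_term[of f red] f unfolding A_def by blast
    then have w: "int (wt p) \<le> m" using lead_val[OF p(2,3)] f False by auto
    have "mon ` {p' \<in> red. wt p' < wt p} \<subseteq> mon ` {p \<in> red. int (wt p) \<le> m}" using w by auto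
    then have "f - emb c * mon p \<in> L m" unfolding L_def using p(3) V.span_mono by blast
    moreover have "emb c * mon p \<in> L m" unfolding L_def using p w
      by (intro V.span_scale V.span_base) auto
    ultimately have "f - emb c * mon p + emb c * mon p \<in> L m" unfolding L_def by (rule V.span_add)
    then show ?thesis by simp
  qed
qed

lemma L_0: "0 \<in> L m" and L_add: "f \<in> L m \<Longrightarrow> g \<in> L m \<Longrightarrow> f + g \<in> L m"
  and L_diff: "f \<in> L m \<Longrightarrow> g \<in> L m \<Longrightarrow> f - g \<in> L m"
  and L_scale: "f \<in> L m \<Longrightarrow> emb c * f \<in> L m"
  by (auto simp: L_def V.span_zero V.span_add V.span_scale V.span_diff)

lemma L_mono: "m \<le> m' \<Longrightarrow> f \<in> L m \<Longrightarrow> f \<in> L m'" by (auto simp: L_iff)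

lemma L_mult: "f \<in> L a \<Longrightarrow> g \<in> L b \<Longrightarrow> f * g \<in> L (a + b)"
  unfolding L_iff using I.val_mult[of f g] A_mult by (cases "f = 0 \<or> g = 0") (auto simp: A_0)

lemma L_power: "f \<in> L a \<Longrightarrow> f ^ k \<in> L (int k * a)"
proof (induction k)
  case 0 show ?case using A_1 I.val_power[of 1 0] by (simp add: L_iff)
next
  case (Suc k) then show ?case using L_mult[of f a "f ^ k" "int k * a"] by (simp add: algebra_simps)
qed

lemma mon_L: "p \<in> red \<Longrightarrow> int (wt p) \<le> m \<Longrightarrow> mon p \<in> L m"
  unfolding L_def by (intro V.span_base) auto

lemma emb_L: "m \<ge> 0 \<Longrightarrow> emb c \<in> L m"
  using L_scale[OF mon_L[of "(0,0)" m], of c] r2 by (simp add: mon_def red_def wt_def)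
lemma x_L: "m \<ge> int r \<Longrightarrow> x \<in> L m"
  using mon_L[of "(1,0)" m] r2 by (simp add: mon_def red_def wt_def)
lemma y_L: "m \<ge> 2 * int r + 1 \<Longrightarrow> y \<in> L m"
  using mon_L[of "(0,1)" m] r2 by (simp add: mon_def red_def wt_def)

lemma L_eq_span:
  assumes "\<And>p. p \<in> red \<Longrightarrow> int (wt p) \<le> m \<Longrightarrow> p \<in> J" shows "L m \<subseteq> V.span (mon ` J)"
  unfolding L_def using assms by (intro V.span_mono) auto

section \<open>Comparison with the given notions of place and divisor\<close>

lemma ex_unif: assumes "valuation_ring emb R" shows "\<exists>t. is_unif R t"
proof (cases "x \<in> R")
  case True
  then obtain s where "s \<ge> 1" "ww s \<in> max_ideal R" using fin_ww_P[OF assms] by blast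
  then show ?thesis using fin_unif[OF assms True] by blast
next
  case False then show ?thesis using inf_unif[OF assms] by blast
qed

lemma max_ideal_inj:
  assumes "valuation_ring emb R" "valuation_ring emb R'" "max_ideal R = max_ideal R'" shows "R = R'"
  using val_ring.place_ring_P[OF val_ring.intro[OF assms(1)]]
    val_ring.place_ring_P[OF val_ring.intro[OF assms(2)]] assms(3) by metis

lemma is_place_iff: "is_place emb P \<longleftrightarrow> (\<exists>R. valuation_ring emb R \<and> P = max_ideal R)"
  by (simp add: is_place_def max_ideal_def)

lemma dvr_exists: "valuation_ring emb R \<Longrightarrow> \<exists>t. dvr emb R t"
  using ex_unif[of R] by (auto intro!: dvr.intro dvr_axioms.intro val_ring.intro)

lemma P_infty_eq: "P_infty emb x y = max_ideal Rinf"
  unfolding P_infty_def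
proof (rule the_equality)
  have "x \<notin> Rinf" "y \<notin> Rinf" using Rinf yR[OF Rinf] by auto
  then show "is_place emb (max_ideal Rinf) \<and> pole_at (max_ideal Rinf) x \<and> pole_at (max_ideal Rinf) y"
    using I.pole_at_iff Rinf(1) is_place_iff by blast
next
  fix P assume P: "is_place emb P \<and> pole_at P x \<and> pole_at P y"
  then obtain R where R: "valuation_ring emb R" "P = max_ideal R" using is_place_iff by blast
  obtain t where "dvr emb R t" using dvr_exists R by blast
  then have "x \<notin> R" using P R dvr.pole_at_iff by metis
  then show "P = max_ideal Rinf" using R Rinf_eq by blast
qed

text \<open>The divisor is zero at finite places, and regularity at all of them means membership in
  \<open>A\<close> by \<open>A_normal\<close>; only the order at infinity remains.\<close>

lemma RR_eq: "RR_space emb (single_divisor m (P_infty emb x y)) = L m"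
proof -
  have "(\<forall>P. is_place emb P \<longrightarrow> place_val P f + single_divisor m (max_ideal Rinf) P \<ge> 0)
    \<longleftrightarrow> f \<in> A \<and> vinf f \<ge> - m" if f: "f \<noteq> 0" for f
  proof
    assume *: "\<forall>P. is_place emb P \<longrightarrow> place_val P f + single_divisor m (max_ideal Rinf) P \<ge> 0"
    have "f \<in> A"
    proof (rule A_normal)
      fix R assume R: "valuation_ring emb R" "x \<in> R"
      then have "max_ideal R \<noteq> max_ideal Rinf" using max_ideal_inj Rinf by blast
      then have "place_val (max_ideal R) f \<ge> 0"
        using *[rule_format, of "max_ideal R"] R is_place_iff
        by (auto simp: single_divisor_def)
      moreover obtain t where "dvr emb R t" using dvr_exists R by blast
      ultimately show "f \<in> R" using f dvr.val_R by metis
    qed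
    moreover have "is_place emb (max_ideal Rinf)" using Rinf is_place_iff by blast
    then have "vinf f \<ge> - m" using *[rule_format, of "max_ideal Rinf"]
      by (auto simp: single_divisor_def)
    ultimately show "f \<in> A \<and> vinf f \<ge> - m" by blast
  next
    assume *: "f \<in> A \<and> vinf f \<ge> - m"
    show "\<forall>P. is_place emb P \<longrightarrow> place_val P f + single_divisor m (max_ideal Rinf) P \<ge> 0"
    proof (intro allI impI)
      fix P assume "is_place emb P"
      then obtain R where R: "valuation_ring emb R" "P = max_ideal R" using is_place_iff by blast
      obtain t where t: "dvr emb R t" using dvr_exists R by blast
      show "place_val P f + single_divisor m (max_ideal Rinf) P \<ge> 0"
      proof (cases "x \<in> R")
        case True
        then have "max_ideal R \<noteq> max_ideal Rinf" using max_ideal_inj Rinf R by blast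
        moreover have "f \<in> R" using fin_A[OF R(1) True] * by blast
        ultimately show ?thesis using R dvr.val_R[OF t f] by (simp add: single_divisor_def)
      next
        case False
        then show ?thesis using Rinf_eq[OF R(1)] * R by (simp add: single_divisor_def)
      qed
    qed
  qed
  then have "f \<in> RR_space emb (single_divisor m (max_ideal Rinf)) \<longleftrightarrow> f \<in> L m" for f
    unfolding RR_space_def L_iff by (cases "f = 0") (simp_all add: A_0)
  then show ?thesis unfolding P_infty_eq by blast
qed

subsection \<open>Rational points\<close>

definition fiber :: "'k \<Rightarrow> 'k set" where "fiber a = {b. h_poly n b = a ^ (2 * r + 1)}"
definition S :: "('k \<times> 'k) set" where "S = (SIGMA a:UNIV. fiber a)"

lemma card_fiber: "card (fiber a) = r" using fib by (simp add: fiber_def)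
lemma card_S: "card S = Q * r" by (simp add: S_def Q_def card_fiber)
end

lemma monic_prod_roots:
  fixes p :: "'a::field poly"
  assumes "finite T" "degree p = card T" "lead_coeff p = 1" "\<And>b. b \<in> T \<Longrightarrow> poly p b = 0"
  shows "p = (\<Prod>b\<in>T. [:- b, 1:])"
proof (rule ccontr)
  define s where "s = (\<Prod>b\<in>T. [:- b, 1:])"
  have s: "degree s = card T" "coeff s (card T) = 1"
    using lead_coeff_prod[of "\<lambda>b. [:- b, 1:]" T]
    by (auto simp: s_def degree_prod_eq_sum_degree)
  assume "p \<noteq> (\<Prod>b\<in>T. [:- b, 1:])"
  then have d: "p - s \<noteq> 0" by (simp add: s_def)
  have "coeff (p - s) (card T) = 0" using s assms by simp
  moreover have "degree (p - s) \<le> card T" using s assms by (intro degree_diff_le) auto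
  ultimately have "degree (p - s) < card T" using d by (metis leading_coeff_0_iff order_le_less)
  moreover have "T \<subseteq> {z. poly (p - s) z = 0}"
    using assms by (auto simp: s_def poly_prod prod_zero_iff)
  then have "card T \<le> card {z. poly (p - s) z = 0}" using poly_roots_finite[OF d]
    by (rule card_mono[rotated])
  ultimately show False using card_poly_roots_bound[OF d] by simp
qed

lemma degree_lead_h:
  fixes c :: "'a::field"
  assumes "n \<ge> 1"
  defines "p \<equiv> (\<Sum>i<n. monom 1 (2 ^ i)) - [:c:]"
  shows "degree p = 2 ^ (n - 1)" "lead_coeff p = 1" "poly p z = h_poly n z - c"
proof -
  define s where "s k = (\<Sum>i<k. monom 1 (2 ^ i)) - [:c:]" for k
  have ss: "s (Suc k) = s k + monom 1 (2 ^ k)" for k by (simp add: s_def)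
  have deg: "degree (s k) < 2 ^ k" for k
  proof (induction k)
    case (Suc k)
    then have "degree (s (Suc k)) \<le> 2 ^ k" unfolding ss
      by (intro degree_add_le) (auto simp: degree_monom_eq)
    also have "\<dots> < 2 ^ Suc k" by simp
    finally show ?case .
  qed (simp add: s_def)
  have p: "p = s (n - 1) + monom 1 (2 ^ (n - 1))" using assms ss[of "n - 1"] by (simp add: s_def)
  show "degree p = 2 ^ (n - 1)" unfolding p using deg
    by (subst degree_add_eq_right) (auto simp: degree_monom_eq)
  then show "lead_coeff p = 1" using deg by (simp add: p coeff_eq_0)
  show "poly p z = h_poly n z - c" by (simp add: p_def poly_sum poly_monom h_poly_def)
qed

context Y2_curve begin

text \<open>The fibre has as many elements as \<open>h\<close> has degree, so the polynomial splits
  into linear factors with rational roots.\<close>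

lemma prod_fiber: "(\<Prod>b\<in>fiber a. z - emb b) = h_poly n z - emb (a ^ (2 * r + 1))"
proof -
  define p where "p = (\<Sum>i<n. monom 1 (2 ^ i)) - [:emb (a ^ (2 * r + 1)):]"
  have n1: "n \<ge> 1" using n2 by simp
  note h = degree_lead_h[OF n1, of "emb (a ^ (2 * r + 1))", folded p_def]
  have inj: "inj_on emb (fiber a)" by (auto intro: inj_onI)
  have "p = (\<Prod>b\<in>emb ` fiber a. [:- b, 1:])"
  proof (rule monic_prod_roots[OF _ _ h(2)])
    show "degree p = card (emb ` fiber a)" using h(1) card_image[OF inj] card_fiber r_eq by simp
    show "poly p b = 0" if "b \<in> emb ` fiber a" for b using that h(3)[of b]
      by (auto simp: h_emb fiber_def)
  qed simp
  also have "\<dots> = (\<Prod>b\<in>fiber a. [:- emb b, 1:])" by (simp add: prod.reindex[OF inj])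
  finally have "poly p z = (\<Prod>b\<in>fiber a. z - emb b)" by (simp add: poly_prod)
  then show ?thesis using h(3) by simp
qed

lemma prod_K: "(\<Prod>a\<in>UNIV. z - emb a) = z ^ Q - z"
proof -
  define p where "p = monom (1::'f) Q - monom 1 1"
  have "coeff p Q = 1" using Q2 by (simp add: p_def)
  moreover have "degree p \<le> Q" unfolding p_def using Q2
    by (intro degree_diff_le) (auto intro: order.trans[OF degree_monom_le])
  ultimately have d: "degree p = Q" by (metis le_degree order_antisym one_neq_zero)
  then have d1: "lead_coeff p = 1" using \<open>coeff p Q = 1\<close> by simp
  have inj: "inj_on emb UNIV" by (auto intro: inj_onI)
  have "p = (\<Prod>b\<in>range emb. [:- b, 1:])"
    by (rule monic_prod_roots[OF _ _ d1]) (auto simp: d card_image[OF inj] Q_def[symmetric], simp add: p_def poly_monom emb_Q)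
  also have "\<dots> = (\<Prod>b\<in>UNIV. [:- emb b, 1:])" by (simp add: prod.reindex[OF inj])
  finally have "poly p z = (\<Prod>b\<in>UNIV. z - emb b)" by (simp add: poly_prod)
  then show ?thesis by (simp add: p_def poly_monom)
qed

lemma x_emb: "x \<noteq> emb a" and y_emb: "y \<noteq> emb b"
  using Rinf(2) yR[OF Rinf] I.emb_in by auto

lemma ww1: "ww 1 = (\<Prod>a\<in>UNIV. x - emb a)" by (simp add: ww_def prod_K)

lemma span_prod_linear:
  "finite T \<Longrightarrow> (\<Prod>b\<in>T. z - emb (c b)) \<in> V.span ((\<lambda>i. z ^ i) ` {..card T})"
proof (induction T rule: finite_induct)
  case empty show ?case by (auto intro: V.span_base)
next
  case (insert b T)
  let ?X = "V.span ((\<lambda>i. z ^ i) ` {..Suc (card T)})"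
  have *: "z * f \<in> ?X \<and> f \<in> ?X" if "f \<in> V.span ((\<lambda>i. z ^ i) ` {..card T})" for f
    using that
  proof (induction rule: V.span_induct_alt)
    case base show ?case using V.span_zero by simp
  next
    case (step c m g)
    then obtain i where i: "m = z ^ i" "i \<le> card T" by auto
    then have "z * m \<in> (\<lambda>i. z ^ i) ` {..Suc (card T)}" "m \<in> (\<lambda>i. z ^ i) ` {..Suc (card T)}"
      by (auto intro: image_eqI[of _ _ "Suc i"])
    then have "emb c * (z * m) + z * g \<in> ?X" "emb c * m + g \<in> ?X"
      using step.IH by (intro V.span_add V.span_scale; blast intro: V.span_base)+
    then show ?case by (simp add: algebra_simps)
  qed
  have "(\<Prod>b\<in>insert b T. z - emb (c b)) = z * (\<Prod>b\<in>T. z - emb (c b)) - emb (c b) * (\<Prod>b\<in>T. z - emb (c b))"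
    using insert by (simp add: algebra_simps)
  also have "\<dots> \<in> ?X" using *[OF insert.IH] by (intro V.span_diff V.span_scale) auto
  finally show ?case using insert by simp
qed

lemma box_mult:
  assumes "f \<in> V.span ((\<lambda>i. x ^ i) ` {..<B})" "g \<in> V.span ((\<lambda>i. y ^ i) ` {..<r})"
  shows "f * g \<in> V.span (mon ` box B)"
proof -
  have *: "x ^ i * g \<in> V.span (mon ` box B)" if "i < B" for i
    using assms(2)
  proof (induction rule: V.span_induct_alt)
    case base show ?case using V.span_zero by simp
  next
    case (step c m g)
    then obtain j where "m = y ^ j" "j < r" by auto
    then have "x ^ i * m \<in> mon ` box B" using that
      by (intro image_eqI[of _ _ "(i, j)"]) (auto simp: mon_def box_def)
    then have "emb c * (x ^ i * m) + x ^ i * g \<in> V.span (mon ` box B)"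
      using step.IH by (intro V.span_add V.span_scale) (auto intro: V.span_base)
    then show ?case by (simp add: algebra_simps)
  qed
  show ?thesis using assms(1)
  proof (induction rule: V.span_induct_alt)
    case base show ?case using V.span_zero by simp
  next
    case (step c m f)
    then have "m * g \<in> V.span (mon ` box B)" using * by auto
    then have "emb c * (m * g) + f * g \<in> V.span (mon ` box B)"
      using step.IH by (intro V.span_add V.span_scale)
    then show ?case by (simp add: algebra_simps)
  qed
qed

text \<open>An unnormalised Lagrange function, for \<open>b\<close> in the fibre of
  \<open>a\<close>: among the rational points it is non-zero exactly at \<open>(a, b)\<close>, and
  its degrees in \<open>x\<close> and \<open>y\<close> stay below \<open>Q\<close> and
  \<open>r\<close>.\<close>

definition delta :: "'k \<Rightarrow> 'k \<Rightarrow> 'f" where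
  "delta a b = (\<Prod>a'\<in>UNIV - {a}. x - emb a') * (\<Prod>b'\<in>fiber a - {b}. y - emb b')"

lemma delta_box: assumes "b \<in> fiber a" shows "delta a b \<in> V.span (mon ` box Q)"
  unfolding delta_def
proof (rule box_mult)
  have "Suc (Q - 1) = Q" using Q2 by simp
  then show "(\<Prod>a'\<in>UNIV - {a}. x - emb a') \<in> V.span ((\<lambda>i. x ^ i) ` {..<Q})"
    using span_prod_linear[of "UNIV - {a}" x "\<lambda>a. a"]
    by (simp add: card_Diff_singleton Q_def[symmetric] lessThan_Suc_atMost[symmetric])
  have "Suc (r - 1) = r" using r2 by simp
  then show "(\<Prod>b'\<in>fiber a - {b}. y - emb b') \<in> V.span ((\<lambda>i. y ^ i) ` {..<r})"
    using span_prod_linear[of "fiber a - {b}" y "\<lambda>a. a"] assms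
    by (simp add: card_Diff_singleton card_fiber lessThan_Suc_atMost[symmetric])
qed

lemma box_A: "f \<in> V.span (mon ` box B) \<Longrightarrow> f \<in> A"
  unfolding A_def using V.span_mono[OF image_mono[OF box_red]] by blast

lemma vinf_x: "vinf x = - int r"
  using lead_val[of 1 x "(1,0)" red] by (simp add: mon_def wt_def V.span_zero)
lemma vinf_y: "vinf y = - (2 * int r + 1)"
  using lead_val[of 1 y "(0,1)" red] by (simp add: mon_def wt_def V.span_zero)

lemma vinf_x_emb: "vinf (x - emb a) = - int r"
proof -
  have "- emb a = emb (-a) * mon (0,0)" by (simp add: mon_def emb_uminus)
  moreover have "mon (0,0) \<in> V.span (mon ` {p' \<in> red. wt p' < wt (1,0)})"
    using r2 by (intro V.span_base imageI) (auto simp: red_def wt_def)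
  ultimately have "- emb a \<in> V.span (mon ` {p' \<in> red. wt p' < wt (1,0)})"
    using V.span_scale by metis
  moreover have "x - emb a - emb 1 * mon (1,0) = - emb a" by (simp add: mon_def)
  ultimately have "x - emb a - emb 1 * mon (1,0) \<in> V.span (mon ` {p' \<in> red. wt p' < wt (1,0)})"
    by metis
  then show ?thesis using lead_val[of 1 "x - emb a" "(1,0)" red] by (simp add: wt_def)
qed

lemma val_prod: "finite J \<Longrightarrow> (\<And>i. i \<in> J \<Longrightarrow> f i \<noteq> 0) \<Longrightarrow> vinf (prod f J) = (\<Sum>i\<in>J. vinf (f i))"
proof (induction J rule: finite_induct)
  case empty show ?case using I.val_power[of 1 0] by simp
qed (simp add: I.val_mult)

lemma vinf_ww1: "vinf (ww 1) = - int (Q * r)"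
  unfolding ww1 by (subst val_prod) (auto simp: x_emb vinf_x_emb Q_def)

text \<open>The leading weight of a multiple of \<open>ww 1\<close> belongs to a reduced monomial
  whose exponent of \<open>x\<close> is at least \<open>Q\<close>; weights being distinct, no
  element of the box attains it.\<close>

lemma ww1_not_dvd_box:
  assumes "f \<in> V.span (mon ` box Q)" "f \<noteq> 0" shows "\<not> cong_ww 1 f 0"
proof
  assume "cong_ww 1 f 0"
  then obtain a where a: "a \<in> A" "f = ww 1 * a" by (auto simp: cong_ww_def)
  then have nz: "a \<noteq> 0" "ww 1 \<noteq> 0" using assms by auto
  obtain p where p: "p \<in> red" "vinf a = - int (wt p)" using A_val a nz by blast
  obtain p' where p': "p' \<in> box Q" "vinf f = - int (wt p')"
    using span_val[OF assms(1) box_red] assms by blast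
  have "vinf f = - int (Q * r) - int (wt p)" using I.val_mult[OF nz(2,1)] a p vinf_ww1 by simp
  then have "int (wt p') = int (wt (fst p + Q, snd p))" using p' by (simp add: wt_def algebra_simps)
  then have "wt p' = wt (fst p + Q, snd p)" by (simp only: of_nat_eq_iff)
  moreover have "(fst p + Q, snd p) \<in> red" "p' \<in> red" using p p' box_red by (auto simp: red_def)
  ultimately have "p' = (fst p + Q, snd p)" using wt_inj by blast
  then show False using p' by (simp add: box_def)
qed

section \<open>Rational points as valuation rings\<close>

definition at_point :: "'f set \<Rightarrow> 'k \<times> 'k \<Rightarrow> bool" where
  "at_point R p \<longleftrightarrow> valuation_ring emb R \<and> x - emb (fst p) \<in> max_ideal R \<and> y - emb (snd p) \<in> max_ideal R"

lemma at_point_x: "at_point R p \<Longrightarrow> x \<in> R"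
proof -
  assume *: "at_point R p"
  then interpret val_ring emb R by (unfold_locales) (simp add: at_point_def)
  have "x - emb (fst p) \<in> R" using * P_R by (auto simp: at_point_def)
  then have "x - emb (fst p) + emb (fst p) \<in> R" using emb_in R_closed(6) by blast
  then show ?thesis by simp
qed

lemma fin_ww1_point:
  assumes R: "valuation_ring emb R" "x \<in> R" "ww 1 \<in> max_ideal R"
  shows "\<exists>p\<in>S. at_point R p"
proof -
  interpret val_ring emb R using R by unfold_locales
  have AR: "A \<subseteq> R" using fin_A R by blast
  have l: "z \<in> A \<Longrightarrow> z - emb a \<in> R" for a z using AR A_emb A_diff by blast
  obtain a where a: "x - emb a \<in> P"
    using R(3)[unfolded ww1] P_prime_prod[of UNIV "\<lambda>a. x - emb a"] l xA
    by auto
  have "(\<Prod>b\<in>fiber a. y - emb b) = x ^ (2 * r + 1) - emb a ^ (2 * r + 1)"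
    by (simp add: prod_fiber eqn emb_power emb_mult)
  also have "\<dots> = (x - emb a) * (\<Sum>i<2 * r + 1. emb a ^ (2 * r + 1 - Suc i) * x ^ i)"
    by (rule power_diff_sumr2)
  also have "\<dots> \<in> P" using a R emb_in by (intro P_mult is_subring_sum[OF sub]) (auto simp: R_closed)
  finally obtain b where "b \<in> fiber a" "y - emb b \<in> P"
    using P_prime_prod[of "fiber a" "\<lambda>b. y - emb b"] l yA by auto
  then show ?thesis using a R(1) by (intro bexI[of _ "(a, b)"]) (auto simp: S_def at_point_def)
qed

text \<open>By \<open>ww_not_dvd_place\<close> there is a finite place where
  \<open>delta a b / ww 1\<close> has a pole. There \<open>ww 1\<close> vanishes, so the place lies
  over some rational point, and \<open>delta a b\<close> does not vanish, which leaves only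
  \<open>(a, b)\<close>.\<close>

lemma at_point_exists: assumes "p \<in> S" shows "\<exists>R. at_point R p"
proof -
  obtain a b where ab: "p = (a, b)" "b \<in> fiber a" using assms by (auto simp: S_def)
  define g where "g = delta a b"
  have g: "g \<in> V.span (mon ` box Q)" "g \<noteq> 0" using delta_box[OF ab(2)] x_emb y_emb
    by (auto simp: g_def delta_def)
  then obtain R where R: "valuation_ring emb R" "A \<subseteq> R" "g / ww 1 \<notin> R"
    using ww_not_dvd_place[OF box_A ww1_not_dvd_box] by (metis order_refl)
  interpret val_ring emb R using R by unfold_locales
  have xR: "x \<in> R" using R xA by blast
  have gR: "g \<in> R" using R box_A g by blast
  have w: "ww 1 \<in> P"
  proof (rule ccontr)
    assume "ww 1 \<notin> P"
    then have "inverse (ww 1) \<in> R" by (simp add: P_iff)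
    then show False using R(3) gR by (simp add: divide_inverse R_closed)
  qed
  interpret dvr emb R "ww 1" by unfold_locales (use R xR fin_unif w in auto)
  have gP: "g \<notin> P"
  proof
    assume "g \<in> P"
    then obtain z where "z \<in> R" "g = ww 1 * z" using P_eq by blast
    then show False using R(3) t0 by simp
  qed
  obtain p' where p': "p' \<in> S" "at_point R p'" using fin_ww1_point[OF R(1) xR w] by blast
  have l: "z \<in> A \<Longrightarrow> z - emb c \<in> R" for c z using R(2) A_emb A_diff by blast
  have g1: "(\<Prod>a'\<in>UNIV - {a}. x - emb a') \<notin> P" "(\<Prod>b'\<in>fiber a - {b}. y - emb b') \<notin> P"
    using gP P_mult P_mult2 is_subring_prod[OF sub] l xA yA unfolding g_def delta_def by metis+
  have "fst p' = a"
  proof (rule ccontr)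
    assume "fst p' \<noteq> a"
    then have "(\<Prod>a'\<in>UNIV - {a}. x - emb a') =
      (x - emb (fst p')) * (\<Prod>a'\<in>UNIV - {a} - {fst p'}. x - emb a')"
      by (intro prod.remove) auto
    moreover have "\<dots> \<in> P" using p'(2) l xA
      by (intro P_mult is_subring_prod[OF sub]) (auto simp: at_point_def)
    ultimately show False using g1 by simp
  qed
  moreover have "snd p' = b"
  proof (rule ccontr)
    assume "snd p' \<noteq> b"
    then have "snd p' \<in> fiber a - {b}" using p'(1) \<open>fst p' = a\<close> by (auto simp: S_def)
    then have "(\<Prod>b'\<in>fiber a - {b}. y - emb b') =
      (y - emb (snd p')) * (\<Prod>b'\<in>fiber a - {b} - {snd p'}. y - emb b')"
      by (intro prod.remove) auto
    moreover have "\<dots> \<in> P" using p'(2) l yA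
      by (intro P_mult is_subring_prod[OF sub]) (auto simp: at_point_def)
    ultimately show False using g1 by simp
  qed
  ultimately show ?thesis using p' ab by (metis prod.collapse)
qed

text \<open>The residue is computed from the coordinates before any \<open>R\<close> is chosen;
  hence two valuation rings over the same point cut out the same ideal of \<open>A\<close> and
  coincide.\<close>

lemma at_point_residue:
  assumes "f \<in> A"
  shows "\<exists>c. \<forall>R. at_point R p \<longrightarrow> f - emb c \<in> max_ideal R"
  using assms
proof (induction rule: A_induct)
  case zero show ?case by (intro exI[of _ 0]) (auto simp: at_point_def intro!: val_ring.P_zero val_ring.intro)
next
  case (step c q g)
  then obtain d where d: "\<And>R. at_point R p \<Longrightarrow> g - emb d \<in> max_ideal R" by blast
  show ?case
  proof (intro exI[of _ "c * (fst p ^ fst q * snd p ^ snd q) + d"] allI impI)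
    fix R assume R: "at_point R p"
    then interpret val_ring emb R by (unfold_locales) (simp add: at_point_def)
    have AR: "A \<subseteq> R" using fin_A[of R] at_point_x[OF R] R by (simp add: at_point_def)
    have pw: "z ^ k - emb e ^ k \<in> P" if "z - emb e \<in> P" "z \<in> R" for z e k
    proof -
      have "z ^ k - emb e ^ k = (z - emb e) * (\<Sum>i<k. emb e ^ (k - Suc i) * z ^ i)"
        by (rule power_diff_sumr2)
      also have "\<dots> \<in> P" using that emb_in
        by (intro P_mult is_subring_sum[OF sub]) (auto simp: R_closed)
      finally show ?thesis .
    qed
    define X Y where "X = emb (fst p) ^ fst q" and "Y = emb (snd p) ^ snd q"
    have 1: "x ^ fst q - X \<in> P" "y ^ snd q - Y \<in> P"
      using pw R AR xA yA by (auto simp: at_point_def X_def Y_def)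
    have "emb c * mon q + g - emb (c * (fst p ^ fst q * snd p ^ snd q) + d) =
      emb c * ((x ^ fst q - X) * y ^ snd q + X * (y ^ snd q - Y)) + (g - emb d)"
      by (simp add: mon_def emb_add emb_mult emb_power X_def Y_def algebra_simps)
    also have "\<dots> \<in> P" using 1 d[OF R] emb_in AR yA
      by (intro P_add P_mult2[OF emb_in] P_mult P_mult2) (auto simp: X_def R_closed)
    finally show "emb c * mon q + g - emb (c * (fst p ^ fst q * snd p ^ snd q) + d) \<in> P" .
  qed
qed

lemma emb_P: "valuation_ring emb R \<Longrightarrow> emb c \<in> max_ideal R \<longleftrightarrow> c = 0"
  using val_ring.P_iff[of emb R "emb c"] val_ring.emb_in[of emb R "inverse c"]
  by (auto simp: val_ring_def emb_inverse)

lemma at_point_unique: assumes R: "at_point R p" "at_point R' p" shows "R = R'"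
proof (rule fin_unique)
  show v: "valuation_ring emb R" "valuation_ring emb R'" "x \<in> R" "x \<in> R'"
    using R at_point_x by (auto simp: at_point_def)
  interpret a: val_ring emb R using v by unfold_locales
  interpret b: val_ring emb R' using v by unfold_locales
  have "f \<in> max_ideal R \<longleftrightarrow> f \<in> max_ideal R'" if fA: "f \<in> A" for f
  proof -
    obtain c where c: "\<And>R. at_point R p \<Longrightarrow> f - emb c \<in> max_ideal R" using at_point_residue[OF fA]
      by blast
    have "f \<in> max_ideal R \<longleftrightarrow> emb c \<in> max_ideal R"
      using a.P_add[OF c[OF R(1)], of "emb c"] a.P_diff[OF _ c[OF R(1)], of f] by auto
    moreover have "f \<in> max_ideal R' \<longleftrightarrow> emb c \<in> max_ideal R'"
      using b.P_add[OF c[OF R(2)], of "emb c"] b.P_diff[OF _ c[OF R(2)], of f] by auto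
    ultimately show ?thesis using emb_P v by blast
  qed
  then show "A \<inter> max_ideal R = A \<inter> max_ideal R'" by blast
qed

definition Rpt :: "'k \<times> 'k \<Rightarrow> 'f set" where "Rpt p = (THE R. at_point R p)"

lemma Rpt: assumes "p \<in> S" shows "at_point (Rpt p) p"
proof -
  have "\<exists>!R. at_point R p" using at_point_exists[OF assms] at_point_unique by blast
  from theI'[OF this] show ?thesis by (simp add: Rpt_def)
qed

lemma Rpt_eq: "p \<in> S \<Longrightarrow> at_point R p \<Longrightarrow> R = Rpt p" using Rpt at_point_unique by blast

lemma P_affine_eq: assumes "(a, b) \<in> S" shows "P_affine emb x y a b = max_ideal (Rpt (a, b))"
  unfolding P_affine_def
proof (rule the_equality)
  have R: "at_point (Rpt (a, b)) (a, b)" using Rpt assms by blast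
  obtain t where t: "dvr emb (Rpt (a, b)) t" using dvr_exists R by (auto simp: at_point_def)
  show "is_place emb (max_ideal (Rpt (a, b))) \<and> zero_at (max_ideal (Rpt (a, b))) (x - emb a)
      \<and> zero_at (max_ideal (Rpt (a, b))) (y - emb b)"
    using R is_place_iff dvr.zero_at_iff[OF t] x_emb y_emb by (auto simp: at_point_def)
next
  fix P assume P: "is_place emb P \<and> zero_at P (x - emb a) \<and> zero_at P (y - emb b)"
  then obtain R where R: "valuation_ring emb R" "P = max_ideal R" using is_place_iff by blast
  obtain t where t: "dvr emb R t" using dvr_exists R by blast
  have "at_point R (a, b)" using P R dvr.zero_at_iff[OF t] by (auto simp: at_point_def)
  then show "P = max_ideal (Rpt (a, b))" using Rpt_eq assms R by blast
qed

section \<open>Evaluation at rational points\<close>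

definition ev :: "'k \<times> 'k \<Rightarrow> 'f \<Rightarrow> 'k" where "ev p f = place_eval emb (max_ideal (Rpt p)) f"

lemma ev_eqI: assumes "p \<in> S" "f - emb c \<in> max_ideal (Rpt p)" shows "ev p f = c"
  unfolding ev_def place_eval_def
proof (rule the_equality)
  fix d assume d: "f - emb d \<in> max_ideal (Rpt p)"
  have v: "valuation_ring emb (Rpt p)" using Rpt assms by (auto simp: at_point_def)
  then interpret val_ring emb "Rpt p" by unfold_locales
  have "emb (c - d) \<in> P" using P_diff[OF d assms(2)] by (simp add: emb_diff)
  then show "d = c" using emb_P[OF v] by simp
qed fact

lemma ev_P: assumes "p \<in> S" "f \<in> A" shows "f - emb (ev p f) \<in> max_ideal (Rpt p)"
proof -
  obtain c where "f - emb c \<in> max_ideal (Rpt p)" using at_point_residue[OF assms(2)] Rpt assms(1)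
    by blast
  then show ?thesis using ev_eqI assms by metis
qed

lemma ev_0_iff: assumes "p \<in> S" "f \<in> A" shows "ev p f = 0 \<longleftrightarrow> f \<in> max_ideal (Rpt p)"
  using ev_P[OF assms] ev_eqI[OF assms(1), of f 0] by auto

lemma ev_emb: "p \<in> S \<Longrightarrow> ev p (emb c) = c"
  using Rpt[of p] val_ring.P_zero[of emb "Rpt p"]
    by (intro ev_eqI) (auto simp: at_point_def val_ring_def)
lemma ev_x: "p \<in> S \<Longrightarrow> ev p x = fst p" using Rpt by (intro ev_eqI) (auto simp: at_point_def)
lemma ev_y: "p \<in> S \<Longrightarrow> ev p y = snd p" using Rpt by (intro ev_eqI) (auto simp: at_point_def)

lemma ev_add: assumes "p \<in> S" "f \<in> A" "g \<in> A" shows "ev p (f + g) = ev p f + ev p g"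
proof (rule ev_eqI[OF assms(1)])
  interpret val_ring emb "Rpt p" using Rpt assms by unfold_locales (auto simp: at_point_def)
  show "f + g - emb (ev p f + ev p g) \<in> P"
    using P_add[OF ev_P[OF assms(1,2)] ev_P[OF assms(1,3)]] by (simp add: emb_add algebra_simps)
qed

lemma ev_mult: assumes "p \<in> S" "f \<in> A" "g \<in> A" shows "ev p (f * g) = ev p f * ev p g"
proof (rule ev_eqI[OF assms(1)])
  have R: "at_point (Rpt p) p" using Rpt assms by blast
  interpret val_ring emb "Rpt p" using R by unfold_locales (auto simp: at_point_def)
  have "g \<in> Rpt p" using fin_A[of "Rpt p"] at_point_x[OF R] R assms by (auto simp: at_point_def)
  then have "(f - emb (ev p f)) * g + emb (ev p f) * (g - emb (ev p g)) \<in> P"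
    using ev_P assms emb_in by (intro P_add P_mult P_mult2)
  then show "f * g - emb (ev p f * ev p g) \<in> P" by (simp add: emb_mult algebra_simps)
qed

lemma ev_scale: "p \<in> S \<Longrightarrow> f \<in> A \<Longrightarrow> ev p (emb c * f) = c * ev p f"
  using ev_mult[of p "emb c" f] ev_emb A_emb by simp
lemma ev_0: "p \<in> S \<Longrightarrow> ev p 0 = 0" using ev_emb[of p 0] by simp
lemma ev_diff: "p \<in> S \<Longrightarrow> f \<in> A \<Longrightarrow> g \<in> A \<Longrightarrow> ev p (f - g) = ev p f - ev p g"
  using ev_add[of p "f - g" g] A_diff by simp
lemma ev_power: "p \<in> S \<Longrightarrow> f \<in> A \<Longrightarrow> ev p (f ^ k) = ev p f ^ k"
proof (induction k)
  case 0 then show ?case using ev_emb[of p 1] by simp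
next
  case (Suc k) then show ?case by (simp add: ev_mult A_closed)
qed
lemma ev_sum: "p \<in> S \<Longrightarrow> (\<And>i. i \<in> J \<Longrightarrow> f i \<in> A) \<Longrightarrow> ev p (sum f J) = (\<Sum>i\<in>J. ev p (f i))"
proof (induction J rule: infinite_finite_induct)
  case (insert i J)
  then have "sum f J \<in> A" by (intro A_sum) auto
  then show ?case using insert by (simp add: ev_add)
qed (auto simp: ev_0)
lemma ev_prod: "p \<in> S \<Longrightarrow> (\<And>i. i \<in> J \<Longrightarrow> f i \<in> A) \<Longrightarrow> ev p (prod f J) = (\<Prod>i\<in>J. ev p (f i))"
proof (induction J rule: infinite_finite_induct)
  case (insert i J)
  then have "prod f J \<in> A" by (intro is_subring_prod[OF A_subring]) auto
  then show ?case using insert by (simp add: ev_mult)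
qed (use ev_emb[of p 1] in auto)
lemma ev_mon: "p \<in> S \<Longrightarrow> ev p (mon q) = fst p ^ fst q * snd p ^ snd q"
  by (simp add: mon_def ev_mult ev_power ev_x ev_y xA yA A_closed)
lemma ev_h: "p \<in> S \<Longrightarrow> f \<in> A \<Longrightarrow> ev p (h_poly n f) = h_poly n (ev p f)"
  unfolding h_poly_def by (simp add: ev_sum ev_power A_closed)

text \<open>\<open>ww 1\<close> is the product of all \<open>x - emb a\<close>, and all of these
  factors but one are units at the point.\<close>

lemma unif_point: assumes "p \<in> S" shows "is_unif (Rpt p) (x - emb (fst p))"
proof -
  have R: "at_point (Rpt p) p" using Rpt assms by blast
  then have v: "valuation_ring emb (Rpt p)" "x \<in> Rpt p" using at_point_x
    by (auto simp: at_point_def)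
  interpret val_ring emb "Rpt p" using v by unfold_locales
  define u where "u = (\<Prod>a\<in>UNIV - {fst p}. x - emb a)"
  have wu: "ww 1 = (x - emb (fst p)) * u" unfolding ww1 u_def
    by (simp add: prod.remove[of UNIV "fst p"])
  have uA: "u \<in> A" unfolding u_def
    by (intro is_subring_prod[OF A_subring]) (simp add: A_diff xA A_emb)
  have uR: "u \<in> Rpt p" using uA fin_A v by blast
  have "ev p u = (\<Prod>a\<in>UNIV - {fst p}. fst p - a)"
    unfolding u_def using assms by (simp add: ev_prod A_diff xA A_emb ev_diff ev_x ev_emb)
  then have "ev p u \<noteq> 0" by simp
  then have un: "unit_of (Rpt p) u" using ev_0_iff[OF assms uA] uR unit_iff by blast
  have "ww 1 \<in> P" unfolding wu using R uR by (intro P_mult) (auto simp: at_point_def)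
  then interpret dvr emb "Rpt p" "ww 1" by unfold_locales (use v fin_unif in auto)
  have "ww 1 * inverse u = x - emb (fst p)" using wu un by (simp add: unit_of_def)
  then show ?thesis using unif_associate[OF unit_inverse[OF un]] by simp
qed

text \<open>The finite zeros of \<open>ww 1\<close> are the rational points, and they are simple. So
  \<open>f / ww 1\<close> is regular at all finite places, and a non-zero \<open>f\<close> has pole
  order at least \<open>Q * r\<close>, the number of points.\<close>

lemma ev_zero_imp_zero:
  assumes "f \<in> L d" "d < int (Q * r)" "\<And>p. p \<in> S \<Longrightarrow> ev p f = 0" shows "f = 0"
proof (rule ccontr)
  assume f0: "f \<noteq> 0"
  have fA: "f \<in> A" using assms L_A by blast
  have w0: "ww 1 \<noteq> 0" by (simp add: ww_0)
  have "f / ww 1 \<in> A"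
  proof (rule A_normal)
    fix R assume R: "valuation_ring emb R" "x \<in> R"
    interpret val_ring emb R using R by unfold_locales
    have fR: "f \<in> R" using fin_A R fA by blast
    show "f / ww 1 \<in> R"
    proof (cases "ww 1 \<in> P")
      case False
      then have "inverse (ww 1) \<in> R" by (simp add: P_iff)
      then show ?thesis using fR by (simp add: divide_inverse R_closed)
    next
      case True
      then interpret dvr emb R "ww 1" by unfold_locales (use R fin_unif in auto)
      obtain p where p: "p \<in> S" "at_point R p" using fin_ww1_point R True by blast
      then have "R = Rpt p" using Rpt_eq by blast
      then have "f \<in> P" using ev_0_iff[OF p(1) fA] assms(3) p by simp
      then obtain z where "z \<in> R" "f = ww 1 * z" using P_eq by blast
      then show ?thesis using w0 by simp
    qed
  qed
  then obtain q where q: "vinf (f / ww 1) = - int (wt q)" using A_val f0 w0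
    by (metis divide_eq_0_iff)
  have "vinf f = vinf (f / ww 1) + vinf (ww 1)" using I.val_mult[of "f / ww 1" "ww 1"] f0 w0 by simp
  then have "vinf f \<le> - int (Q * r)" using q vinf_ww1 by simp
  then show False using assms f0 by (auto simp: L_iff)
qed

end

subsection \<open>Duality\<close>

text \<open>Lagrange interpolation of the \<open>j\<close>-th power on the set has the common
  denominator \<open>\<kappa>\<close>; comparing coefficients of degree \<open>card T - 1\<close>
  gives the power sum.\<close>

lemma sum_power_coset:
  fixes T :: "'a::field set"
  assumes T: "finite T" and \<kappa>: "\<And>b. b \<in> T \<Longrightarrow> (\<Prod>b'\<in>T - {b}. b - b') = \<kappa>" and j: "j < card T"
  shows "(\<Sum>b\<in>T. b ^ j) = (if j = card T - 1 then \<kappa> else 0)"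
proof -
  define l where "l b = (\<Prod>b'\<in>T - {b}. [:- b', 1:])" for b
  define p where "p = (\<Sum>b\<in>T. smult (b ^ j) (l b)) - monom \<kappa> j"
  have dl: "degree (l b) = card T - 1" "coeff (l b) (card T - 1) = 1" if "b \<in> T" for b
    using that T lead_coeff_prod[of "\<lambda>b. [:- b, 1:]" "T - {b}"]
    by (auto simp: l_def degree_prod_eq_sum_degree)
  have lb: "poly (l b) z = (if b = z then \<kappa> else 0)" if "b \<in> T" "z \<in> T" for b z
    using that T \<kappa> by (auto simp: l_def poly_prod)
  have "poly p z = 0" if "z \<in> T" for z
  proof -
    have "(\<Sum>b\<in>T. b ^ j * poly (l b) z) = (\<Sum>b\<in>T. if b = z then z ^ j * \<kappa> else 0)"
      using that lb by (intro sum.cong) auto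
    then show ?thesis using that T by (simp add: p_def poly_sum poly_monom)
  qed
  moreover have "degree p \<le> card T - 1" unfolding p_def using dl j
    by (intro degree_diff_le degree_sum_le order.trans[OF degree_smult_le] order.trans[OF degree_monom_le] T) auto
  then have "degree p < card T" using j by linarith
  ultimately have "p = 0"
    using card_poly_roots_bound[of p] poly_roots_finite[of p] card_mono[of "{z. poly p z = 0}" T]
      by fastforce
  then have "coeff p (card T - 1) = 0" by simp
  then have "(\<Sum>b\<in>T. b ^ j * coeff (l b) (card T - 1)) = (if j = card T - 1 then \<kappa> else 0)"
    by (simp add: p_def coeff_sum coeff_monom)
  then show ?thesis using dl by simp
qed

context Y2_curve begin

definition \<kappa>y :: 'k where "\<kappa>y = (\<Prod>v\<in>fiber 0 - {0}. v)"
definition \<kappa>x :: 'k where "\<kappa>x = (\<Prod>v\<in>UNIV - {0}. v)"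

lemma \<kappa>_nz: "\<kappa>y \<noteq> 0" "\<kappa>x \<noteq> 0" by (auto simp: \<kappa>y_def \<kappa>x_def)

text \<open>Each fibre is a translate of \<open>fiber 0\<close>, the kernel of the additive map
  \<open>h\<close>, so the product depends neither on the fibre nor on the point.\<close>

lemma prod_fiber_diff: assumes "b \<in> fiber a" shows "(\<Prod>b'\<in>fiber a - {b}. b - b') = \<kappa>y"
  unfolding \<kappa>y_def
proof (rule prod.reindex_bij_witness[of _ "\<lambda>v. b - v" "\<lambda>b'. b - b'"])
  note c = char2_neg[OF c2K]
  have h: "h_poly n (b - v) = h_poly n b - h_poly n v" for v
    unfolding c using h_poly_add[OF c2K] .
  fix v assume "v \<in> fiber 0 - {0}"
  then show "b - v \<in> fiber a - {b}" using assms h by (auto simp: fiber_def)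
next
  have h: "h_poly n (b - v) = h_poly n b - h_poly n v" for v
    unfolding char2_neg[OF c2K] using h_poly_add[OF c2K] .
  fix v assume "v \<in> fiber a - {b}"
  then show "b - v \<in> fiber 0 - {0}" using assms h by (auto simp: fiber_def)
qed auto

lemma prod_K_diff: "(\<Prod>a'\<in>UNIV - {a}. a - a') = \<kappa>x"
  unfolding \<kappa>x_def
  by (rule prod.reindex_bij_witness[of _ "\<lambda>v. a - v" "\<lambda>b'. a - b'"]) auto

text \<open>On products this is the standard inner product of two codewords.\<close>

definition tr :: "'f \<Rightarrow> 'k" where "tr f = (\<Sum>p\<in>S. ev p f)"
text \<open>The weight of the top monomial of \<open>box Q\<close>. With \<open>N = Q * r\<close>
  points and genus \<open>g = r * (r - 1)\<close> it equals \<open>N + 2 * g - 1\<close>, so the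
  orders of a code and its dual add up to \<open>M - 1\<close>.\<close>

definition M :: int where "M = int (wt (Q - 1, r - 1))"

lemma M_eq: "M = 4 * int r ^ 3 + 2 * int r ^ 2 - 2 * int r - 1"
proof -
  have 1: "int (Q - 1) = 4 * int r * int r - 1" using Q2 Q_eq by (simp add: of_nat_diff)
  have 2: "int (r - 1) = int r - 1" using r2 by (simp add: of_nat_diff)
  have "M = int (Q - 1) * int r + int (r - 1) * (2 * int r + 1)"
    unfolding M_def wt_def fst_conv snd_conv of_nat_add of_nat_mult by simp
  then show ?thesis unfolding 1 2 by (simp add: algebra_simps power2_eq_square power3_eq_cube)
qed

lemma tr_add: "f \<in> A \<Longrightarrow> g \<in> A \<Longrightarrow> tr (f + g) = tr f + tr g"
  by (simp add: tr_def ev_add sum.distrib)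
lemma tr_scale: "f \<in> A \<Longrightarrow> tr (emb c * f) = c * tr f"
  by (simp add: tr_def ev_scale sum_distrib_left)

lemma sum_powers_K: assumes "i < Q"
  shows "(\<Sum>a\<in>(UNIV::'k set). a ^ i) = (if i = Q - 1 then \<kappa>x else 0)"
  using sum_power_coset[of UNIV \<kappa>x i] assms prod_K_diff by (simp add: Q_def)

lemma sum_powers_fiber: assumes "j < r" shows "(\<Sum>b\<in>fiber a. b ^ j) = (if j = r - 1 then \<kappa>y else 0)"
  using sum_power_coset[of "fiber a" \<kappa>y j] assms prod_fiber_diff card_fiber by simp

lemma tr_mon: assumes "snd q < r"
  shows "tr (mon q) = (if snd q = r - 1 then \<kappa>y * (\<Sum>a\<in>(UNIV::'k set). a ^ fst q) else 0)"
proof -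
  have "tr (mon q) = (\<Sum>p\<in>S. fst p ^ fst q * snd p ^ snd q)" by (simp add: tr_def ev_mon)
  also have "\<dots> = (\<Sum>a\<in>UNIV. \<Sum>b\<in>fiber a. a ^ fst q * b ^ snd q)"
    unfolding S_def by (subst sum.Sigma) (auto simp: case_prod_unfold)
  also have "\<dots> = (\<Sum>a\<in>UNIV. a ^ fst q * (if snd q = r - 1 then \<kappa>y else 0))"
    by (simp add: sum_distrib_left[symmetric] sum_powers_fiber[OF assms])
  finally show ?thesis by (simp add: sum_distrib_left mult.commute)
qed

lemma tr_top: "tr (mon (Q - 1, r - 1)) = \<kappa>y * \<kappa>x"
  using tr_mon[of "(Q - 1, r - 1)"] sum_powers_K[of "Q - 1"] r2 Q2 by simp

text \<open>A monomial contributes only if its exponent of \<open>y\<close> is \<open>r - 1\<close>;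
  a weight below \<open>M\<close> then forces the exponent of \<open>x\<close> below
  \<open>Q - 1\<close>, where the power sum over the field vanishes.\<close>

lemma tr_L: assumes "f \<in> L (M - 1)" shows "tr f = 0"
proof -
  have "f \<in> A \<and> tr f = 0"
    using assms unfolding L_def
  proof (induction rule: V.span_induct_alt)
    case base show ?case by (simp add: tr_def A_0 ev_0)
  next
    case (step c m g)
    then obtain q where q: "m = mon q" "q \<in> red" "int (wt q) \<le> M - 1" by auto
    have "tr (mon q) = 0"
    proof (cases "snd q = r - 1")
      case True
      moreover have "wt q < wt (Q - 1, r - 1)" using q(3) by (simp add: M_def)
      ultimately have i: "fst q < Q - 1" by (simp add: wt_def)
      then have "(\<Sum>a\<in>(UNIV::'k set). a ^ fst q) = 0" using sum_powers_K[of "fst q"] by simp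
      then show ?thesis using tr_mon[of q] q by (simp add: red_def)
    next
      case False then show ?thesis using tr_mon[of q] q by (simp add: red_def)
    qed
    then show ?case using step mon_A[OF q(2)] q(1) by (simp add: tr_add tr_scale A_add A_scale)
  qed
  then show ?thesis ..
qed

lemma interpolation: obtains f where "f \<in> V.span (mon ` box Q)" "\<And>p. p \<in> S \<Longrightarrow> ev p f = \<phi> p"
proof -
  define f where "f = (\<Sum>p\<in>S. emb (\<phi> p / (\<kappa>x * \<kappa>y)) * delta (fst p) (snd p))"
  have d: "delta (fst p) (snd p) \<in> V.span (mon ` box Q)" if "p \<in> S" for p
    using that delta_box by (auto simp: S_def)
  have evd: "ev p (delta (fst p') (snd p')) = (if p' = p then \<kappa>x * \<kappa>y else 0)"
    if p: "p \<in> S" "p' \<in> S" for p p'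
  proof -
    have "ev p (delta (fst p') (snd p')) = (\<Prod>a\<in>UNIV - {fst p'}. fst p - a) * (\<Prod>b\<in>fiber (fst p') - {snd p'}. snd p - b)"
      unfolding delta_def using p(1)
      by (simp add: ev_mult ev_prod ev_diff ev_x ev_y ev_emb A_diff xA yA A_emb is_subring_prod[OF A_subring])
    also have "\<dots> = (if p' = p then \<kappa>x * \<kappa>y else 0)"
    proof (cases "fst p' = fst p")
      case False
      then have "(\<Prod>a\<in>UNIV - {fst p'}. fst p - a) = 0" by (auto intro!: prod_zero)
      then show ?thesis using False by auto
    next
      case e: True
      show ?thesis
      proof (cases "snd p' = snd p")
        case True
        then have "p' = p" using e by (simp add: prod_eq_iff)
        moreover have "snd p \<in> fiber (fst p)" using p by (auto simp: S_def)
        ultimately show ?thesis using prod_K_diff prod_fiber_diff by simp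
      next
        case False
        then have "snd p \<in> fiber (fst p') - {snd p'}" using p e by (auto simp: S_def)
        then have "(\<Prod>b\<in>fiber (fst p') - {snd p'}. snd p - b) = 0" by (intro prod_zero) auto
        then show ?thesis using False by auto
      qed
    qed
    finally show ?thesis .
  qed
  show ?thesis
  proof (rule that[of f])
    show "f \<in> V.span (mon ` box Q)" unfolding f_def by (intro V.span_sum V.span_scale d)
    fix p assume p: "p \<in> S"
    have "ev p f = (\<Sum>p'\<in>S. \<phi> p' / (\<kappa>x * \<kappa>y) * ev p (delta (fst p') (snd p')))"
      unfolding f_def using p box_A[OF d]
        by (simp add: ev_sum A_scale ev_scale del: times_divide_eq_left)
    also have "\<dots> = (\<Sum>p'\<in>S. if p' = p then \<phi> p else 0)"
      using p evd \<kappa>_nz by (intro sum.cong) auto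
    finally show "ev p f = \<phi> p" using p by simp
  qed
qed

text \<open>The code \<open>C\<^sub>m\<close>, as a space of functions on \<open>S\<close>, is stable under \<open>\<tau>\<close>.\<close>

definition pres :: "int \<Rightarrow> ('k \<times> 'k \<Rightarrow> 'k \<times> 'k) \<Rightarrow> bool" where
  "pres m \<tau> \<longleftrightarrow> (\<forall>f\<in>L m. \<exists>g\<in>L m. \<forall>p\<in>S. ev p g = ev (\<tau> p) f)"

text \<open>The permutation acts injectively on finitely many codewords, hence surjectively. The
  duality argument and the equality of codes both need these preimages.\<close>

lemma pres_surj:
  assumes "pres m \<tau>" "bij_betw \<tau> S S" "g \<in> L m" obtains f
    where "f \<in> L m" "\<And>p. p \<in> S \<Longrightarrow> ev p g = ev (\<tau> p) f"
proof -
  \<comment> \<open>Cutting off outside \<open>S\<close> makes codewords functions on a finite type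
    and determines them by their values on \<open>S\<close>.\<close>
  define \<Phi> where "\<Phi> f = (\<lambda>p. if p \<in> S then ev p f else 0)" for f
  define T where "T c = (\<lambda>p. if p \<in> S then c (\<tau> p) else 0)" for c :: "'k \<times> 'k \<Rightarrow> 'k"
  have \<tau>S: "\<tau> p \<in> S" if "p \<in> S" for p using assms(2) that by (auto simp: bij_betw_def)
  have "T ` \<Phi> ` L m \<subseteq> \<Phi> ` L m"
  proof clarify
    fix f assume "f \<in> L m"
    then obtain g where "g \<in> L m" "\<forall>p\<in>S. ev p g = ev (\<tau> p) f" using assms(1)
      by (auto simp: pres_def)
    then have "T (\<Phi> f) = \<Phi> g" using \<tau>S by (auto simp: T_def \<Phi>_def)
    then show "T (\<Phi> f) \<in> \<Phi> ` L m" using \<open>g \<in> L m\<close> by auto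
  qed
  moreover have "inj_on T (\<Phi> ` L m)"
  proof (rule inj_onI, clarify)
    fix f f' assume e: "T (\<Phi> f) = T (\<Phi> f')"
    have "\<Phi> f s = \<Phi> f' s" for s
    proof (cases "s \<in> S")
      case True
      then obtain p where "p \<in> S" "s = \<tau> p" using assms(2) by (metis bij_betw_imp_surj_on imageE)
      then show ?thesis using fun_cong[OF e, of p] by (simp add: T_def)
    qed (simp add: \<Phi>_def)
    then show "\<Phi> f = \<Phi> f'" by blast
  qed
  ultimately have "T ` \<Phi> ` L m = \<Phi> ` L m" by (intro endo_inj_surj) auto
  then obtain f where "f \<in> L m" "\<Phi> g = T (\<Phi> f)" using assms(3) by blast
  then show ?thesis using that[of f] \<tau>S by (metis (no_types, lifting) T_def \<Phi>_def)
qed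

text \<open>If the interpolant \<open>g\<close> of \<open>f\<close> composed with
  \<open>\<tau>\<close> had order above \<open>m'\<close>, its leading monomial would pair
  non-trivially with the complementary monomial of the box, which lies in \<open>L m\<close>. But
  the pairing is unchanged by permuting the points, and \<open>L m\<close> is orthogonal to
  \<open>L m'\<close>.\<close>

lemma pres_dual:
  assumes pr: "pres m \<tau>" and bij: "bij_betw \<tau> S S" and m: "m + m' = M - 1"
  shows "pres m' \<tau>"
  unfolding pres_def
proof
  fix f assume f: "f \<in> L m'"
  obtain g where g: "g \<in> V.span (mon ` box Q)" "\<And>p. p \<in> S \<Longrightarrow> ev p g = ev (\<tau> p) f"
    using interpolation[of "\<lambda>p. ev (\<tau> p) f"] by blast
  have gA: "g \<in> A" using g box_A by blast
  have "g \<in> L m'"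
  proof (rule ccontr)
    assume ng: "g \<notin> L m'"
    then have g0: "g \<noteq> 0" using L_0 by auto
    obtain q c where q: "q \<in> box Q" "c \<noteq> 0" "g - emb c * mon q \<in> V.span (mon ` {p' \<in> box Q. wt p' < wt q})"
      by (rule lead_term[OF g(1) box_red g0])
    have wq: "int (wt q) > m'"
      using ng lead_val[OF q(2,3)] gA by (auto simp: L_iff)
    \<comment> \<open>Chosen so that the product of the two monomials is the top one; its weight
      \<open>M - wt q\<close> is at most \<open>m\<close> because \<open>wt q > m'\<close>.\<close>
    define q' where "q' = (Q - 1 - fst q, r - 1 - snd q)"
    have sm: "fst q' + fst q = Q - 1" "snd q' + snd q = r - 1" using q(1)
      by (auto simp: q'_def box_def)
    have "wt q' + wt q = wt (Q - 1, r - 1)"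
      unfolding wt_def fst_conv snd_conv sm[symmetric] by (simp add: algebra_simps)
    then have wq': "int (wt q') = M - int (wt q)" by (simp add: M_def)
    have q'r: "q' \<in> red" using r2 by (simp add: q'_def red_def)
    have mm: "mon q' * mon q = mon (Q - 1, r - 1)"
      unfolding mon_def fst_conv snd_conv sm[symmetric] by (simp add: power_add mult_ac)
    define u where "u = mon q'"
    have uL: "u \<in> L (M - int (wt q))" unfolding u_def using q'r wq' by (intro mon_L) auto
    then have um: "u \<in> L m" using wq m by (intro L_mono[of "M - int (wt q)" m]) auto
    have uA: "u \<in> A" using um L_A by blast
    obtain u' where u': "u' \<in> L m" "\<And>p. p \<in> S \<Longrightarrow> ev p u = ev (\<tau> p) u'"
      using pres_surj[OF pr bij um] by blast
    have fA: "f \<in> A" and u'A: "u' \<in> A" using f u' L_A by auto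
    have "tr (u * g) = (\<Sum>p\<in>S. ev (\<tau> p) u' * ev (\<tau> p) f)"
      unfolding tr_def using u' g uA gA by (simp add: ev_mult)
    also have "\<dots> = (\<Sum>p\<in>S. ev p u' * ev p f)"
      by (rule sum.reindex_bij_betw[OF bij, of "\<lambda>p. ev p u' * ev p f"])
    also have "\<dots> = tr (u' * f)" unfolding tr_def using u'A fA by (simp add: ev_mult)
    also have "\<dots> = 0" using L_mult[OF u'(1) f] m by (intro tr_L) simp
    finally have 1: "tr (u * g) = 0" .
    define g1 where "g1 = g - emb c * mon q"
    have "mon ` {p' \<in> box Q. wt p' < wt q} \<subseteq> mon ` {p \<in> red. int (wt p) \<le> int (wt q) - 1}"
      using box_red by auto
    then have g1L: "g1 \<in> L (int (wt q) - 1)" unfolding g1_def L_def using q(3) V.span_mono by blast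
    have ug1: "u * g1 \<in> L (M - 1)" using L_mult[OF uL g1L] by simp
    have "u * g = emb c * (mon q' * mon q) + u * g1" by (simp add: g1_def u_def algebra_simps)
    then have "u * g = emb c * mon (Q - 1, r - 1) + u * g1" unfolding mm .
    moreover have topA: "mon (Q - 1, r - 1) \<in> A" using r2 by (intro mon_A) (simp add: red_def)
    ultimately have "tr (u * g) = c * (\<kappa>y * \<kappa>x)"
      using tr_L[OF ug1] L_A[OF ug1] tr_top by (simp add: tr_add tr_scale A_scale)
    then show False using 1 q(2) \<kappa>_nz by simp
  qed
  then show "\<exists>g\<in>L m'. \<forall>p\<in>S. ev p g = ev (\<tau> p) f" using g by blast
qed

subsection \<open>Permutations preserving the code\<close>

lemma span_combination:
  assumes "f \<in> V.span (mon ` set qs)" shows "\<exists>c. f = (\<Sum>q\<in>set qs. emb (c q) * mon q)"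
  using assms
proof (induction rule: V.span_induct_alt)
  case base show ?case by (intro exI[of _ "\<lambda>_. 0"]) simp
next
  case (step c m g)
  then obtain d q where d: "g = (\<Sum>q\<in>set qs. emb (d q) * mon q)" "m = mon q" "q \<in> set qs" by auto
  have "(\<Sum>s\<in>set qs. emb ((d(q := d q + c)) s) * mon s) = (\<Sum>s\<in>set qs. emb (d s) * mon s + (if s = q then emb c * mon q else 0))"
    by (intro sum.cong) (auto simp: emb_add algebra_simps)
  also have "\<dots> = emb c * m + g" using d by (simp add: sum.distrib)
  finally show ?case by metis
qed

lemma L_const: assumes "f \<in> L m" "m < int r" shows "\<exists>c. f = emb c"
proof -
  have "p \<in> set [(0,0)]" if "p \<in> red" "int (wt p) \<le> m" for p
  proof -
    have "wt p < r" using that assms by simp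
    then have "fst p * r + snd p * r < 1 * r" by (simp add: wt_def algebra_simps)
    then have "(fst p + snd p) * r < 1 * r" by (simp add: algebra_simps)
    then have "fst p + snd p < 1" by (simp only: mult_less_cancel2)
    then show ?thesis by (cases p) auto
  qed
  then have "f \<in> V.span (mon ` set [(0,0)])" using L_eq_span[of m "set [(0,0)]"] assms by blast
  then obtain c where "f = (\<Sum>q\<in>set [(0,0)]. emb (c q) * mon q)" using span_combination by blast
  then have "f = emb (c (0,0))" by (simp add: mon_def)
  then show ?thesis by blast
qed

lemma L_linear: assumes "f \<in> L m" "m < 2 * int r" shows "\<exists>c d. f = emb c * x + emb d"
proof -
  have "p \<in> set [(0,0), (1,0)]" if "p \<in> red" "int (wt p) \<le> m" for p
  proof -
    have "wt p < 2 * r" using that assms by simp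
    then have "fst p * r + snd p * (2 * r) < 2 * r" by (simp add: wt_def algebra_simps)
    then have "(fst p + 2 * snd p) * r < 2 * r" by (simp add: algebra_simps)
    then have "fst p + 2 * snd p < 2" by (simp only: mult_less_cancel2)
    then show ?thesis by (cases p) auto
  qed
  then have "f \<in> V.span (mon ` set [(0,0), (1,0)])" using L_eq_span[of m "set [(0,0), (1,0)]"] assms
    by blast
  then obtain c where "f = (\<Sum>q\<in>set [(0,0), (1,0)]. emb (c q) * mon q)" using span_combination
    by blast
  then have "f = emb (c (1,0)) * x + emb (c (0,0))" by (simp add: mon_def)
  then show ?thesis by blast
qed

lemma L_quadratic: assumes "f \<in> L m" "m \<le> 2 * int r"
  shows "\<exists>c d e. f = emb c + emb d * x + emb e * x ^ 2"
proof -
  have "p \<in> set [(0,0), (1,0), (2,0)]" if "p \<in> red" "int (wt p) \<le> m" for p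
  proof -
    have w: "wt p \<le> 2 * r" using that assms by simp
    then have "snd p * (2 * r + 1) < 1 * (2 * r + 1)" by (simp add: wt_def)
    then have s: "snd p = 0" by (simp only: mult_less_cancel2 less_one)
    then have "fst p * r \<le> 2 * r" using w by (simp add: wt_def)
    then have "fst p \<le> 2" using r2 by simp
    then show ?thesis using s by (cases p) auto
  qed
  then have "f \<in> V.span (mon ` set [(0,0), (1,0), (2,0)])"
    using L_eq_span[of m "set [(0,0), (1,0), (2,0)]"] assms by blast
  then obtain c where "f = (\<Sum>q\<in>set [(0,0), (1,0), (2,0)]. emb (c q) * mon q)"
    using span_combination by blast
  then have "f = emb (c (0,0)) + emb (c (1,0)) * x + emb (c (2,0)) * x ^ 2" by (simp add: mon_def)
  then show ?thesis by blast
qed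

lemma L_y_form: assumes "f \<in> L m" "m \<le> 2 * int r + 1"
  shows "\<exists>c0 c1 c2 c3. f = emb c0 + emb c1 * x + emb c2 * x ^ 2 + emb c3 * y"
proof -
  have "p \<in> set [(0,0), (1,0), (2,0), (0,1)]" if "p \<in> red" "int (wt p) \<le> m" for p
  proof -
    have w: "wt p \<le> 2 * r + 1" using that assms by simp
    then have "snd p * (2 * r + 1) \<le> 1 * (2 * r + 1)" by (simp add: wt_def)
    then have "snd p \<le> 1" by (simp only: mult_le_cancel2)
    then consider "snd p = 0" | "snd p = 1" by linarith
    then show ?thesis
    proof cases
      case 1
      then have "fst p * r \<le> 2 * r + 1" using w by (simp add: wt_def)
      also have "\<dots> < 3 * r" using r2 by simp
      finally have "fst p < 3" by (simp only: mult_less_cancel2)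
      then have "fst p = 0 \<or> fst p = 1 \<or> fst p = 2" by linarith
      then show ?thesis using 1 by (cases p) auto
    next
      case 2
      then have "fst p * r \<le> 0" using w by (simp add: wt_def)
      then show ?thesis using 2 r2 by (cases p) auto
    qed
  qed
  then have "f \<in> V.span (mon ` set [(0,0), (1,0), (2,0), (0,1)])"
    using L_eq_span[of m "set [(0,0), (1,0), (2,0), (0,1)]"] assms by blast
  then obtain c where "f = (\<Sum>q\<in>set [(0,0), (1,0), (2,0), (0,1)]. emb (c q) * mon q)"
    using span_combination by blast
  then have "f = emb (c (0,0)) + emb (c (1,0)) * x + emb (c (2,0)) * x ^ 2 + emb (c (0,1)) * y"
    by (simp add: mon_def)
  then show ?thesis by blast
qed

text \<open>
  As \<open>2m < N\<close>, the map that \<open>\<tau>\<close> induces on \<open>L m\<close> is multiplicative where defined. So high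
  powers of the image of \<open>x\<close> (or \<open>y\<close>) stay in \<open>L m\<close>, which bounds the pole order of that image.
\<close>

lemma pres_power:
  assumes pr: "pres m \<tau>" "bij_betw \<tau> S S" and m: "0 \<le> m" "2 * m < int (Q * r)"
    and u: "u \<in> A" "\<And>j. j \<le> k \<Longrightarrow> u ^ j \<in> L m" and u': "u' \<in> L m" "\<And>p. p \<in> S \<Longrightarrow> ev p u' = ev (\<tau> p) u"
  shows "u' ^ k \<in> L m"
  using u(2)
proof (induction k)
  case 0 then show ?case by simp
next
  case (Suc k)
  have \<tau>S: "\<tau> p \<in> S" if "p \<in> S" for p using pr(2) that by (auto simp: bij_betw_def)
  have IH: "u' ^ k \<in> L m" using Suc by simp
  obtain F where F: "F \<in> L m" "\<And>p. p \<in> S \<Longrightarrow> ev p F = ev (\<tau> p) (u ^ Suc k)"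
    using pr(1) Suc.prems[of "Suc k"] unfolding pres_def by blast
  have A: "u' \<in> A" "F \<in> A" using u' F L_A by auto
  have "F - u' * u' ^ k = 0"
  proof (rule ev_zero_imp_zero)
    show "F - u' * u' ^ k \<in> L (2 * m)"
      using L_mult[OF u'(1) IH] L_mono[OF _ F(1), of "2 * m"] m by (intro L_diff) auto
    fix p assume p: "p \<in> S"
    then show "ev p (F - u' * u' ^ k) = 0"
      using A F(2)[OF p] u'(2)[OF p] u(1) \<tau>S[OF p]
      by (simp add: ev_diff ev_mult ev_power A_closed)
  qed (use m in simp)
  then show ?case using F by simp
qed

lemma fst_S: "fst ` S = UNIV"
proof -
  have "fiber a \<noteq> {}" for a using card_fiber[of a] r2 by auto
  then show ?thesis by (force simp: S_def)
qed

text \<open>With \<open>k = m div w\<close> one has \<open>m < (k + 1) * w \<le> 2 * k * w\<close>,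
  so an order of at most \<open>m / k\<close> is below \<open>2 * w\<close>. The bound is crude, but
  for \<open>w = r\<close> it already leaves only linear polynomials in \<open>x\<close>.\<close>

lemma degree_bound:
  assumes "0 < w" "w \<le> m" "u' ^ (m div w) \<in> L (int m)" "u' \<in> A"
  shows "u' \<in> L (2 * int w - 1)"
proof (cases "u' = 0")
  case False
  define k where "k = m div w"
  have k1: "k \<ge> 1" using assms(1,2) unfolding k_def
    by (metis div_greater_zero_iff less_eq_Suc_le One_nat_def)
  have mk: "m < (k + 1) * w" using assms(1) unfolding k_def
    by (metis Suc_eq_plus1 dividend_less_div_times mult.commute mult_Suc_right add.commute)
  have "int k * vinf u' \<ge> - int m" using assms(3) False I.val_power[OF False]
    by (auto simp: L_iff k_def)
  then have 1: "int k * (- vinf u') < int k * int w + int w" using mk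
    by (simp add: algebra_simps flip: of_nat_mult of_nat_add)
  have "- vinf u' < 2 * int w"
  proof (rule ccontr)
    assume "\<not> - vinf u' < 2 * int w"
    then have "int k * (2 * int w) \<le> int k * (- vinf u')" by (intro mult_left_mono) auto
    then have "int k * int w < int w" using 1 by (simp add: algebra_simps)
    then show False using k1 assms(1) by simp
  qed
  then show ?thesis using assms(4) by (simp add: L_iff)
qed (simp add: L_0)

lemma pres_x:
  assumes pr: "pres (int m) \<tau>" "bij_betw \<tau> S S" and m: "r \<le> m" "2 * m < Q * r"
  obtains \<alpha> \<beta> where "\<alpha> \<noteq> 0" "\<And>p. p \<in> S \<Longrightarrow> fst (\<tau> p) = \<alpha> * fst p + \<beta>"
proof -
  have \<tau>S: "\<tau> p \<in> S" if "p \<in> S" for p using pr(2) that by (auto simp: bij_betw_def)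
  have "x \<in> L (int m)" using m by (intro x_L) simp
  then obtain f where f: "f \<in> L (int m)" "\<And>p. p \<in> S \<Longrightarrow> ev p f = ev (\<tau> p) x" using pr(1)
    by (auto simp: pres_def)
  have "f ^ (m div r) \<in> L (int m)"
  proof (rule pres_power[OF pr _ _ xA _ f])
    fix j assume "j \<le> m div r"
    then have "j * r \<le> m" by (meson div_times_less_eq_dividend le_trans mult_le_mono1)
    then have "int j * int r \<le> int m" by (metis of_nat_le_iff of_nat_mult)
    then show "x ^ j \<in> L (int m)"
      using L_power[OF x_L[of "int r"], of j] L_mono[of "int j * int r" "int m"] by simp
  qed (use m in \<open>auto simp flip: of_nat_mult\<close>)
  then have "f \<in> L (2 * int r - 1)" using degree_bound[of r m f] m r2 L_A[OF f(1)] by simp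
  then obtain \<alpha> \<beta> where ab: "f = emb \<alpha> * x + emb \<beta>" using L_linear[of f "2 * int r - 1"] by auto
  have *: "fst (\<tau> p) = \<alpha> * fst p + \<beta>" if "p \<in> S" for p
    using f(2)[OF that] that \<tau>S unfolding ab
      by (simp add: ev_add ev_scale ev_x ev_emb xA A_scale A_emb)
  \<comment> \<open>Otherwise all points would share one first coordinate, as \<open>\<tau>\<close>
    is onto.\<close>
  moreover have "\<alpha> \<noteq> 0"
  proof
    assume "\<alpha> = 0"
    then have "fst (\<tau> p) = \<beta>" if "p \<in> S" for p using *[OF that] by simp
    then have "fst s = \<beta>" if "s \<in> S" for s using that pr(2) by (metis bij_betw_imp_surj_on imageE)
    then have "UNIV \<subseteq> {\<beta>}" using fst_S by blast
    then have "(0::'k) = \<beta>" "(1::'k) = \<beta>" by blast+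
    then show False by simp
  qed
  ultimately show ?thesis using that by blast
qed

lemma vinf_h: assumes "z \<noteq> 0" "vinf z < 0" shows "vinf (h_poly n z) = int r * vinf z"
proof -
  have "z \<notin> Rinf" using assms I.val_R by auto
  then have e: "h_poly n z * inverse z ^ r - 1 \<in> max_ideal Rinf" using h_lead_inverse[OF Rinf(1)]
    by blast
  define w where "w = h_poly n z * inverse z ^ r"
  have u: "unit_of Rinf w" using eq1_unit[OF Rinf] e by (simp add: w_def)
  have "h_poly n z = w * z ^ r" using assms(1) by (simp add: w_def power_inverse)
  moreover have "w \<noteq> 0" using u by (simp add: unit_of_def)
  ultimately show ?thesis using assms(1) I.val_unit[OF u] by (simp add: I.val_mult I.val_power)
qed

text \<open>\<open>degree_bound\<close> gives only order \<open>4 * r + 1\<close>, too large for the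
  wanted shape. It suffices, however, to lift the curve equation for the images from the points to
  an identity of functions, and comparing pole orders in that identity gives
  \<open>2 * r + 1\<close>.\<close>

lemma pres_y:
  assumes pr: "pres (int m) \<tau>" "bij_betw \<tau> S S" and m: "2 * r + 1 \<le> m" "2 * m < Q * r"
    and \<alpha>: "\<alpha> \<noteq> 0" "\<And>p. p \<in> S \<Longrightarrow> fst (\<tau> p) = \<alpha> * fst p + \<beta>"
  obtains c0 c1 c2 c3 where "c3 \<noteq> 0"
    "h_poly n (emb c0 + emb c1 * x + emb c2 * x ^ 2 + emb c3 * y) = (emb \<alpha> * x + emb \<beta>) ^ (2 * r + 1)"
    "\<And>p. p \<in> S \<Longrightarrow> snd (\<tau> p) = c0 + c1 * fst p + c2 * fst p ^ 2 + c3 * snd p"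
proof -
  have \<tau>S: "\<tau> p \<in> S" if "p \<in> S" for p using pr(2) that by (auto simp: bij_betw_def)
  have yL: "y \<in> L (2 * int r + 1)" by (intro y_L) simp
  have "y \<in> L (int m)" using m by (intro y_L) simp
  then obtain g where g: "g \<in> L (int m)" "\<And>p. p \<in> S \<Longrightarrow> ev p g = ev (\<tau> p) y" using pr(1)
    by (auto simp: pres_def)
  have gA: "g \<in> A" using g L_A by blast
  have "g ^ (m div (2 * r + 1)) \<in> L (int m)"
  proof (rule pres_power[OF pr _ _ yA _ g])
    fix j assume "j \<le> m div (2 * r + 1)"
    then have "j * (2 * r + 1) \<le> m" by (meson div_times_less_eq_dividend le_trans mult_le_mono1)
    then have "int (j * (2 * r + 1)) \<le> int m" by (simp only: of_nat_le_iff)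
    then have "int j * (2 * int r + 1) \<le> int m" by (simp add: algebra_simps)
    then show "y ^ j \<in> L (int m)"
      using L_power[OF yL, of j] L_mono[of "int j * (2 * int r + 1)" "int m"] by simp
  qed (use m in \<open>auto simp flip: of_nat_mult\<close>)
  then have gL: "g \<in> L (4 * int r + 1)" using degree_bound[of "2 * r + 1" m g] m gA
    by (simp add: algebra_simps)
  define f where "f = emb \<alpha> * x + emb \<beta>"
  have fA: "f \<in> A" by (simp add: f_def A_add A_scale A_emb xA)
  have fL: "f \<in> L (int r)" unfolding f_def by (intro L_add L_scale x_L emb_L) auto
  have evf: "ev p f = fst (\<tau> p)" if "p \<in> S" for p
    using \<alpha>(2)[OF that] that by (simp add: f_def ev_add ev_scale ev_x ev_emb xA A_scale A_emb)
  have hg: "h_poly n g = f ^ (2 * r + 1)"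
  proof -
    have "h_poly n g - f ^ (2 * r + 1) = 0"
    proof (rule ev_zero_imp_zero)
      \<comment> \<open>\<open>h\<close> multiplies the bound on the order of \<open>g\<close> by
        \<open>r\<close>; as \<open>r \<ge> 2\<close>, the result stays below the number
        \<open>4 * r ^ 3\<close> of points.\<close>
      let ?d = "int r * (4 * int r + 1)"
      have "h_poly n g \<in> L ?d" unfolding h_poly_def L_def
      proof (rule V.span_sum, fold L_def)
        fix i assume "i \<in> {..<n}"
        then have "i \<le> n - 1" by simp
        then have "(2::nat) ^ i \<le> r" unfolding r_eq by (intro power_increasing) auto
        then have "int (2 ^ i) * (4 * int r + 1) \<le> ?d"
          by (intro mult_right_mono) (simp_all add: of_nat_le_iff del: of_nat_power)
        then show "g ^ 2 ^ i \<in> L ?d" using L_mono[OF _ L_power[OF gL, of "2 ^ i"]] by blast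
      qed
      moreover have "f ^ (2 * r + 1) \<in> L ?d"
        using L_mono[OF _ L_power[OF fL, of "2 * r + 1"], of ?d] by (simp add: algebra_simps)
      ultimately show "h_poly n g - f ^ (2 * r + 1) \<in> L ?d" by (rule L_diff)
      define s where "s = r * r"
      have "s * 2 \<le> s * r" using r2 by (intro mult_left_mono) auto
      moreover have "r \<le> s" "0 < s" using r2 by (auto simp: s_def)
      moreover have "r * (4 * r + 1) = 4 * s + r" "Q * r = 4 * (s * r)"
        by (auto simp: s_def Q_eq algebra_simps)
      ultimately have "r * (4 * r + 1) < Q * r" by linarith
      then have "int (r * (4 * r + 1)) < int (Q * r)" by (simp only: of_nat_less_iff)
      then show "?d < int (Q * r)" by (simp only: of_nat_mult of_nat_add of_nat_numeral of_nat_1)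
      fix p assume p: "p \<in> S"
      have "h_poly n (snd (\<tau> p)) = fst (\<tau> p) ^ (2 * r + 1)" using \<tau>S[OF p]
        by (auto simp: S_def fiber_def)
      moreover have "ev p (h_poly n g - f ^ (2 * r + 1)) = h_poly n (ev p g) - ev p f ^ (2 * r + 1)"
        using p gA fA by (simp only: ev_diff ev_h ev_power A_closed h_subring[OF A_subring])
      ultimately show "ev p (h_poly n g - f ^ (2 * r + 1)) = 0"
        using g(2)[OF p] evf[OF p] \<tau>S[OF p] by (simp add: ev_y)
    qed
    then show ?thesis by simp
  qed
  have f0: "f \<noteq> 0"
  proof
    assume "f = 0"
    then have "emb \<alpha> * x = emb (- \<beta>)" by (simp add: f_def emb_uminus eq_neg_iff_add_eq_0)
    then have "emb (inverse \<alpha>) * (emb \<alpha> * x) = emb (inverse \<alpha> * (- \<beta>))" by (simp only: emb_mult)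
    moreover have "emb (inverse \<alpha>) * (emb \<alpha> * x) = x" using \<alpha>(1) by (simp add: emb_inverse)
    ultimately have "x = emb (inverse \<alpha> * (- \<beta>))" by simp
    then show False using x_emb by blast
  qed
  have gL2: "g \<in> L (2 * int r + 1)"
  proof (cases "g = 0 \<or> vinf g \<ge> 0")
    case True then show ?thesis using gA by (auto simp: L_iff)
  next
    case False
    then have "int r * vinf g = vinf (f ^ (2 * r + 1))" using vinf_h[of g] hg by simp
    also have "\<dots> = int (2 * r + 1) * vinf f" using f0 by (rule I.val_power)
    finally have "int r * vinf g = int (2 * r + 1) * vinf f" .
    moreover have "vinf f \<ge> - int r" using fL f0 by (auto simp: L_iff)
    then have "int (2 * r + 1) * vinf f \<ge> int (2 * r + 1) * (- int r)"
      by (intro mult_left_mono) auto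
    ultimately have "int r * vinf g \<ge> int r * (- int (2 * r + 1))" by (simp add: algebra_simps)
    then have "vinf g \<ge> - int (2 * r + 1)" using r2 by (simp add: mult_le_cancel_left_pos)
    then show ?thesis using gA by (simp add: L_iff)
  qed
  obtain c0 c1 c2 c3 where c: "g = emb c0 + emb c1 * x + emb c2 * x ^ 2 + emb c3 * y"
    using L_y_form[OF gL2] by auto
  have snd\<tau>: "snd (\<tau> p) = c0 + c1 * fst p + c2 * fst p ^ 2 + c3 * snd p" if "p \<in> S" for p
    using g(2)[OF that] that \<tau>S[OF that] unfolding c
    by (simp add: ev_add ev_scale ev_x ev_y ev_power ev_emb xA yA A_add A_scale A_emb A_closed)
  \<comment> \<open>Otherwise the image of a point would depend on its first coordinate only, and
    \<open>\<tau>\<close> would identify two points of a fibre.\<close>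
  have "c3 \<noteq> 0"
  proof
    assume c3: "c3 = 0"
    have "\<not> fiber 0 \<subseteq> {b}" for b
    proof
      assume "fiber 0 \<subseteq> {b}"
      then have "card (fiber 0) \<le> card {b}" by (intro card_mono) auto
      then show False using card_fiber[of 0] r2 by simp
    qed
    then obtain b b' where b: "b \<in> fiber 0" "b' \<in> fiber 0" "b \<noteq> b'"
      by (metis subset_singleton_iff subsetI singletonI empty_subsetI all_not_in_conv singletonD)
    then have s: "(0, b) \<in> S" "(0, b') \<in> S" by (auto simp: S_def)
    then have "\<tau> (0, b) = \<tau> (0, b')" using \<alpha>(2) snd\<tau> c3 by (simp add: prod_eq_iff)
    then show False using s b(3) pr(2) by (auto simp: bij_betw_def inj_on_def)
  qed
  then show ?thesis using that[of c3 c0 c1 c2] hg snd\<tau> unfolding c f_def by blast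
qed

subsection \<open>Automorphisms of the function field\<close>

text \<open>At a pole the leading term of a polynomial dominates the others, so its value is not
  zero. This is how new coordinates are seen to be transcendental.\<close>

lemma transcendental_pole:
  assumes "valuation_ring emb R" "z \<notin> R" shows "transcendental_over emb z"
  unfolding transcendental_over_def
proof (intro allI impI)
  interpret val_ring emb R using assms by unfold_locales
  have z0: "z \<noteq> 0" using assms R_closed by auto
  have iz: "inverse z \<in> P" using assms by (simp add: P_iff)
  fix p :: "'k poly" assume p: "p \<noteq> 0"
  define d where "d = degree p"
  have dm: "degree (map_poly emb p) \<le> d"
    by (rule degree_le) (auto simp: coeff_map_poly d_def coeff_eq_0)
  have lc: "unit_of R (emb (coeff p d))"
    using p emb_in by (simp add: unit_of_def d_def flip: emb_inverse)
  have "poly (map_poly emb p) z * inverse z ^ d = (\<Sum>i\<le>d. emb (coeff p i) * z ^ i * inverse z ^ d)"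
    by (simp add: poly_altdef_le[OF dm] coeff_map_poly sum_distrib_right)
  also have "\<dots> = (\<Sum>i\<le>d. emb (coeff p i) * inverse z ^ (d - i))"
  proof (rule sum.cong)
    fix i assume "i \<in> {..d}"
    then have "inverse z ^ d = inverse z ^ i * inverse z ^ (d - i)" by (simp flip: power_add)
    then show "emb (coeff p i) * z ^ i * inverse z ^ d = emb (coeff p i) * inverse z ^ (d - i)"
      using z0 by (simp add: power_inverse)
  qed simp
  also have "\<dots> = emb (coeff p d) + (\<Sum>i<d. emb (coeff p i) * inverse z ^ (d - i))"
    by (simp add: lessThan_Suc_atMost[symmetric])
  finally have e: "poly (map_poly emb p) z * inverse z ^ d = emb (coeff p d) + (\<Sum>i<d. emb (coeff p i) * inverse z ^ (d - i))" .
  have "(\<Sum>i<d. emb (coeff p i) * inverse z ^ (d - i)) \<in> P"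
    using iz by (intro P_sum P_mult2[OF emb_in] P_power) auto
  then have "unit_of R (poly (map_poly emb p) z * inverse z ^ d)" unfolding e using lc unit_add_P
    by blast
  then show "poly (map_poly emb p) z \<noteq> 0" by (auto simp: unit_of_def)
qed

text \<open>The substitution is invertible, so the new pair generates the same field; everything
  proved for \<open>x\<close> and \<open>y\<close> becomes available for it.\<close>

lemma coord_change:
  assumes \<alpha>: "\<alpha> \<noteq> 0" and c3: "c3 \<noteq> 0"
    and f: "f = emb \<alpha> * x + emb \<beta>" and g: "g = emb c0 + emb c1 * x + emb c2 * x ^ 2 + emb c3 * y"
    and h: "h_poly n g = f ^ (2 * r + 1)"
  shows "Y2_curve n r emb f g"
proof
  have xf: "x = emb (inverse \<alpha>) * (f - emb \<beta>)" using \<alpha> f by (simp add: emb_inverse)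
  have yg: "y = emb (inverse c3) * (g - (emb c0 + emb c1 * x + emb c2 * x ^ 2))" using c3 g
    by (simp add: emb_inverse)
  have "f \<notin> Rinf"
  proof
    assume "f \<in> Rinf"
    then have "x \<in> Rinf" by (subst xf) (simp add: I.R_closed I.emb_in)
    then show False using Rinf by blast
  qed
  then have tf: "transcendental_over emb f" using transcendental_pole Rinf by blast
  have "B = UNIV" if B: "is_subfield B" "range emb \<union> {f, g} \<subseteq> B" for B
  proof -
    note cl = is_subring_closed[of B]
    have sB: "is_subring B" using B by (simp add: is_subfield_def)
    have eB: "emb c \<in> B" for c using B by auto
    have xB: "x \<in> B" using B eB by (subst xf) (simp add: cl[OF sB])
    have yB: "y \<in> B" using B eB xB by (subst yg) (simp add: cl[OF sB])
    show ?thesis using B xB yB by (intro subfield_UNIV) auto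
  qed
  then have "field_adjoin emb {f, g} = UNIV" by (auto simp: field_adjoin_def)
  then show "Y2_function_field n emb f g"
    unfolding Y2_function_field_def two_r using emb tf h by simp
qed (use n2 r_eq card_K fib in auto)

definition faut :: "('f \<Rightarrow> 'f) \<Rightarrow> bool" where "faut \<sigma> \<longleftrightarrow> \<sigma> \<in> carrier (field_aut emb)"

lemma faut_iff: "faut \<sigma> \<longleftrightarrow> bij \<sigma> \<and> (\<forall>a b. \<sigma> (a + b) = \<sigma> a + \<sigma> b) \<and> (\<forall>a b. \<sigma> (a * b) = \<sigma> a * \<sigma> b)
    \<and> (\<forall>c. \<sigma> (emb c) = emb c)"
  by (simp add: faut_def field_aut_def)

context
  fixes \<sigma> assumes \<sigma>: "faut \<sigma>"
begin

lemma \<sigma>_bij: "bij \<sigma>" and \<sigma>_add: "\<sigma> (a + b) = \<sigma> a + \<sigma> b" and \<sigma>_mult: "\<sigma> (a * b) = \<sigma> a * \<sigma> b"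
  and \<sigma>_emb: "\<sigma> (emb c) = emb c"
  using \<sigma> by (auto simp: faut_iff)
lemma \<sigma>_0: "\<sigma> 0 = 0" and \<sigma>_1: "\<sigma> 1 = 1" using \<sigma>_emb[of 0] \<sigma>_emb[of 1] by auto
lemma \<sigma>_eq: "\<sigma> a = \<sigma> b \<longleftrightarrow> a = b" using \<sigma>_bij by (auto simp: bij_def inj_def)
lemma \<sigma>_eq0: "\<sigma> a = 0 \<longleftrightarrow> a = 0" using \<sigma>_eq[of a 0] \<sigma>_0 by simp
lemma \<sigma>_diff: "\<sigma> (a - b) = \<sigma> a - \<sigma> b" using \<sigma>_add[of "a - b" b] by simp
lemma \<sigma>_power: "\<sigma> (a ^ k) = \<sigma> a ^ k" by (induction k) (auto simp: \<sigma>_1 \<sigma>_mult)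
lemma \<sigma>_inverse: "\<sigma> (inverse a) = inverse (\<sigma> a)"
proof (cases "a = 0")
  case False
  then have "\<sigma> a * \<sigma> (inverse a) = 1" by (simp add: \<sigma>_mult[symmetric] \<sigma>_1)
  then show ?thesis by (metis inverse_unique)
qed (simp add: \<sigma>_0)
lemma \<sigma>_divide: "\<sigma> (a / b) = \<sigma> a / \<sigma> b" by (simp add: divide_inverse \<sigma>_mult \<sigma>_inverse)
lemma \<sigma>_powi: "\<sigma> (a powi k) = \<sigma> a powi k" by (simp add: power_int_def \<sigma>_power \<sigma>_inverse)
lemma \<sigma>_sum: "\<sigma> (sum f J) = (\<Sum>i\<in>J. \<sigma> (f i))"
  by (induction J rule: infinite_finite_induct) (auto simp: \<sigma>_0 \<sigma>_add)
lemma \<sigma>_h: "\<sigma> (h_poly n z) = h_poly n (\<sigma> z)" by (simp add: h_poly_def \<sigma>_sum \<sigma>_power)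

lemma \<sigma>_mem: "\<sigma> z \<in> \<sigma> ` R \<longleftrightarrow> z \<in> R" using \<sigma>_eq by auto

lemma \<sigma>_valuation_ring: assumes "valuation_ring emb R" shows "valuation_ring emb (\<sigma> ` R)"
proof -
  interpret val_ring emb R using assms by unfold_locales
  have "is_subring (\<sigma> ` R)"
    unfolding is_subring_def
  proof (intro conjI ballI)
    show "0 \<in> \<sigma> ` R" using R_closed \<sigma>_0 by (metis image_eqI)
    show "1 \<in> \<sigma> ` R" using R_closed \<sigma>_1 by (metis image_eqI)
    fix a b assume "a \<in> \<sigma> ` R" "b \<in> \<sigma> ` R"
    then show "a - b \<in> \<sigma> ` R" "a * b \<in> \<sigma> ` R"
      by (auto simp: \<sigma>_diff[symmetric] \<sigma>_mult[symmetric] R_closed \<sigma>_mem)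
  qed
  moreover have "range emb \<subset> \<sigma> ` R"
  proof
    show "range emb \<subseteq> \<sigma> ` R" using emb_in \<sigma>_emb by (metis image_eqI image_subsetI)
    obtain z where "z \<in> R" "z \<notin> range emb" using assms by (auto simp: valuation_ring_def)
    then show "range emb \<noteq> \<sigma> ` R" using \<sigma>_emb \<sigma>_eq by (metis (no_types, lifting) imageE image_eqI)
  qed
  moreover have "\<sigma> ` R \<subset> UNIV"
  proof -
    obtain z where "z \<notin> R" using assms by (auto simp: valuation_ring_def)
    then show ?thesis using \<sigma>_mem by (metis UNIV_I psubsetI subset_UNIV)
  qed
  moreover have "z \<in> \<sigma> ` R \<or> inverse z \<in> \<sigma> ` R" for z
  proof -
    obtain w where "z = \<sigma> w" using \<sigma>_bij by (metis bij_pointE)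
    then show ?thesis using total[of w] by (auto simp: \<sigma>_inverse[symmetric] \<sigma>_mem)
  qed
  ultimately show ?thesis by (simp add: valuation_ring_def)
qed

lemma \<sigma>_max_ideal: assumes "valuation_ring emb R" shows "\<sigma> z \<in> max_ideal (\<sigma> ` R) \<longleftrightarrow> z \<in> max_ideal R"
  using val_ring.P_iff[OF val_ring.intro[OF assms], of z]
    val_ring.P_iff[OF val_ring.intro[OF \<sigma>_valuation_ring[OF assms]], of "\<sigma> z"]
  by (simp add: \<sigma>_eq0 \<sigma>_inverse[symmetric] \<sigma>_mem)

lemma \<sigma>_unit: "unit_of R u \<Longrightarrow> unit_of (\<sigma> ` R) (\<sigma> u)"
  by (simp add: unit_of_def \<sigma>_eq0 \<sigma>_mem \<sigma>_inverse[symmetric])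

lemma \<sigma>_dvr: assumes "dvr emb R t" shows "dvr emb (\<sigma> ` R) (\<sigma> t)"
proof -
  interpret dvr emb R t by fact
  show ?thesis
  proof (intro dvr.intro val_ring.intro dvr_axioms.intro)
    show "valuation_ring emb (\<sigma> ` R)" using \<sigma>_valuation_ring vr by blast
    show "is_unif (\<sigma> ` R) (\<sigma> t)"
      unfolding is_unif_def
    proof (intro conjI allI impI)
      show "\<sigma> t \<noteq> 0" "\<sigma> t \<in> max_ideal (\<sigma> ` R)" using t0 tP \<sigma>_max_ideal[OF vr] \<sigma>_eq0 by auto
      fix z :: 'f assume "z \<noteq> 0"
      obtain w where w: "z = \<sigma> w" using \<sigma>_bij by (metis bij_pointE)
      then have "w \<noteq> 0" using \<open>z \<noteq> 0\<close> \<sigma>_0 by auto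
      then obtain k u where "unit_of R u" "w = t powi k * u" using ex_form by blast
      then have "unit_of (\<sigma> ` R) (\<sigma> u) \<and> z = \<sigma> t powi k * \<sigma> u" using \<sigma>_unit w
        by (simp add: \<sigma>_mult \<sigma>_powi)
      then show "\<exists>k u. unit_of (\<sigma> ` R) u \<and> z = \<sigma> t powi k * u" by blast
    qed
  qed
qed

lemma \<sigma>_val: assumes "dvr emb R t" "z \<noteq> 0"
  shows "place_val (max_ideal (\<sigma> ` R)) (\<sigma> z) = place_val (max_ideal R) z"
proof -
  interpret a: dvr emb R t by fact
  interpret b: dvr emb "\<sigma> ` R" "\<sigma> t" using \<sigma>_dvr assms by blast
  obtain k u where "unit_of R u" "z = t powi k * u" using a.ex_form assms by blast
  then show ?thesis using a.place_val_form b.place_val_form \<sigma>_unit by (simp add: \<sigma>_mult \<sigma>_powi)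
qed

end

lemma faut_inv: assumes "faut \<sigma>" shows "faut (inv_into UNIV \<sigma>)"
proof -
  have b: "bij \<sigma>" using \<sigma>_bij assms by blast
  have s: "\<sigma> (inv_into UNIV \<sigma> z) = z" for z using b by (simp add: bij_is_surj surj_f_inv_f)
  have i: "inv_into UNIV \<sigma> z = w \<longleftrightarrow> z = \<sigma> w" for z w using b s by (metis bij_inv_eq_iff)
  show ?thesis unfolding faut_iff using assms b s
    by (auto simp: i \<sigma>_add \<sigma>_mult \<sigma>_emb bij_imp_bij_inv)
qed

lemma faut_inv_image: assumes "faut \<sigma>"
  shows "\<sigma> ` (inv_into UNIV \<sigma> ` R) = R" "inv_into UNIV \<sigma> ` (\<sigma> ` R) = R"
  using \<sigma>_bij[OF assms] by (simp_all add: image_image bij_is_surj surj_f_inv_f bij_is_inj)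

text \<open>The place at infinity is rational: at order zero the leading weights of numerator and
  denominator agree, and the quotient of the leading coefficients is the residue.\<close>

lemma Rinf_residue: assumes "z \<in> Rinf" shows "\<exists>c. z - emb c \<in> max_ideal Rinf"
proof (cases "z \<in> max_ideal Rinf")
  case True then show ?thesis by (intro exI[of _ 0]) simp
next
  case False
  then have z0: "z \<noteq> 0" using I.P_zero by auto
  obtain g d where gd: "g \<in> A" "d \<in> A" "d \<noteq> 0" "z = g / d" by (rule frac_A)
  then have "g \<noteq> 0" using z0 by auto
  obtain p c where p: "c \<noteq> 0" "g - emb c * mon p \<in> V.span (mon ` {p' \<in> red. wt p' < wt p})"
    using lead_term[of g red] gd \<open>g \<noteq> 0\<close> unfolding A_def by blast
  obtain p' c' where p': "c' \<noteq> 0" "d - emb c' * mon p' \<in> V.span (mon ` {p'' \<in> red. wt p'' < wt p'})"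
    using lead_term[of d red] gd unfolding A_def by blast
  have "vinf z = 0" using False assms I.val_R[OF z0] I.val_P[OF z0] by auto
  moreover have "vinf g = vinf z + vinf d" using I.val_mult[OF z0 gd(3)] gd by simp
  ultimately have w: "wt p = wt p'" using lead_val[OF p] lead_val[OF p'] by simp
  define G D where "G = g * tinf ^ wt p" and "D = d * tinf ^ wt p"
  have G: "G - emb c \<in> max_ideal Rinf" using lead_unit(2)[OF Rinf p] by (simp add: G_def)
  have D: "D - emb c' \<in> max_ideal Rinf" "unit_of Rinf D" using lead_unit[OF Rinf p']
    by (auto simp: D_def w)
  have zGD: "z = G * inverse D" using gd tinf0 by (simp add: G_def D_def field_simps)
  define k where "k = c * inverse c'"
  have "emb k * emb c' = emb c" using p'(1) by (simp add: k_def flip: emb_mult)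
  then have "(G - emb c) - emb k * (D - emb c') = G - emb k * D" by (simp add: algebra_simps)
  moreover have "D \<noteq> 0" using D(2) by (simp add: unit_of_def)
  ultimately have "z - emb k = inverse D * ((G - emb c) - emb k * (D - emb c'))"
    by (simp add: zGD algebra_simps)
  also have "\<dots> \<in> max_ideal Rinf"
    using D(2) by (intro I.P_mult2[OF _ I.P_diff[OF G I.P_mult2[OF I.emb_in D(1)]]]) (simp add: unit_of_def)
  finally show ?thesis by blast
qed

text \<open>
  The translation \<open>y \<mapsto> y + b + w + w\<^sup>2\<close> with \<open>w = a\<^sup>q (x + a)\<close> moves the point \<open>(a, b)\<close> to the
  origin; it rests on \<open>h(w + w\<^sup>2) = w\<^sup>q + w\<close>.
\<close>

lemma translate:
  assumes "(a, b) \<in> S"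
  obtains x' y' where "Y2_curve n r emb x' y'" "x' = x - emb a"
    "\<And>R. valuation_ring emb R \<Longrightarrow> x - emb a \<in> max_ideal R \<Longrightarrow> y - emb b \<in> max_ideal R \<Longrightarrow> y' \<in> max_ideal R"
proof -
  define x' where "x' = x + emb a"
  define w where "w = emb (a ^ (2 * r)) * x'"
  define y' where "y' = y + emb b + (w ^ 2 + w)"
  have fr: "(u + v :: 'f) ^ (2 * r) = u ^ (2 * r) + v ^ (2 * r)" for u v
    using char2_frobenius[OF c2F, of u v n] by (simp only: two_r)
  have aQ: "(a ^ (2 * r)) ^ (2 * r) = a" using power_card_UNIV[of a] card_K
    by (simp add: power2_eq_square power_mult[symmetric])
  have hb: "h_poly n (emb b) = emb a ^ (2 * r + 1)" using assms
    by (simp add: h_emb emb_power emb_mult S_def fiber_def)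
  have "h_poly n (w ^ 2 + w) = w ^ (2 * r) + w"
    by (simp only: h_poly_add[OF c2F] h_poly_square[OF c2F] h_poly_telescope[OF c2F] two_r)
  also have "w ^ (2 * r) = emb a * x' ^ (2 * r)"
    unfolding w_def power_mult_distrib emb_power[symmetric] aQ ..
  finally have hw: "h_poly n (w ^ 2 + w) = emb a * (x ^ (2 * r) + emb a ^ (2 * r)) + emb a ^ (2 * r) * (x + emb a)"
    unfolding x'_def fr w_def emb_power .
  define X E where "X = x ^ (2 * r)" and "E = emb a ^ (2 * r)"
  have "h_poly n y' = x ^ (2 * r + 1) + emb a ^ (2 * r + 1) + (emb a * (X + E) + E * (x + emb a))"
    unfolding y'_def h_poly_add[OF c2F] eqn hb hw[unfolded h_poly_add[OF c2F]] X_def E_def ..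
  also have "\<dots> = X * x + X * emb a + E * x + E * emb a + (E * emb a + E * emb a)"
    by (simp add: X_def E_def algebra_simps)
  also have "\<dots> = (X + E) * (x + emb a)" by (simp only: char2 add_0_right) (simp add: algebra_simps)
  also have "\<dots> = x' ^ (2 * r + 1)" unfolding X_def E_def fr[symmetric] x'_def by simp
  finally have h: "h_poly n y' = x' ^ (2 * r + 1)" .
  have x'f: "x' = emb 1 * x + emb a" by (simp add: x'_def)
  have sq: "(u + v :: 'f) ^ 2 = u ^ 2 + v ^ 2" for u v using char2_frobenius[OF c2F, of u v 1]
    by simp
  have y'f: "y' = emb (b + (a ^ (2 * r)) ^ 2 * a ^ 2 + a ^ (2 * r) * a) + emb (a ^ (2 * r)) * x + emb ((a ^ (2 * r)) ^ 2) * x ^ 2 + emb 1 * y"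
    unfolding y'_def w_def x'_def power_mult_distrib sq
      by (simp add: emb_add emb_mult emb_power algebra_simps)
  have "Y2_curve n r emb x' y'" by (rule coord_change[OF one_neq_zero one_neq_zero x'f y'f h])
  moreover have "x' = x - emb a" by (simp add: x'_def char2)
  moreover have "y' \<in> max_ideal R"
    if R: "valuation_ring emb R" "x - emb a \<in> max_ideal R" "y - emb b \<in> max_ideal R" for R
  proof -
    interpret val_ring emb R using R by unfold_locales
    have "y + emb b \<in> P" "x' \<in> P" using R(2,3) by (simp_all add: char2 x'_def)
    then have "w \<in> P" unfolding w_def using P_mult2[OF emb_in] by blast
    then show ?thesis unfolding y'_def using \<open>y + emb b \<in> P\<close> P_add P_power by simp
  qed
  ultimately show ?thesis using that by blast
qed

lemma origin_S: "(0, 0) \<in> S" by (simp add: S_def fiber_def h_poly_def power_0_left)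

text \<open>
  If \<open>z\<close> were not constant, \<open>z y\<close> would lie in \<open>\<langle>1, x, x\<^sup>2, y\<rangle>\<close> without being a multiple of \<open>y\<close>, and yet
  vanish to order at least three at the origin, where \<open>x\<close> is a local parameter.
\<close>

lemma no_pole_at_origin:
  assumes R: "at_point R (0, 0)"
    and z: "z \<noteq> 0" "place_val (max_ideal R) z = - int r"
    and reg: "\<And>R'. valuation_ring emb R' \<Longrightarrow> R' \<noteq> R \<Longrightarrow> z \<in> R'"
  shows "z \<in> range emb"
proof -
  have v: "valuation_ring emb R" and xP: "x \<in> max_ideal R" and yP: "y \<in> max_ideal R"
    using R by (auto simp: at_point_def)
  have "R = Rpt (0, 0)" using Rpt_eq[OF origin_S R] .
  then have "is_unif R x" using unif_point[OF origin_S] by simp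
  then interpret dvr emb R x by unfold_locales (use v in auto)
  let ?v = "place_val (max_ideal R)"
  \<comment> \<open>Factoring \<open>y\<close> out of \<open>h(y)\<close> leaves 1 plus an element
    of \<open>P\<close>, so \<open>y\<close> and \<open>x ^ (2 * r + 1)\<close> differ by a
    unit.\<close>
  have vy: "?v y = 2 * int r + 1"
  proof -
    have "{..<n} = insert 0 {1..<n}" using n2 by auto
    then have "h_poly n y = y + (\<Sum>i=1..<n. y ^ 2 ^ i)" by (simp add: h_poly_def)
    also have "(\<Sum>i=1..<n. y ^ 2 ^ i) = y * (\<Sum>i=1..<n. y ^ (2 ^ i - 1))"
      unfolding sum_distrib_left
    proof (rule sum.cong)
      fix i
      have "(2::nat) ^ i = Suc (2 ^ i - 1)" by simp
      then show "y ^ 2 ^ i = y * y ^ (2 ^ i - 1)" by (metis power_Suc)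
    qed simp
    finally have hy: "y * (1 + (\<Sum>i=1..<n. y ^ (2 ^ i - 1))) = x ^ (2 * r + 1)" using eqn
      by (simp add: algebra_simps)
    define u where "u = 1 + (\<Sum>i=1..<n. y ^ (2 ^ i - 1))"
    have "(\<Sum>i=1..<n. y ^ (2 ^ i - 1)) \<in> P"
    proof (intro P_sum P_power yP)
      fix i assume "i \<in> {1..<n}"
      then have "(2::nat) ^ 1 \<le> 2 ^ i" by (intro power_increasing) auto
      then show "0 < (2::nat) ^ i - 1" by simp
    qed
    then have u: "unit_of R u" unfolding u_def by (intro unit_add_P unit_1)
    then have "u \<noteq> 0" by (simp add: unit_of_def)
    then have "?v y = ?v (x ^ (2 * r + 1))" using val_mult[OF y0, of u] val_unit[OF u] hy
      by (simp add: u_def)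
    then show ?thesis using val_power[OF x0, of "2 * r + 1"] val_t by simp
  qed
  define f where "f = z * y"
  have f0: "f \<noteq> 0" using z y0 by (simp add: f_def)
  have vf: "?v f = int r + 1" unfolding f_def using val_mult[OF z(1) y0] z(2) vy by simp
  have xR: "x \<in> R" using xP P_R by blast
  have ninf: "Rinf \<noteq> R" using xR Rinf by blast
  have fA: "f \<in> A"
  proof (rule A_normal)
    fix R' assume R': "valuation_ring emb R'" "x \<in> R'"
    show "f \<in> R'"
    proof (cases "R' = R")
      case True then show ?thesis using vf val_R[OF f0] by simp
    next
      case False
      interpret R': val_ring emb R' using R' by unfold_locales
      have "y \<in> R'" using fin_A[OF R'] yA by blast
      then show ?thesis unfolding f_def using reg[OF R'(1) False] R'.R_closed by blast
    qed
  qed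
  have "z \<in> Rinf" using reg[OF Rinf(1) ninf] .
  then have "vinf f \<ge> - (2 * int r + 1)" unfolding f_def
    using I.val_mult[OF z(1) y0] vinf_y I.val_R[OF z(1)] by simp
  then have "f \<in> L (2 * int r + 1)" using fA by (simp add: L_iff)
  then obtain c0 c1 c2 c3 where c: "f = emb c0 + emb c1 * x + emb c2 * x ^ 2 + emb c3 * y"
    using L_y_form[of f "2 * int r + 1"] by auto
  \<comment> \<open>The orders \<open>r + 1\<close> of \<open>f\<close> and \<open>2 * r + 1\<close>
    of \<open>y\<close> are at least 3. So \<open>x ^ 3\<close> divides the part of \<open>f\<close>
    that is quadratic in \<open>x\<close>, and its coefficients vanish one after the other.\<close>
  have cube: "\<exists>w\<in>R. s = x ^ 3 * w" if "s \<noteq> 0" "?v s \<ge> 3" for s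
  proof (rule bexI[of _ "s / x ^ 3"])
    have "?v (s / x ^ 3) + ?v (x ^ 3) = ?v s" using val_mult[of "s / x ^ 3" "x ^ 3"] that x0 by simp
    then have "?v (s / x ^ 3) \<ge> 0" using val_power[OF x0, of 3] val_t that by simp
    then show "s / x ^ 3 \<in> R" using val_R[of "s / x ^ 3"] that x0 by simp
  qed (use x0 in simp)
  obtain w1 where w1: "w1 \<in> R" "f = x ^ 3 * w1" using cube[OF f0] vf r2 by auto
  obtain w2 where w2: "w2 \<in> R" "y = x ^ 3 * w2" using cube[OF y0] vy r2 by auto
  define w where "w = w1 - emb c3 * w2"
  have wR: "w \<in> R" unfolding w_def using w1 w2 emb_in by (simp add: R_closed)
  have e: "emb c0 + emb c1 * x + emb c2 * x ^ 2 = x ^ 3 * w"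
    unfolding w_def right_diff_distrib w1(2)[symmetric] c using w2(2) by (simp add: algebra_simps)
  have Z: "emb d = 0" if "emb d = x * s" "s \<in> R" for d s
  proof -
    have "emb d \<in> P" unfolding that(1) using P_mult[OF xP that(2)] .
    then show ?thesis using emb_P[OF v] by simp
  qed
  have "emb c0 = x * (x ^ 2 * w - emb c1 - emb c2 * x)"
    using e by (simp add: algebra_simps power2_eq_square power3_eq_cube eq_diff_eq)
  moreover have "x ^ 2 * w - emb c1 - emb c2 * x \<in> R" using wR xR emb_in by (simp add: R_closed)
  ultimately have c0: "emb c0 = 0" using Z by blast
  have "x * (emb c1 + emb c2 * x) = x * (x ^ 2 * w)" using e c0
    by (simp add: algebra_simps power2_eq_square power3_eq_cube)
  then have e1: "emb c1 + emb c2 * x = x ^ 2 * w" using x0 by simp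
  then have "emb c1 = x * (x * w - emb c2)" by (simp add: algebra_simps power2_eq_square eq_diff_eq)
  moreover have "x * w - emb c2 \<in> R" using wR xR emb_in by (simp add: R_closed)
  ultimately have c1: "emb c1 = 0" using Z by blast
  have "x * emb c2 = x * (x * w)" using e1 c1
    by (simp add: power2_eq_square mult.commute mult.left_commute)
  then have "emb c2 = x * w" using x0 by simp
  then have c2: "emb c2 = 0" using Z wR by blast
  have "z * y = emb c3 * y" using c c0 c1 c2 by (simp add: f_def)
  then have "z = emb c3" using y0 by simp
  then show ?thesis by blast
qed

lemma faut_Rinf: assumes \<sigma>: "faut \<sigma>" shows "\<sigma> ` Rinf = Rinf"
proof (rule ccontr)
  assume ne: "\<sigma> ` Rinf \<noteq> Rinf"
  define R where "R = \<sigma> ` Rinf"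
  have v: "valuation_ring emb R" unfolding R_def using \<sigma>_valuation_ring[OF \<sigma>] Rinf by blast
  then interpret val_ring emb R by unfold_locales
  have xR: "x \<in> R" using Rinf_eq[OF v] ne by (auto simp: R_def)
  \<comment> \<open>An automorphism carries rational places to rational places; the residues of
    \<open>x\<close> and \<open>y\<close> are the coordinates of the point below
    \<open>R\<close>.\<close>
  have res: "\<exists>c. z - emb c \<in> P" if zR: "z \<in> R" for z
  proof -
    obtain w where w: "w \<in> Rinf" "z = \<sigma> w" using zR by (auto simp: R_def)
    obtain c where "w - emb c \<in> max_ideal Rinf" using Rinf_residue w by blast
    then have "\<sigma> (w - emb c) \<in> P" unfolding R_def using \<sigma>_max_ideal[OF \<sigma> Rinf(1)] by blast
    then show ?thesis using w by (auto simp: \<sigma>_diff[OF \<sigma>] \<sigma>_emb[OF \<sigma>])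
  qed
  have yR: "y \<in> R" using fin_A[OF v xR] yA by blast
  obtain a b where ab: "x - emb a \<in> P" "y - emb b \<in> P" using res[OF xR] res[OF yR] by blast
  have abS: "(a, b) \<in> S"
  proof -
    have 1: "x ^ (2 * r + 1) - emb a ^ (2 * r + 1) \<in> P"
    proof -
      have "x ^ (2 * r + 1) - emb a ^ (2 * r + 1) = (x - emb a) * (\<Sum>i<2 * r + 1. emb a ^ (2 * r + 1 - Suc i) * x ^ i)"
        by (rule power_diff_sumr2)
      also have "\<dots> \<in> P" using ab xR emb_in
        by (intro P_mult is_subring_sum[OF sub]) (auto simp: R_closed)
      finally show ?thesis .
    qed
    have 2: "h_poly n y - h_poly n (emb b) \<in> P"
    proof -
      have "h_poly n y - h_poly n (emb b) = h_poly n (y - emb b)"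
        by (simp only: char2(3) h_poly_add[OF c2F])
      also have "\<dots> \<in> P" unfolding h_poly_def using ab by (intro P_sum P_power) auto
      finally show ?thesis .
    qed
    have "emb (h_poly n b - a ^ (2 * r + 1)) = (x ^ (2 * r + 1) - emb a ^ (2 * r + 1)) - (h_poly n y - h_poly n (emb b))"
      unfolding eqn by (simp only: emb_diff emb_power h_emb) (simp add: algebra_simps)
    then have "emb (h_poly n b - a ^ (2 * r + 1)) \<in> P" using P_diff[OF 1 2] by metis
    then have "h_poly n b - a ^ (2 * r + 1) = 0" using emb_P[OF v] by blast
    then show ?thesis by (simp add: S_def fiber_def)
  qed
  obtain x' y' where C: "Y2_curve n r emb x' y'" "x' = x - emb a"
      "\<And>R. valuation_ring emb R \<Longrightarrow> x - emb a \<in> max_ideal R \<Longrightarrow> y - emb b \<in> max_ideal R \<Longrightarrow> y' \<in> max_ideal R"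
    using translate[OF abS] by blast
  interpret C: Y2_curve n r emb x' y' by (rule C(1))
  have at: "C.at_point R (0, 0)" unfolding C.at_point_def using v ab C(2) C(3)[OF v ab] by simp
  \<comment> \<open>In the coordinates centred at the point, \<open>\<sigma> x\<close> has its only
    pole at the origin, of order \<open>r\<close>, just as \<open>x\<close> has it at
    infinity.\<close>
  have "\<sigma> x \<in> range emb"
  proof (rule C.no_pole_at_origin[OF at])
    show "\<sigma> x \<noteq> 0" using x0 \<sigma>_eq0[OF \<sigma>] by simp
    show "place_val P (\<sigma> x) = - int r" unfolding R_def using \<sigma>_val[OF \<sigma> I.dvr_axioms x0] vinf_x
      by simp
    fix R' assume R': "valuation_ring emb R'" "R' \<noteq> R"
    define R'' where "R'' = inv_into UNIV \<sigma> ` R'"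
    have "valuation_ring emb R''" unfolding R''_def
      using \<sigma>_valuation_ring[OF faut_inv[OF \<sigma>] R'(1)] .
    moreover have s: "\<sigma> ` R'' = R'" unfolding R''_def using faut_inv_image[OF \<sigma>] by blast
    then have "R'' \<noteq> Rinf" using R' R_def by blast
    ultimately have "x \<in> R''" using Rinf_eq by blast
    then show "\<sigma> x \<in> R'" using s by blast
  qed
  then obtain c where "\<sigma> x = \<sigma> (emb c)" using \<sigma>_emb[OF \<sigma>] by auto
  then show False using \<sigma>_eq[OF \<sigma>] x_emb by blast
qed

lemma faut_A: assumes \<sigma>: "faut \<sigma>" and f: "f \<in> A" shows "\<sigma> f \<in> A"
proof (rule A_normal)
  fix R assume R: "valuation_ring emb R" "x \<in> R"
  define R' where "R' = inv_into UNIV \<sigma> ` R"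
  have v: "valuation_ring emb R'" unfolding R'_def using \<sigma>_valuation_ring[OF faut_inv[OF \<sigma>] R(1)] .
  have s: "\<sigma> ` R' = R" unfolding R'_def using faut_inv_image[OF \<sigma>] by blast
  have "R' \<noteq> Rinf" using s faut_Rinf[OF \<sigma>] R Rinf by auto
  then have "x \<in> R'" using Rinf_eq[OF v] by blast
  then have "f \<in> R'" using fin_A[OF v] f by blast
  then show "\<sigma> f \<in> R" using s by blast
qed

lemma faut_vinf: assumes "faut \<sigma>" "z \<noteq> 0" shows "vinf (\<sigma> z) = vinf z"
  using \<sigma>_val[OF assms(1) I.dvr_axioms assms(2)] faut_Rinf[OF assms(1)] by simp

lemma faut_L: "faut \<sigma> \<Longrightarrow> f \<in> L m \<Longrightarrow> \<sigma> f \<in> L m"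
  using faut_A[of \<sigma> f] faut_vinf[of \<sigma> f] \<sigma>_0[of \<sigma>] by (cases "f = 0") (auto simp: L_iff)

section \<open>Automorphisms as permutations of the rational points\<close>

definition pi_perm :: "('f \<Rightarrow> 'f) \<Rightarrow> 'k \<times> 'k \<Rightarrow> 'k \<times> 'k" where
  "pi_perm \<sigma> p = (ev p (\<sigma> x), ev p (\<sigma> y))"

lemma pi_perm_S: assumes \<sigma>: "faut \<sigma>" and p: "p \<in> S" shows "pi_perm \<sigma> p \<in> S"
proof -
  have "h_poly n (ev p (\<sigma> y)) = ev p (\<sigma> (h_poly n y))"
    using p faut_A[OF \<sigma> yA] by (simp add: ev_h \<sigma>_h[OF \<sigma>])
  also have "\<dots> = ev p (\<sigma> x) ^ (2 * r + 1)"
    unfolding eqn \<sigma>_power[OF \<sigma>] using p faut_A[OF \<sigma> xA] by (rule ev_power)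
  finally show ?thesis by (simp add: pi_perm_def S_def fiber_def)
qed

lemma ev_pi_perm: assumes \<sigma>: "faut \<sigma>" and p: "p \<in> S" and u: "u \<in> A"
  shows "ev (pi_perm \<sigma> p) u = ev p (\<sigma> u)"
  using u
proof (induction rule: A_induct)
  case zero then show ?case using ev_0[OF p] ev_0[OF pi_perm_S[OF \<sigma> p]] \<sigma>_0[OF \<sigma>] by simp
next
  case (step c q g)
  have s: "pi_perm \<sigma> p \<in> S" using pi_perm_S[OF \<sigma> p] .
  have "ev p (\<sigma> (mon q)) = ev (pi_perm \<sigma> p) (mon q)"
    unfolding ev_mon[OF s] unfolding mon_def \<sigma>_mult[OF \<sigma>] \<sigma>_power[OF \<sigma>]
    using p faut_A[OF \<sigma>] xA yA by (simp add: ev_mult ev_power A_closed pi_perm_def)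
  then show ?case
    using step mon_A[OF step(1)] s p faut_A[OF \<sigma>]
    by (simp add: ev_add ev_scale A_scale \<sigma>_add[OF \<sigma>] \<sigma>_mult[OF \<sigma>] \<sigma>_emb[OF \<sigma>])
qed

text \<open>Points pull functions back, so composition is reversed; the isomorphism with code
  automorphisms must therefore pass to inverses.\<close>

lemma pi_perm_comp: assumes "faut \<sigma>" "faut \<sigma>'" "p \<in> S"
  shows "pi_perm (\<sigma> \<circ> \<sigma>') p = pi_perm \<sigma>' (pi_perm \<sigma> p)"
  using ev_pi_perm[OF assms(1,3)] faut_A[OF assms(2)] xA yA by (simp add: pi_perm_def)

lemma pi_perm_id: "p \<in> S \<Longrightarrow> pi_perm id p = p" by (simp add: pi_perm_def ev_x ev_y)

lemma faut_comp_inv: assumes "faut \<sigma>" shows "inv_into UNIV \<sigma> \<circ> \<sigma> = id" "\<sigma> \<circ> inv_into UNIV \<sigma> = id"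
  using \<sigma>_bij[OF assms] by (simp_all add: fun_eq_iff bij_is_surj surj_f_inv_f bij_is_inj)

lemma pi_perm_bij: assumes "faut \<sigma>" shows "bij_betw (pi_perm \<sigma>) S S"
proof (rule bij_betwI[where g = "pi_perm (inv_into UNIV \<sigma>)"])
  show "pi_perm \<sigma> \<in> S \<rightarrow> S" "pi_perm (inv_into UNIV \<sigma>) \<in> S \<rightarrow> S"
    using pi_perm_S[OF assms] pi_perm_S[OF faut_inv[OF assms]] by auto
  show "pi_perm (inv_into UNIV \<sigma>) (pi_perm \<sigma> p) = p" if "p \<in> S" for p
    using pi_perm_comp[OF assms faut_inv[OF assms] that] faut_comp_inv[OF assms] pi_perm_id[OF that]
      by simp
  show "pi_perm \<sigma> (pi_perm (inv_into UNIV \<sigma>) p) = p" if "p \<in> S" for p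
    using pi_perm_comp[OF faut_inv[OF assms] assms that] faut_comp_inv[OF assms] pi_perm_id[OF that]
      by simp
qed

lemma pi_perm_pres: assumes "faut \<sigma>" shows "pres m (pi_perm \<sigma>)"
  unfolding pres_def
proof
  fix f assume f: "f \<in> L m"
  then show "\<exists>g\<in>L m. \<forall>p\<in>S. ev p g = ev (pi_perm \<sigma> p) f"
    using faut_L[OF assms f] ev_pi_perm[OF assms] L_A by (intro bexI[of _ "\<sigma> f"]) auto
qed

lemma faut_ext: assumes s: "faut \<sigma>" "faut \<sigma>'" and xy: "\<sigma> x = \<sigma>' x" "\<sigma> y = \<sigma>' y" shows "\<sigma> = \<sigma>'"
proof
  fix z
  have A: "\<sigma> u = \<sigma>' u" if "u \<in> A" for u using that
  proof (induction rule: A_induct)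
    case (step c q g)
    then show ?case using xy
      by (simp add: mon_def \<sigma>_add[OF s(1)] \<sigma>_add[OF s(2)] \<sigma>_mult[OF s(1)] \<sigma>_mult[OF s(2)]
        \<sigma>_power[OF s(1)] \<sigma>_power[OF s(2)] \<sigma>_emb[OF s(1)] \<sigma>_emb[OF s(2)])
  qed (simp add: \<sigma>_0[OF s(1)] \<sigma>_0[OF s(2)])
  obtain g d where "g \<in> A" "d \<in> A" "z = g / d" using frac_A by metis
  then show "\<sigma> z = \<sigma>' z" using A by (simp add: \<sigma>_divide[OF s(1)] \<sigma>_divide[OF s(2)])
qed

text \<open>The images of \<open>x\<close> and \<open>y\<close> have order at most
  \<open>2 * r + 1\<close>, below the number of points, so their values determine them and with them
  the automorphism.\<close>

lemma pi_perm_inj: assumes s: "faut \<sigma>" "faut \<sigma>'" and e: "\<And>p. p \<in> S \<Longrightarrow> pi_perm \<sigma> p = pi_perm \<sigma>' p"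
  shows "\<sigma> = \<sigma>'"
proof -
  have "\<sigma> u = \<sigma>' u" if u: "u \<in> L (2 * int r + 1)" "u = x \<or> u = y" for u
  proof -
    have uL: "\<sigma> u \<in> L (2 * int r + 1)" "\<sigma>' u \<in> L (2 * int r + 1)" using faut_L s u by auto
    have "\<sigma> u - \<sigma>' u = 0"
    proof (rule ev_zero_imp_zero)
      show "\<sigma> u - \<sigma>' u \<in> L (2 * int r + 1)" using uL L_diff by blast
      have "4 * 2 * r \<le> 4 * r * r" using r2 by simp
      then have "2 * r + 1 < Q" unfolding Q_eq using r2 by linarith
      also have "Q \<le> Q * r" using r2 by simp
      finally have "int (2 * r + 1) < int (Q * r)" by (simp only: of_nat_less_iff)
      then show "2 * int r + 1 < int (Q * r)" by simp
      fix p assume p: "p \<in> S"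
      then show "ev p (\<sigma> u - \<sigma>' u) = 0" using e[OF p] u(2) L_A[OF uL(1)] L_A[OF uL(2)]
        by (auto simp: ev_diff pi_perm_def)
    qed
    then show ?thesis by simp
  qed
  then show ?thesis using faut_ext[OF s] x_L[of "2 * int r + 1"] y_L[of "2 * int r + 1"] by auto
qed

text \<open>The reduced monomials form a basis of \<open>A\<close>, and \<open>f\<close>,
  \<open>g\<close> obey the same reduction rule for the \<open>r\<close>-th power as
  \<open>x\<close>, \<open>y\<close>. So the linear map between the two families of monomials is
  multiplicative; leading terms show that it is injective, and it extends to fractions.\<close>

lemma faut_exists:
  assumes \<alpha>: "\<alpha> \<noteq> 0" and c3: "c3 \<noteq> 0"
    and f: "f = emb \<alpha> * x + emb \<beta>" and g: "g = emb c0 + emb c1 * x + emb c2 * x ^ 2 + emb c3 * y"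
    and h: "h_poly n g = f ^ (2 * r + 1)"
  obtains \<sigma> where "faut \<sigma>" "\<sigma> x = f" "\<sigma> y = g"
proof -
  interpret C: Y2_curve n r emb f g by (rule coord_change[OF assms])
  interpret VP: vector_space_pair "\<lambda>c f. emb c * f" "\<lambda>c f. emb c * f" by unfold_locales
  obtain \<rho> where \<rho>: "Vector_Spaces.linear (\<lambda>c f. emb c * f) (\<lambda>c f. emb c * f) \<rho>"
    "\<forall>m\<in>mon ` red. \<rho> m = C.mon (inv_into red mon m)"
    using VP.linear_independent_extend[OF mon_independent, of "\<lambda>m. C.mon (inv_into red mon m)"]
      by blast
  have \<rho>_mon: "\<rho> (mon q) = C.mon q" if "q \<in> red" for q using \<rho>(2) that mon_inj
    by (simp add: inv_into_f_f)
  interpret \<rho>: Vector_Spaces.linear "\<lambda>c f. emb c * f" "\<lambda>c f. emb c * f" \<rho> by (rule \<rho>(1))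
  have \<rho>_add: "\<rho> (a + b) = \<rho> a + \<rho> b" and \<rho>_scale: "\<rho> (emb c * a) = emb c * \<rho> a" for a b c
    using \<rho>.add \<rho>.scale by auto
  have \<rho>_0: "\<rho> 0 = 0" using \<rho>.zero by simp
  have \<rho>_x: "\<rho> (x * u) = f * \<rho> u" if "u \<in> A" for u
    using that
  proof (induction rule: A_induct)
    case (step c q u)
    have "x * mon q = mon (Suc (fst q), snd q)" by (simp add: mon_def)
    moreover have "(Suc (fst q), snd q) \<in> red" using step by (simp add: red_def)
    ultimately have m: "\<rho> (x * mon q) = f * C.mon q" using \<rho>_mon by (simp add: C.mon_def)
    have e: "x * (emb c * mon q + u) = emb c * (x * mon q) + x * u" by (simp add: algebra_simps)
    show ?case unfolding e \<rho>_add \<rho>_scale m step(3) \<rho>_mon[OF step(1)] by (simp add: algebra_simps)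
  qed (simp add: \<rho>_0)
  have \<rho>_xpow: "\<rho> (x ^ k * u) = f ^ k * \<rho> u" if "u \<in> A" for k u
    by (induction k) (use that in \<open>auto simp: \<rho>_x A_xpow mult.assoc\<close>)
  have \<rho>_diff: "\<rho> (a - b) = \<rho> a - \<rho> b" for a b using \<rho>_add[of "a - b" b] by simp
  have \<rho>_sum: "\<rho> (sum F J) = (\<Sum>i\<in>J. \<rho> (F i))" for F and J :: "nat set"
    by (induction J rule: infinite_finite_induct) (auto simp: \<rho>_0 \<rho>_add)
  have \<rho>_y: "\<rho> (y * u) = g * \<rho> u" if "u \<in> A" for u
    using that
  proof (induction rule: A_induct)
    case (step c q u)
    have m: "\<rho> (y * mon q) = g * C.mon q"
    proof (cases "Suc (snd q) < r")
      case True
      have "y * mon q = mon (fst q, Suc (snd q))" by (simp add: mon_def mult_ac)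
      moreover have "(fst q, Suc (snd q)) \<in> red" using True by (simp add: red_def)
      ultimately show ?thesis using \<rho>_mon by (simp add: C.mon_def mult_ac)
    next
      case False
      then have sq: "Suc (snd q) = r" using step by (simp add: red_def)
      have 1: "mon (2 * r + 1, 0) - (\<Sum>i<n-1. mon (0, 2 ^ i)) \<in> A"
        using r2 pow_less_r by (intro A_diff A_sum mon_A) (auto simp: red_def)
      have "y * mon q = x ^ fst q * y ^ r" using sq by (auto simp: mon_def)
      also have "\<dots> = x ^ fst q * (mon (2 * r + 1, 0) - (\<Sum>i<n-1. mon (0, 2 ^ i)))"
        unfolding y_r by (simp add: mon_def)
      finally have "\<rho> (y * mon q) = f ^ fst q * \<rho> (mon (2 * r + 1, 0) - (\<Sum>i<n-1. mon (0, 2 ^ i)))"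
        using \<rho>_xpow[OF 1] by simp
      also have "\<rho> (mon (2 * r + 1, 0) - (\<Sum>i<n-1. mon (0, 2 ^ i))) = C.mon (2 * r + 1, 0) - (\<Sum>i<n-1. C.mon (0, 2 ^ i))"
        unfolding \<rho>_diff \<rho>_sum using r2 pow_less_r by (simp add: \<rho>_mon red_def)
      also have "\<dots> = g ^ r" unfolding C.y_r by (simp add: C.mon_def)
      also have "f ^ fst q * g ^ r = g * C.mon q" using sq by (auto simp: C.mon_def)
      finally show ?thesis .
    qed
    have e: "y * (emb c * mon q + u) = emb c * (y * mon q) + y * u" by (simp add: algebra_simps)
    show ?case unfolding e \<rho>_add \<rho>_scale m step(3) \<rho>_mon[OF step(1)] by (simp add: algebra_simps)
  qed (simp add: \<rho>_0)
  have \<rho>_ypow: "\<rho> (y ^ k * u) = g ^ k * \<rho> u" if "u \<in> A" for k u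
    by (induction k) (use that in \<open>auto simp: \<rho>_y A_ypow mult.assoc\<close>)
  have \<rho>_mult: "\<rho> (v * u) = \<rho> v * \<rho> u" if "v \<in> A" "u \<in> A" for u v
    using that(1)
  proof (induction rule: A_induct)
    case (step c q v)
    have m: "\<rho> (mon q * u) = C.mon q * \<rho> u"
      using \<rho>_xpow[OF A_ypow[OF that(2)]] \<rho>_ypow[OF that(2)]
        by (simp add: mon_def C.mon_def mult.assoc)
    have e: "(emb c * mon q + v) * u = emb c * (mon q * u) + v * u" by (simp add: algebra_simps)
    show ?case unfolding e \<rho>_add \<rho>_scale m step(3) \<rho>_mon[OF step(1)] by (simp add: algebra_simps)
  qed (simp add: \<rho>_0)
  have \<rho>_1: "\<rho> 1 = 1" using \<rho>_mon[of "(0,0)"] r2 by (simp add: red_def mon_def C.mon_def)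
  have \<rho>_emb: "\<rho> (emb c) = emb c" for c using \<rho>_scale[of c 1] \<rho>_1 by simp
  have \<rho>x: "\<rho> x = f" using \<rho>_x[OF A_1] \<rho>_1 by simp
  have \<rho>y: "\<rho> y = g" using \<rho>_y[OF A_1] \<rho>_1 by simp
  have \<rho>_span: "\<rho> u \<in> V.span (C.mon ` J)" if "u \<in> V.span (mon ` J)" "J \<subseteq> red" for u J
    using that(1)
  proof (induction rule: V.span_induct_alt)
    case base show ?case using V.span_zero \<rho>_0 by simp
  next
    case (step c m u)
    then obtain q where "q \<in> J" "m = mon q" by blast
    then have "\<rho> m \<in> V.span (C.mon ` J)" using \<rho>_mon[of q] that(2) by (intro V.span_base) auto
    then show ?case using step.IH unfolding \<rho>_add \<rho>_scale by (intro V.span_add V.span_scale)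
  qed
  have \<rho>_nz: "\<rho> u \<noteq> 0" if uA: "u \<in> A" "u \<noteq> 0" for u
  proof -
    obtain q c where q: "q \<in> red" "c \<noteq> 0" "u - emb c * mon q \<in> V.span (mon ` {p' \<in> red. wt p' < wt q})"
      using lead_term[of u red] uA unfolding A_def by blast
    have "\<rho> (u - emb c * mon q) \<in> V.span (C.mon ` {p' \<in> red. wt p' < wt q})"
      by (rule \<rho>_span[OF q(3)]) auto
    then have "\<rho> u - emb c * C.mon q \<in> V.span (C.mon ` {p' \<in> red. wt p' < wt q})"
      using \<rho>_mon[OF q(1)] by (simp add: \<rho>_diff \<rho>_scale)
    then have "unit_of C.Rinf (\<rho> u * C.tinf ^ wt q)" using C.lead_unit(1)[OF C.Rinf q(2)] by blast
    then show ?thesis by (auto simp: unit_of_def)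
  qed
  \<comment> \<open>Independent of the fraction chosen, because \<open>\<rho>\<close> is
    multiplicative on \<open>A\<close> and sends no other element to 0 than 0.\<close>
  define \<sigma> where "\<sigma> z = (THE w. \<exists>u\<in>A. \<exists>v\<in>A. v \<noteq> 0 \<and> z = u / v \<and> w = \<rho> u / \<rho> v)" for z
  have \<sigma>_eqI: "\<sigma> (u / v) = \<rho> u / \<rho> v" if uv: "u \<in> A" "v \<in> A" "v \<noteq> 0" for u v
    unfolding \<sigma>_def
  proof (rule the_equality)
    show "\<exists>u'\<in>A. \<exists>v'\<in>A. v' \<noteq> 0 \<and> u / v = u' / v' \<and> \<rho> u / \<rho> v = \<rho> u' / \<rho> v'" using uv by blast
    fix w assume "\<exists>u'\<in>A. \<exists>v'\<in>A. v' \<noteq> 0 \<and> u / v = u' / v' \<and> w = \<rho> u' / \<rho> v'"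
    then obtain u' v' where u': "u' \<in> A" "v' \<in> A" "v' \<noteq> 0" "u / v = u' / v'" "w = \<rho> u' / \<rho> v'"
      by blast
    then have "u * v' = u' * v" using uv by (simp add: frac_eq_eq)
    then have "\<rho> u * \<rho> v' = \<rho> u' * \<rho> v" using uv u' \<rho>_mult by metis
    then show "w = \<rho> u / \<rho> v" using \<rho>_nz uv u' by (simp add: frac_eq_eq)
  qed
  have \<sigma>A: "\<sigma> u = \<rho> u" if "u \<in> A" for u using \<sigma>_eqI[OF that A_1] \<rho>_1 by simp
  have hom: "\<sigma> (a + b) = \<sigma> a + \<sigma> b \<and> \<sigma> (a * b) = \<sigma> a * \<sigma> b \<and> (a \<noteq> 0 \<longrightarrow> \<sigma> a \<noteq> 0) \<and> \<sigma> (inverse a) = inverse (\<sigma> a)" for a b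
  proof -
    obtain u v where a: "u \<in> A" "v \<in> A" "v \<noteq> 0" "a = u / v" by (rule frac_A)
    obtain u' v' where b: "u' \<in> A" "v' \<in> A" "v' \<noteq> 0" "b = u' / v'" by (rule frac_A)
    have nz: "\<rho> v \<noteq> 0" "\<rho> v' \<noteq> 0" using \<rho>_nz a b by auto
    have ab: "\<sigma> a = \<rho> u / \<rho> v" "\<sigma> b = \<rho> u' / \<rho> v'" using \<sigma>_eqI a b by auto
    have "a + b = (u * v' + u' * v) / (v * v')" using a b by (simp add: field_simps)
    then have 1: "\<sigma> (a + b) = \<rho> (u * v' + u' * v) / \<rho> (v * v')" using a b
      by (simp add: \<sigma>_eqI A_closed)
    have "a * b = (u * u') / (v * v')" using a b by simp
    then have 2: "\<sigma> (a * b) = \<rho> (u * u') / \<rho> (v * v')" using a b by (simp add: \<sigma>_eqI A_closed)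
    have 3: "\<sigma> (inverse a) = inverse (\<sigma> a)"
    proof (cases "u = 0")
      case True then show ?thesis using a ab \<sigma>A[OF A_0] \<rho>_0 by simp
    next
      case False
      have "inverse a = v / u" using a by simp
      then show ?thesis using \<sigma>_eqI[OF a(2,1) False] ab by simp
    qed
    have "\<rho> (u * v' + u' * v) = \<rho> u * \<rho> v' + \<rho> u' * \<rho> v" "\<rho> (v * v') = \<rho> v * \<rho> v'" "\<rho> (u * u') = \<rho> u * \<rho> u'"
      using a b by (simp_all add: \<rho>_add \<rho>_mult A_closed)
    then have 4: "\<sigma> (a + b) = \<sigma> a + \<sigma> b" "\<sigma> (a * b) = \<sigma> a * \<sigma> b"
      unfolding 1 2 ab using nz by (simp_all add: add_frac_eq)
    have "a \<noteq> 0 \<longrightarrow> \<sigma> a \<noteq> 0" unfolding ab(1) using nz \<rho>_nz[OF a(1)] a(4) by auto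
    then show ?thesis using 3 4 by blast
  qed
  have \<sigma>_d: "\<sigma> (a - b) = \<sigma> a - \<sigma> b" for a b using hom[of "a - b" b] by simp
  have inj: "inj \<sigma>"
  proof (rule injI)
    fix a b assume "\<sigma> a = \<sigma> b"
    then show "a = b" using hom[of "a - b" 0] \<sigma>_d[of a b] by auto
  qed
  have e: "\<sigma> (emb c) = emb c" for c using \<sigma>A[OF A_emb] \<rho>_emb by simp
  \<comment> \<open>Surjectivity: a subfield containing the constants, \<open>f\<close> and
    \<open>g\<close> is everything, since \<open>f\<close> and \<open>g\<close> generate the field
    too.\<close>
  have "is_subfield (range \<sigma>)"
    unfolding is_subfield_def is_subring_def
  proof (intro conjI ballI)
    show "0 \<in> range \<sigma>" "1 \<in> range \<sigma>" using e[of 0] e[of 1]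
      by (metis emb_0 rangeI, metis emb_1 rangeI)
    fix a assume "a \<in> range \<sigma>"
    then obtain a' where a': "a = \<sigma> a'" by blast
    show "inverse a \<in> range \<sigma>" unfolding a' using hom[of a' 0] by (metis rangeI)
    fix b assume "b \<in> range \<sigma>"
    then obtain b' where b': "b = \<sigma> b'" by blast
    show "a - b \<in> range \<sigma>" unfolding a' b' using \<sigma>_d by (metis rangeI)
    show "a * b \<in> range \<sigma>" unfolding a' b' using hom[of a' b'] by (metis rangeI)
  qed
  moreover have \<sigma>x: "\<sigma> x = f" and \<sigma>y: "\<sigma> y = g" using \<sigma>A xA yA \<rho>x \<rho>y by auto
  then have "f \<in> range \<sigma>" "g \<in> range \<sigma>" by auto
  moreover have "range emb \<subseteq> range \<sigma>" using e by (metis image_subsetI rangeI)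
  ultimately have "range \<sigma> = UNIV" using C.subfield_UNIV by blast
  then have "faut \<sigma>" unfolding faut_iff using hom e inj by (auto simp: bij_def)
  then show ?thesis using that \<sigma>x \<sigma>y by blast
qed

lemma pres_faut:
  assumes pr: "pres (int m) \<tau>" "bij_betw \<tau> S S" and m: "2 * r + 1 \<le> m" "2 * m < Q * r"
  obtains \<sigma> where "faut \<sigma>" "\<And>p. p \<in> S \<Longrightarrow> pi_perm \<sigma> p = \<tau> p"
proof -
  have "r \<le> m" using m by simp
  then obtain \<alpha> \<beta> where ab: "\<alpha> \<noteq> 0" "\<And>p. p \<in> S \<Longrightarrow> fst (\<tau> p) = \<alpha> * fst p + \<beta>"
    using pres_x[OF pr _ m(2)] by blast
  show ?thesis
  proof (rule pres_y[OF pr m ab])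
    fix c0 c1 c2 c3 assume c: "c3 \<noteq> 0"
      "h_poly n (emb c0 + emb c1 * x + emb c2 * x ^ 2 + emb c3 * y) = (emb \<alpha> * x + emb \<beta>) ^ (2 * r + 1)"
      "\<And>p. p \<in> S \<Longrightarrow> snd (\<tau> p) = c0 + c1 * fst p + c2 * fst p ^ 2 + c3 * snd p"
    obtain \<sigma> where \<sigma>: "faut \<sigma>" "\<sigma> x = emb \<alpha> * x + emb \<beta>" "\<sigma> y = emb c0 + emb c1 * x + emb c2 * x ^ 2 + emb c3 * y"
      using faut_exists[OF ab(1) c(1) refl refl c(2)] by blast
    have "pi_perm \<sigma> p = \<tau> p" if "p \<in> S" for p
      unfolding pi_perm_def \<sigma> using that ab(2)[OF that] c(3)[OF that]
      by (simp add: prod_eq_iff ev_add ev_scale ev_x ev_y ev_power ev_emb xA yA A_add A_scale A_emb A_closed)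
    then show ?thesis using that \<sigma> by blast
  qed
qed

end

subsection \<open>Permutation groups\<close>

text \<open>Stated for bare records: the product of two preimages must lie in
  \<open>carrier G\<close> for the inverse map to recover it.\<close>

lemma iso_inverse:
  assumes h: "h \<in> iso G H" and closed: "\<And>a b. a \<in> carrier G \<Longrightarrow> b \<in> carrier G \<Longrightarrow> a \<otimes>\<^bsub>G\<^esub> b \<in> carrier G"
  shows "H \<cong> G"
proof (rule is_isoI)
  have hom: "h \<in> hom G H" and bij: "bij_betw h (carrier G) (carrier H)" using h
    by (auto simp: iso_def)
  let ?k = "inv_into (carrier G) h"
  have k: "?k a \<in> carrier G" "h (?k a) = a" if "a \<in> carrier H" for a
    using that bij by (auto simp: bij_betw_def inv_into_into f_inv_into_f)
  have "?k (a \<otimes>\<^bsub>H\<^esub> b) = ?k a \<otimes>\<^bsub>G\<^esub> ?k b" if ab: "a \<in> carrier H" "b \<in> carrier H" for a b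
  proof -
    have "h (?k a \<otimes>\<^bsub>G\<^esub> ?k b) = a \<otimes>\<^bsub>H\<^esub> b" using hom k[OF ab(1)] k[OF ab(2)] by (simp add: hom_def)
    then show ?thesis using closed k[OF ab(1)] k[OF ab(2)] bij
      by (metis bij_betw_imp_inj_on inv_into_f_f)
  qed
  then show "?k \<in> iso H G" using bij_betw_inv_into[OF bij] k by (auto simp: iso_def hom_def)
qed

lemma symmetric_groups_iso:
  assumes e: "bij_betw e A B"
  shows "\<lparr>carrier = {p. p permutes A}, mult = (\<circ>), one = id\<rparr> \<cong> \<lparr>carrier = {p. p permutes B}, mult = (\<circ>), one = id\<rparr>"
proof (rule is_isoI)
  have inj: "inj_on e A" and im: "e ` A = B" using e by (auto simp: bij_betw_def)
  have mp: "map_permutation A e p b = (if b \<in> B then e (p (inv_into A e b)) else b)" for p b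
    by (simp add: map_permutation_def restrict_id_def im)
  have comp: "map_permutation A e (p \<circ> s) = map_permutation A e p \<circ> map_permutation A e s"
    if "s permutes A" for p s
  proof
    fix b
    show "map_permutation A e (p \<circ> s) b = (map_permutation A e p \<circ> map_permutation A e s) b"
    proof (cases "b \<in> B")
      case True
      then have "s (inv_into A e b) \<in> A" using that im by (metis inv_into_into permutes_in_image)
      then show ?thesis using True inj im by (auto simp: mp)
    qed (simp add: mp)
  qed
  have "bij_betw (map_permutation A e) {p. p permutes A} {p. p permutes B}"
  proof (rule bij_betwI[where g = "map_permutation B (inv_into A e)"])
    have e': "bij_betw (inv_into A e) B A" using e by (rule bij_betw_inv_into)
    show "map_permutation A e \<in> {p. p permutes A} \<rightarrow> {p. p permutes B}"
      using map_permutation_permutes[OF e] by auto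
    show "map_permutation B (inv_into A e) \<in> {p. p permutes B} \<rightarrow> {p. p permutes A}"
      using map_permutation_permutes[OF e'] by auto
    show "map_permutation B (inv_into A e) (map_permutation A e p) = p"
      if "p \<in> {p. p permutes A}" for p
      using that inj by (intro map_permutation_compose_inv[OF e]) auto
    show "map_permutation A e (map_permutation B (inv_into A e) p) = p"
      if "p \<in> {p. p permutes B}" for p
      using that im by (intro map_permutation_compose_inv[OF e']) (auto simp: f_inv_into_f)
  qed
  then show "map_permutation A e \<in> iso \<lparr>carrier = {p. p permutes A}, mult = (\<circ>), one = id\<rparr> \<lparr>carrier = {p. p permutes B}, mult = (\<circ>), one = id\<rparr>"
    using comp map_permutation_permutes[OF e] by (auto simp: iso_def hom_def)
qed

lemma affine_bij: assumes "\<sigma> \<in> carrier (affine_group :: ('k::field \<Rightarrow> 'k) monoid)" shows "bij \<sigma>"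
proof -
  obtain \<alpha> \<beta> where s: "\<sigma> = (\<lambda>t. \<alpha> * t + \<beta>)" "\<alpha> \<noteq> 0" using assms by (auto simp: affine_group_def)
  show ?thesis unfolding s(1)
    by (rule bij_betw_byWitness[where f' = "\<lambda>t. (t - \<beta>) / \<alpha>"]) (use s(2) in auto)
qed

lemma affine_comp:
  assumes "\<sigma> \<in> carrier (affine_group :: ('k::field \<Rightarrow> 'k) monoid)" "\<sigma>' \<in> carrier affine_group"
  shows "\<sigma> \<circ> \<sigma>' \<in> carrier affine_group"
proof -
  obtain \<alpha> \<beta> where s: "\<sigma> = (\<lambda>t. \<alpha> * t + \<beta>)" "\<alpha> \<noteq> 0" using assms by (auto simp: affine_group_def)
  obtain \<alpha>' \<beta>' where s': "\<sigma>' = (\<lambda>t. \<alpha>' * t + \<beta>')" "\<alpha>' \<noteq> 0" using assms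
    by (auto simp: affine_group_def)
  have "\<sigma> \<circ> \<sigma>' = (\<lambda>t. (\<alpha> * \<alpha>') * t + (\<alpha> * \<beta>' + \<beta>))" by (auto simp: s s' algebra_simps)
  then show ?thesis using s s' by (auto simp: affine_group_def)
qed

text \<open>\<open>e\<close> labels a position by its first coordinate and an index within the
  fibre. A permutation covering an affine map is that map together with one bijection between fibres
  for each value of the coordinate; as all fibres carry the labels \<open>{1..r}\<close>, these
  bijections are elements of one symmetric group.\<close>

lemma fibre_permutations_iso:
  fixes e :: "nat \<Rightarrow> 'k::field \<times> nat"
  assumes e: "bij_betw e {..<N} (UNIV \<times> {1..r})" and r: "r \<ge> 1"
  shows "\<lparr>carrier = {\<tau>. \<tau> permutes {..<N} \<and> (\<exists>\<alpha> \<beta>. \<alpha> \<noteq> 0 \<and> (\<forall>i<N. fst (e (\<tau> i)) = \<alpha> * fst (e i) + \<beta>))},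
           mult = (\<circ>), one = id\<rparr> \<cong> (sym_affine_group r :: (('k \<Rightarrow> nat \<Rightarrow> nat) \<times> ('k \<Rightarrow> 'k)) monoid)"
    (is "?G \<cong> ?H")
proof -
  define d where "d = inv_into {..<N} e"
  have ed: "e (d w) = w" "d w < N" if "w \<in> UNIV \<times> {1..r}" for w
  proof -
    have w: "w \<in> e ` {..<N}" using that e by (simp add: bij_betw_def)
    show "e (d w) = w" unfolding d_def using f_inv_into_f[OF w] .
    show "d w < N" unfolding d_def using inv_into_into[OF w] by simp
  qed
  have de: "d (e i) = i" "snd (e i) \<in> {1..r}" if "i < N" for i
  proof -
    show "d (e i) = i" using that e unfolding d_def by (simp add: bij_betw_def)
    have "e i \<in> UNIV \<times> {1..r}" using that e by (auto simp: bij_betw_def)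
    then show "snd (e i) \<in> {1..r}" by (auto simp: mem_Times_iff)
  qed
  have H: "carrier ?H = {(s, \<sigma>). (\<forall>t. s t permutes {1..r}) \<and> \<sigma> \<in> carrier affine_group}"
    by (auto simp: sym_affine_group_def semidirect_product_def sym_group_def PiE_iff)
  have Hm: "(s, \<sigma>) \<otimes>\<^bsub>?H\<^esub> (s', \<sigma>') = (\<lambda>t. s t \<circ> s' (inv_into UNIV \<sigma> t), \<sigma> \<circ> \<sigma>')" for s s'
    and \<sigma> \<sigma>' :: "'k \<Rightarrow> 'k"
    by (auto simp: sym_affine_group_def semidirect_product_def sym_group_def affine_group_def restrict_def)
  \<comment> \<open>The component of the family is taken at the target fibre; with this convention
    composition produces \<open>s t \<circ> s' (inv_into UNIV \<sigma> t)\<close>, the product of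
    the semidirect group.\<close>
  define \<Psi> where "\<Psi> w i = (if i < N then d (snd w (fst (e i)), fst w (snd w (fst (e i))) (snd (e i))) else i)"
    for w :: "('k \<Rightarrow> nat \<Rightarrow> nat) \<times> ('k \<Rightarrow> 'k)" and i
  have \<Psi>e: "e (\<Psi> (s, \<sigma>) i) = (\<sigma> (fst (e i)), s (\<sigma> (fst (e i))) (snd (e i)))" "\<Psi> (s, \<sigma>) i < N"
    if "\<And>t. s t permutes {1..r}" "i < N" for s \<sigma> i
  proof -
    have "s (\<sigma> (fst (e i))) (snd (e i)) \<in> {1..r}" using that(1) de(2)[OF that(2)] permutes_in_image
      by metis
    then show "e (\<Psi> (s, \<sigma>) i) = (\<sigma> (fst (e i)), s (\<sigma> (fst (e i))) (snd (e i)))" "\<Psi> (s, \<sigma>) i < N"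
      using ed that(2) by (auto simp: \<Psi>_def)
  qed
  have e_inj: "i = j" if "i < N" "j < N" "e i = e j" for i j using that de(1) by metis
  have hom: "\<Psi> ((s, \<sigma>) \<otimes>\<^bsub>?H\<^esub> (s', \<sigma>')) = \<Psi> (s, \<sigma>) \<circ> \<Psi> (s', \<sigma>')"
    if w: "(s, \<sigma>) \<in> carrier ?H" "(s', \<sigma>') \<in> carrier ?H" for s \<sigma> s' \<sigma>'
  proof
    fix i
    have bs: "bij \<sigma>" using w affine_bij by (auto simp: H)
    have ps: "s t permutes {1..r}" "s' t permutes {1..r}" for t using w by (auto simp: H)
    have pc: "s t \<circ> s' (inv_into UNIV \<sigma> t) permutes {1..r}" for t using ps
      by (intro permutes_compose)
    show "\<Psi> ((s, \<sigma>) \<otimes>\<^bsub>?H\<^esub> (s', \<sigma>')) i = (\<Psi> (s, \<sigma>) \<circ> \<Psi> (s', \<sigma>')) i"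
    proof (cases "i < N")
      case True
      have 1: "\<Psi> (s', \<sigma>') i < N" using \<Psi>e(2)[OF ps(2) True] .
      have "\<Psi> (\<lambda>t. s t \<circ> s' (inv_into UNIV \<sigma> t), \<sigma> \<circ> \<sigma>') i = \<Psi> (s, \<sigma>) (\<Psi> (s', \<sigma>') i)"
        by (rule e_inj[OF \<Psi>e(2)[OF pc True] \<Psi>e(2)[OF ps(1) 1]])
           (use \<Psi>e(1)[OF pc True] \<Psi>e(1)[OF ps(1) 1] \<Psi>e(1)[OF ps(2) True] bs in \<open>simp add: bij_is_inj\<close>)
      then show ?thesis unfolding Hm by simp
    qed (simp add: \<Psi>_def)
  qed
  have "inj_on \<Psi> (carrier ?H)"
  proof (rule inj_onI, clarify)
    fix s \<sigma> s' \<sigma>' assume w: "(s, \<sigma>) \<in> carrier ?H" "(s', \<sigma>') \<in> carrier ?H"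
      and eq: "\<Psi> (s, \<sigma>) = \<Psi> (s', \<sigma>')"
    have ps: "s t permutes {1..r}" "s' t permutes {1..r}" for t using w by (auto simp: H)
    have *: "\<sigma> t = \<sigma>' t \<and> s (\<sigma> t) l = s' (\<sigma>' t) l" if "l \<in> {1..r}" for t l
    proof -
      have w: "(t, l) \<in> UNIV \<times> {1..r}" using that by simp
      show ?thesis using \<Psi>e(1)[where s = s and \<sigma> = \<sigma>, OF ps(1) ed(2)[OF w]]
          \<Psi>e(1)[where s = s' and \<sigma> = \<sigma>', OF ps(2) ed(2)[OF w]] ed(1)[OF w] eq by auto
    qed
    have s\<sigma>: "\<sigma> = \<sigma>'" using *[of 1] r by auto
    moreover have "s u l = s' u l" for u l
    proof (cases "l \<in> {1..r}")
      case True
      have "bij \<sigma>" using w affine_bij[of \<sigma>] by (simp add: H)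
      then obtain t where "u = \<sigma> t" by (metis bij_pointE)
      then show ?thesis using *[OF True, of t] s\<sigma> by simp
    next
      case False then show ?thesis using ps by (metis permutes_not_in)
    qed
    ultimately show "s = s' \<and> \<sigma> = \<sigma>'" by auto
  qed
  moreover have img: "\<Psi> ` carrier ?H = carrier ?G"
  proof
    show "\<Psi> ` carrier ?H \<subseteq> carrier ?G"
    proof clarify
      fix s \<sigma> assume w: "(s, \<sigma>) \<in> carrier ?H"
      have ps: "s t permutes {1..r}" for t using w by (auto simp: H)
      have bs: "bij \<sigma>" using w affine_bij by (auto simp: H)
      have "inj_on (\<Psi> (s, \<sigma>)) {..<N}"
      proof (rule inj_onI)
        fix i j assume ij: "i \<in> {..<N}" "j \<in> {..<N}" "\<Psi> (s, \<sigma>) i = \<Psi> (s, \<sigma>) j"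
        then have "\<sigma> (fst (e i)) = \<sigma> (fst (e j)) \<and> s (\<sigma> (fst (e i))) (snd (e i)) = s (\<sigma> (fst (e j))) (snd (e j))"
          using \<Psi>e(1)[where s = s and \<sigma> = \<sigma>, OF ps, of i] \<Psi>e(1)[where s = s and \<sigma> = \<sigma>, OF ps, of j]
            by auto
        then have "fst (e i) = fst (e j)" "snd (e i) = snd (e j)"
          using bs ps by (auto simp: bij_def inj_def) (metis permutes_inj inj_eq)
        then show "i = j" using ij e_inj by (simp add: prod_eq_iff)
      qed
      moreover have "\<Psi> (s, \<sigma>) ` {..<N} \<subseteq> {..<N}" using \<Psi>e(2)[where s = s and \<sigma> = \<sigma>, OF ps] by auto
      ultimately have "bij_betw (\<Psi> (s, \<sigma>)) {..<N} {..<N}" by (simp add: bij_betw_def endo_inj_surj)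
      then have "\<Psi> (s, \<sigma>) permutes {..<N}" by (intro bij_imp_permutes) (auto simp: \<Psi>_def)
      moreover obtain \<alpha> \<beta> where "\<sigma> = (\<lambda>t. \<alpha> * t + \<beta>)" "\<alpha> \<noteq> 0" using w
        by (auto simp: H affine_group_def)
      ultimately show "\<Psi> (s, \<sigma>) \<in> carrier ?G" using \<Psi>e(1)[where s = s and \<sigma> = \<sigma>, OF ps] by auto
    qed
    show "carrier ?G \<subseteq> \<Psi> ` carrier ?H"
    proof
      fix \<tau> assume "\<tau> \<in> carrier ?G"
      then obtain \<alpha> \<beta>
        where \<tau>: "\<tau> permutes {..<N}" "\<alpha> \<noteq> 0" "\<And>i. i < N \<Longrightarrow> fst (e (\<tau> i)) = \<alpha> * fst (e i) + \<beta>"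
        by auto
      define \<sigma> where "\<sigma> = (\<lambda>t. \<alpha> * t + \<beta>)"
      have \<sigma>: "\<sigma> \<in> carrier affine_group" using \<tau>(2) by (auto simp: affine_group_def \<sigma>_def)
      then have bs: "bij \<sigma>" by (rule affine_bij)
      have \<tau>N: "\<tau> i < N" if "i < N" for i using \<tau>(1) that by (metis lessThan_iff permutes_in_image)
      have \<tau>i: "i = j" if "\<tau> i = \<tau> j" for i j using \<tau>(1) that by (metis permutes_inj injD)
      \<comment> \<open>What \<open>\<tau>\<close> does on arriving in the fibre of
        \<open>u\<close>, hence starting from the fibre of the preimage of \<open>u\<close>; labels
        outside \<open>{1..r}\<close> stay fixed.\<close>
      define s where "s u l = (if l \<in> {1..r} then snd (e (\<tau> (d (inv_into UNIV \<sigma> u, l)))) else l)" for u l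
      have dl: "d (t, l) < N" "e (d (t, l)) = (t, l)" if "l \<in> {1..r}" for t l
        using ed[of "(t, l)"] that by auto
      have ps: "s u permutes {1..r}" for u
      proof (rule bij_imp_permutes)
        have "inj_on (s u) {1..r}"
        proof (rule inj_onI)
          fix l l' assume l: "l \<in> {1..r}" "l' \<in> {1..r}" "s u l = s u l'"
          let ?i = "d (inv_into UNIV \<sigma> u, l)" and ?j = "d (inv_into UNIV \<sigma> u, l')"
          have "e (\<tau> ?i) = e (\<tau> ?j)" using l \<tau>(3)[of ?i] \<tau>(3)[of ?j] dl
            by (auto simp: s_def prod_eq_iff)
          then have "?i = ?j" using e_inj \<tau>N \<tau>i dl l by metis
          then show "l = l'" using dl l by (metis prod.inject)
        qed
        moreover have "s u ` {1..r} \<subseteq> {1..r}"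
        proof
          fix z assume "z \<in> s u ` {1..r}"
          then obtain l where "l \<in> {1..r}" "z = s u l" by blast
          then show "z \<in> {1..r}" using de(2)[OF \<tau>N[OF dl(1)]] by (simp add: s_def)
        qed
        ultimately show "bij_betw (s u) {1..r} {1..r}" by (simp add: bij_betw_def endo_inj_surj)
      qed (auto simp: s_def)
      have "\<Psi> (s, \<sigma>) i = \<tau> i" for i
      proof (cases "i < N")
        case True
        have l: "snd (e i) \<in> {1..r}" using de(2)[OF True] .
        show ?thesis
        proof (rule e_inj[OF \<Psi>e(2)[where s = s, OF ps True] \<tau>N[OF True]])
          have "d (e i) = i" using de(1)[OF True] .
          then have "s (\<sigma> (fst (e i))) (snd (e i)) = snd (e (\<tau> i))"
            using l bs by (simp add: s_def bij_is_inj)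
          then show "e (\<Psi> (s, \<sigma>) i) = e (\<tau> i)"
            using \<Psi>e(1)[where s = s and \<sigma> = \<sigma>, OF ps True] \<tau>(3)[OF True]
            by (simp add: prod_eq_iff \<sigma>_def)
        qed
      next
        case False then show ?thesis using \<tau>(1) by (simp add: \<Psi>_def permutes_not_in)
      qed
      then have "\<Psi> (s, \<sigma>) = \<tau>" by blast
      moreover have "(s, \<sigma>) \<in> carrier ?H" using ps \<sigma> by (simp add: H)
      ultimately show "\<tau> \<in> \<Psi> ` carrier ?H" by blast
    qed
  qed
  ultimately have "bij_betw \<Psi> (carrier ?H) (carrier ?G)" by (simp add: bij_betw_def)
  moreover have "\<Psi> \<in> hom ?H ?G"
    unfolding hom_def
  proof (intro CollectI conjI ballI funcsetI)
    fix w w' assume w: "w \<in> carrier ?H"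
    show "\<Psi> w \<in> carrier ?G" unfolding img[symmetric] using w by (rule imageI)
    assume "w' \<in> carrier ?H"
    then show "\<Psi> (w \<otimes>\<^bsub>?H\<^esub> w') = \<Psi> w \<otimes>\<^bsub>?G\<^esub> \<Psi> w'"
      using w hom[of "fst w" "snd w" "fst w'" "snd w'"] by simp
  qed
  ultimately have "\<Psi> \<in> iso ?H ?G" by (simp add: iso_def)
  then show ?thesis
  proof (rule iso_inverse)
    fix w w' assume "w \<in> carrier ?H" "w' \<in> carrier ?H"
    then show "w \<otimes>\<^bsub>?H\<^esub> w' \<in> carrier ?H"
      by (cases w; cases w') (auto simp: H Hm intro: affine_comp permutes_compose)
  qed
qed

subsection \<open>The automorphism groups of the codes\<close>

context Y2_curve begin

context
  fixes N :: nat and pt :: "nat \<Rightarrow> 'k \<times> 'k"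
  assumes pt: "bij_betw pt {..<N} S"
begin

definition enc :: "'f \<Rightarrow> 'k list" where "enc f = map (\<lambda>i. ev (pt i) f) [0..<N]"
definition on_S :: "(nat \<Rightarrow> nat) \<Rightarrow> 'k \<times> 'k \<Rightarrow> 'k \<times> 'k"
  where "on_S \<tau> p = pt (\<tau> (inv_into {..<N} pt p))"

lemma pt_S: "i < N \<Longrightarrow> pt i \<in> S" using pt by (auto simp: bij_betw_def)
lemma pt_surj: "p \<in> S \<Longrightarrow> \<exists>i<N. p = pt i" using pt unfolding bij_betw_def
  by (metis imageE lessThan_iff)
lemma on_S_pt: "i < N \<Longrightarrow> on_S \<tau> (pt i) = pt (\<tau> i)" using pt by (simp add: on_S_def bij_betw_def)
lemma pt_inj: "i < N \<Longrightarrow> j < N \<Longrightarrow> pt i = pt j \<Longrightarrow> i = j" using pt by (auto simp: bij_betw_def inj_on_def)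

lemma perm_N: "\<tau> permutes {..<N} \<Longrightarrow> i < N \<Longrightarrow> \<tau> i < N" by (metis lessThan_iff permutes_in_image)

lemma on_S_bij: assumes "\<tau> permutes {..<N}" shows "bij_betw (on_S \<tau>) S S"
proof -
  have "bij_betw (pt \<circ> (\<tau> \<circ> inv_into {..<N} pt)) S S"
    using bij_betw_trans[OF bij_betw_trans[OF bij_betw_inv_into[OF pt] permutes_imp_bij[OF assms]] pt]
    by (simp add: comp_assoc)
  moreover have "pt \<circ> (\<tau> \<circ> inv_into {..<N} pt) = on_S \<tau>" by (auto simp: on_S_def)
  ultimately show ?thesis by simp
qed

lemma permute_enc: assumes "\<tau> permutes {..<N}"
  shows "permute_list \<tau> (enc f) = map (\<lambda>i. ev (pt (\<tau> i)) f) [0..<N]"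
  unfolding permute_list_def enc_def using perm_N[OF assms] by (auto intro!: map_cong)

text \<open>\<open>pres\<close> expresses one inclusion only; \<open>pres_surj\<close> supplies the
  other.\<close>

lemma code_preserved_iff:
  assumes \<tau>: "\<tau> permutes {..<N}"
  shows "permute_list \<tau> ` enc ` L m = enc ` L m \<longleftrightarrow> pres m (on_S \<tau>)"
proof
  assume e: "permute_list \<tau> ` enc ` L m = enc ` L m"
  show "pres m (on_S \<tau>)" unfolding pres_def
  proof
    fix f assume "f \<in> L m"
    then obtain g where g: "g \<in> L m" "permute_list \<tau> (enc f) = enc g" using e by blast
    then have "\<forall>i<N. ev (pt (\<tau> i)) f = ev (pt i) g" using permute_enc[OF \<tau>, of f] enc_def[of g]
      by simp
    then have "\<forall>p\<in>S. ev p g = ev (on_S \<tau> p) f" using pt_surj on_S_pt by metis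
    then show "\<exists>g\<in>L m. \<forall>p\<in>S. ev p g = ev (on_S \<tau> p) f" using g by blast
  qed
next
  assume pr: "pres m (on_S \<tau>)"
  have eq: "permute_list \<tau> (enc f) = enc g" if "\<And>p. p \<in> S \<Longrightarrow> ev p g = ev (on_S \<tau> p) f" for f g
  proof -
    have "permute_list \<tau> (enc f) = map (\<lambda>i. ev (pt (\<tau> i)) f) [0..<N]" by (rule permute_enc[OF \<tau>])
    also have "\<dots> = enc g" unfolding enc_def using that[OF pt_S] on_S_pt by auto
    finally show ?thesis .
  qed
  show "permute_list \<tau> ` enc ` L m = enc ` L m"
  proof
    show "permute_list \<tau> ` enc ` L m \<subseteq> enc ` L m"
    proof clarify
      fix f assume "f \<in> L m"
      then obtain g where "g \<in> L m" "\<And>p. p \<in> S \<Longrightarrow> ev p g = ev (on_S \<tau> p) f" using pr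
        unfolding pres_def by blast
      then show "permute_list \<tau> (enc f) \<in> enc ` L m" using eq by blast
    qed
    show "enc ` L m \<subseteq> permute_list \<tau> ` enc ` L m"
    proof clarify
      fix g assume "g \<in> L m"
      then obtain f where "f \<in> L m" "\<And>p. p \<in> S \<Longrightarrow> ev p g = ev (on_S \<tau> p) f"
        using pres_surj[OF pr on_S_bij[OF \<tau>]] by blast
      then show "enc g \<in> permute_list \<tau> ` enc ` L m" using eq by (metis imageI)
    qed
  qed
qed

lemma code_aut_carrier: "carrier (code_aut N (enc ` L m)) = {\<tau>. \<tau> permutes {..<N} \<and> pres m (on_S \<tau>)}"
  by (simp add: code_aut_def code_preserved_iff cong: conj_cong)

lemma code_aut_dual: "code_aut N (enc ` L m) = code_aut N (enc ` L (M - 1 - m))"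
proof -
  have "pres m (on_S \<tau>) \<longleftrightarrow> pres (M - 1 - m) (on_S \<tau>)" if "\<tau> permutes {..<N}" for \<tau>
    using pres_dual[OF _ on_S_bij[OF that], of m "M - 1 - m"] pres_dual[OF _ on_S_bij[OF that], of "M - 1 - m" m] by auto
  then have "carrier (code_aut N (enc ` L m)) = carrier (code_aut N (enc ` L (M - 1 - m)))"
    unfolding code_aut_carrier by blast
  then show ?thesis by (simp add: code_aut_def)
qed

lemma code_aut_constant: assumes "m < int r" shows "code_aut N (enc ` L m) \<cong> sym_group N"
proof -
  have "pres m (on_S \<tau>)" if \<tau>: "\<tau> permutes {..<N}" for \<tau>
    unfolding pres_def
  proof
    fix f assume f: "f \<in> L m"
    then obtain c where "f = emb c" using L_const assms by blast
    moreover have "on_S \<tau> p \<in> S" if "p \<in> S" for p using on_S_bij[OF \<tau>] that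
      by (auto simp: bij_betw_def)
    ultimately show "\<exists>g\<in>L m. \<forall>p\<in>S. ev p g = ev (on_S \<tau> p) f" using f
      by (intro bexI[of _ f]) (auto simp: ev_emb)
  qed
  then have "carrier (code_aut N (enc ` L m)) = {\<tau>. \<tau> permutes {..<N}}" unfolding code_aut_carrier
    by blast
  then have "code_aut N (enc ` L m) = \<lparr>carrier = {\<tau>. \<tau> permutes {..<N}}, mult = (\<circ>), one = id\<rparr>"
    by (simp add: code_aut_def)
  \<comment> \<open>Positions are counted from 0, whereas \<open>sym_group\<close> acts on
    \<open>{1..N}\<close>.\<close>
  moreover have "bij_betw Suc {..<N} {1..N}" by (simp add: bij_betw_def image_Suc_lessThan)
  from symmetric_groups_iso[OF this] have "\<lparr>carrier = {\<tau>. \<tau> permutes {..<N}}, mult = (\<circ>), one = id\<rparr> \<cong> sym_group N"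
    by (simp add: sym_group_def)
  ultimately show ?thesis by simp
qed

text \<open>Up to order \<open>2 * r\<close> there are only polynomials in \<open>x\<close>, of
  degree at most 2, and an affine substitution keeps their degree whatever happens inside the
  fibres. The converse is \<open>pres_x\<close>.\<close>

lemma pres_affine:
  assumes m: "r \<le> m" "m \<le> 2 * r" and \<tau>: "bij_betw \<tau> S S"
  shows "pres (int m) \<tau> \<longleftrightarrow> (\<exists>\<alpha> \<beta>. \<alpha> \<noteq> 0 \<and> (\<forall>p\<in>S. fst (\<tau> p) = \<alpha> * fst p + \<beta>))"
proof
  have "4 * 2 * r \<le> 4 * r * r" using r2 by simp
  then have "2 * m < Q" unfolding Q_eq using m r2 by linarith
  also have "Q \<le> Q * r" using r2 by simp
  finally have m2: "2 * m < Q * r" .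
  assume "pres (int m) \<tau>"
  then show "\<exists>\<alpha> \<beta>. \<alpha> \<noteq> 0 \<and> (\<forall>p\<in>S. fst (\<tau> p) = \<alpha> * fst p + \<beta>)" using pres_x[OF _ \<tau> m(1) m2] by metis
next
  assume "\<exists>\<alpha> \<beta>. \<alpha> \<noteq> 0 \<and> (\<forall>p\<in>S. fst (\<tau> p) = \<alpha> * fst p + \<beta>)"
  then obtain \<alpha> \<beta> where ab: "\<And>p. p \<in> S \<Longrightarrow> fst (\<tau> p) = \<alpha> * fst p + \<beta>" by blast
  have \<tau>S: "\<tau> p \<in> S" if "p \<in> S" for p using \<tau> that by (auto simp: bij_betw_def)
  define s where "s = emb \<alpha> * x + emb \<beta>"
  have sA: "s \<in> A" by (simp add: s_def A_add A_scale A_emb xA)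
  have sL: "s \<in> L (int r)" unfolding s_def by (intro L_add L_scale x_L emb_L) auto
  have evs: "ev p s = fst (\<tau> p)" if "p \<in> S" for p
    using ab[OF that] that by (simp add: s_def ev_add ev_scale ev_x ev_emb xA A_scale A_emb)
  show "pres (int m) \<tau>" unfolding pres_def
  proof
    fix f assume f: "f \<in> L (int m)"
    show "\<exists>g\<in>L (int m). \<forall>p\<in>S. ev p g = ev (\<tau> p) f"
    proof (cases "m = 2 * r")
      case False
      then have "int m < 2 * int r" using m by simp
      then obtain c d where c: "f = emb c * x + emb d" using L_linear[OF f] by blast
      show ?thesis
      proof (intro bexI[of _ "emb c * s + emb d"] ballI)
        show "emb c * s + emb d \<in> L (int m)" using L_mono[OF _ sL, of "int m"] m
          by (intro L_add L_scale emb_L) auto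
        fix p assume p: "p \<in> S"
        then show "ev p (emb c * s + emb d) = ev (\<tau> p) f" using \<tau>S[OF p] evs[OF p]
          by (simp add: c ev_add ev_scale ev_x ev_emb xA sA A_scale A_emb)
      qed
    next
      case True
      then obtain c d e where c: "f = emb c + emb d * x + emb e * x ^ 2" using L_quadratic[OF f]
        by auto
      \<comment> \<open>At \<open>m = 2 * r\<close> the monomial \<open>x ^ 2\<close> enters, and
        its image has just the order allowed.\<close>
      have s2: "s ^ 2 \<in> L (int m)" using L_power[OF sL, of 2] True by simp
      show ?thesis
      proof (intro bexI[of _ "emb c + emb d * s + emb e * s ^ 2"] ballI)
        show "emb c + emb d * s + emb e * s ^ 2 \<in> L (int m)"
          using L_mono[OF _ sL, of "int m"] m s2 by (intro L_add L_scale emb_L) auto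
        fix p assume p: "p \<in> S"
        then show "ev p (emb c + emb d * s + emb e * s ^ 2) = ev (\<tau> p) f" using \<tau>S[OF p] evs[OF p]
          by (simp add: c ev_add ev_scale ev_x ev_emb ev_power xA sA A_scale A_emb A_add A_closed)
      qed
    qed
  qed
qed

lemma code_aut_affine:
  assumes m: "r \<le> m" "m \<le> 2 * r"
    and e: "bij_betw e {..<N} (UNIV \<times> {1..r})" "\<And>i. i < N \<Longrightarrow> fst (e i) = fst (pt i)"
  shows "code_aut N (enc ` L (int m)) \<cong> (sym_affine_group r :: (('k \<Rightarrow> nat \<Rightarrow> nat) \<times> ('k \<Rightarrow> 'k)) monoid)"
proof -
  have "pres (int m) (on_S \<tau>) \<longleftrightarrow> (\<exists>\<alpha> \<beta>. \<alpha> \<noteq> 0 \<and> (\<forall>i<N. fst (e (\<tau> i)) = \<alpha> * fst (e i) + \<beta>))"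
    if \<tau>: "\<tau> permutes {..<N}" for \<tau>
  proof -
    have "(\<forall>p\<in>S. fst (on_S \<tau> p) = \<alpha> * fst p + \<beta>) \<longleftrightarrow> (\<forall>i<N. fst (e (\<tau> i)) = \<alpha> * fst (e i) + \<beta>)" for \<alpha> \<beta>
    proof -
      have "(\<forall>p\<in>S. fst (on_S \<tau> p) = \<alpha> * fst p + \<beta>) \<longleftrightarrow> (\<forall>i<N. fst (on_S \<tau> (pt i)) = \<alpha> * fst (pt i) + \<beta>)"
        using pt_S pt_surj by metis
      also have "\<dots> \<longleftrightarrow> (\<forall>i<N. fst (e (\<tau> i)) = \<alpha> * fst (e i) + \<beta>)"
        using e(2) perm_N[OF \<tau>] on_S_pt by auto
      finally show ?thesis .
    qed
    then show ?thesis using pres_affine[OF m on_S_bij[OF \<tau>]] by simp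
  qed
  then have "carrier (code_aut N (enc ` L (int m))) =
    {\<tau>. \<tau> permutes {..<N} \<and> (\<exists>\<alpha> \<beta>. \<alpha> \<noteq> 0 \<and> (\<forall>i<N. fst (e (\<tau> i)) = \<alpha> * fst (e i) + \<beta>))}"
    unfolding code_aut_carrier by blast
  then have "code_aut N (enc ` L (int m)) =
    \<lparr>carrier = {\<tau>. \<tau> permutes {..<N} \<and> (\<exists>\<alpha> \<beta>. \<alpha> \<noteq> 0 \<and> (\<forall>i<N. fst (e (\<tau> i)) = \<alpha> * fst (e i) + \<beta>))},
           mult = (\<circ>), one = id\<rparr>" by (simp add: code_aut_def)
  then show ?thesis using fibre_permutations_iso[OF e(1)] r2 by simp
qed

lemma code_aut_field_aut:
  assumes m: "2 * r + 1 \<le> m" "2 * m < Q * r"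
  shows "code_aut N (enc ` L (int m)) \<cong> field_aut emb"
proof (rule iso_inverse)
  define ix where "ix = inv_into {..<N} pt"
  have ix: "ix p < N" "pt (ix p) = p" if "p \<in> S" for p
  proof -
    have w: "p \<in> pt ` {..<N}" using that pt by (simp add: bij_betw_def)
    show "pt (ix p) = p" unfolding ix_def using f_inv_into_f[OF w] .
    show "ix p < N" unfolding ix_def using inv_into_into[OF w] by simp
  qed
  \<comment> \<open>The inverse compensates for the reversal of composition by
    \<open>pi_perm\<close>.\<close>
  define \<Phi> where "\<Phi> \<sigma> i = (if i < N then ix (pi_perm (inv_into UNIV \<sigma>) (pt i)) else i)" for \<sigma> i
  have piS: "pi_perm (inv_into UNIV \<sigma>) (pt i) \<in> S" if "faut \<sigma>" "i < N" for \<sigma> i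
    using pi_perm_S[OF faut_inv[OF that(1)] pt_S[OF that(2)]] .
  have \<Phi>N: "\<Phi> \<sigma> i < N" and pt\<Phi>: "pt (\<Phi> \<sigma> i) = pi_perm (inv_into UNIV \<sigma>) (pt i)"
    if "faut \<sigma>" "i < N" for \<sigma> i
    using ix[OF piS[OF that]] that(2) by (auto simp: \<Phi>_def)
  have car: "\<sigma> \<in> carrier (field_aut emb) \<longleftrightarrow> faut \<sigma>" for \<sigma> by (simp add: faut_def)
  have fcomp: "faut (\<sigma> \<circ> \<sigma>')" if "faut \<sigma>" "faut \<sigma>'" for \<sigma> \<sigma>'
    using that by (auto simp: faut_iff bij_comp)
  have onS: "on_S (\<Phi> \<sigma>) p = pi_perm (inv_into UNIV \<sigma>) p" if "faut \<sigma>" "p \<in> S" for \<sigma> p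
    using pt_surj[OF that(2)] on_S_pt pt\<Phi>[OF that(1)] by metis
  have perm: "\<Phi> \<sigma> permutes {..<N}" if \<sigma>: "faut \<sigma>" for \<sigma>
  proof (rule bij_imp_permutes)
    have "inj_on (\<Phi> \<sigma>) {..<N}"
    proof (rule inj_onI)
      fix i j assume ij: "i \<in> {..<N}" "j \<in> {..<N}" "\<Phi> \<sigma> i = \<Phi> \<sigma> j"
      then have "pi_perm (inv_into UNIV \<sigma>) (pt i) = pi_perm (inv_into UNIV \<sigma>) (pt j)"
        using pt\<Phi>[OF \<sigma>] by (metis lessThan_iff)
      then have "pt i = pt j" using pi_perm_bij[OF faut_inv[OF \<sigma>]] pt_S ij
        by (auto simp: bij_betw_def inj_on_def)
      then show "i = j" using pt_inj ij by auto
    qed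
    moreover have "\<Phi> \<sigma> ` {..<N} \<subseteq> {..<N}" using \<Phi>N[OF \<sigma>] by auto
    ultimately show "bij_betw (\<Phi> \<sigma>) {..<N} {..<N}" by (simp add: bij_betw_def endo_inj_surj)
  qed (simp add: \<Phi>_def)
  have into: "\<Phi> \<sigma> \<in> carrier (code_aut N (enc ` L (int m)))" if \<sigma>: "faut \<sigma>" for \<sigma>
  proof -
    have "pres (int m) (on_S (\<Phi> \<sigma>))"
      using pi_perm_pres[OF faut_inv[OF \<sigma>], of "int m"] onS[OF \<sigma>] by (simp add: pres_def)
    then show ?thesis unfolding code_aut_carrier using perm[OF \<sigma>] by blast
  qed
  have hom: "\<Phi> (\<sigma> \<circ> \<sigma>') = \<Phi> \<sigma> \<circ> \<Phi> \<sigma>'" if s: "faut \<sigma>" "faut \<sigma>'" for \<sigma> \<sigma>'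
  proof
    fix i
    show "\<Phi> (\<sigma> \<circ> \<sigma>') i = (\<Phi> \<sigma> \<circ> \<Phi> \<sigma>') i"
    proof (cases "i < N")
      case True
      have inv: "inv_into UNIV (\<sigma> \<circ> \<sigma>') = inv_into UNIV \<sigma>' \<circ> inv_into UNIV \<sigma>"
        using \<sigma>_bij[OF s(1)] \<sigma>_bij[OF s(2)] by (rule o_inv_distrib)
      have 1: "\<Phi> \<sigma>' i < N" using \<Phi>N[OF s(2) True] .
      have "pt (\<Phi> (\<sigma> \<circ> \<sigma>') i) = pt (\<Phi> \<sigma> (\<Phi> \<sigma>' i))"
        unfolding pt\<Phi>[OF fcomp[OF s] True] pt\<Phi>[OF s(1) 1] pt\<Phi>[OF s(2) True] inv
        by (rule pi_perm_comp[OF faut_inv[OF s(2)] faut_inv[OF s(1)] pt_S[OF True]])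
      then show ?thesis using pt_inj \<Phi>N[OF fcomp[OF s] True] \<Phi>N[OF s(1) 1] by simp
    qed (simp add: \<Phi>_def)
  qed
  have inj: "\<sigma> = \<sigma>'" if s: "faut \<sigma>" "faut \<sigma>'" "\<Phi> \<sigma> = \<Phi> \<sigma>'" for \<sigma> \<sigma>'
  proof -
    have "inv_into UNIV \<sigma> = inv_into UNIV \<sigma>'"
      by (rule pi_perm_inj[OF faut_inv[OF s(1)] faut_inv[OF s(2)]]) (use onS s in metis)
    then show ?thesis using \<sigma>_bij[OF s(1)] \<sigma>_bij[OF s(2)] by (metis inv_inv_eq)
  qed
  have surj: "\<exists>\<sigma>. faut \<sigma> \<and> \<Phi> \<sigma> = \<tau>" if "\<tau> \<in> carrier (code_aut N (enc ` L (int m)))" for \<tau>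
  proof -
    have \<tau>: "\<tau> permutes {..<N}" "pres (int m) (on_S \<tau>)" using that unfolding code_aut_carrier
      by auto
    obtain \<sigma> where s: "faut \<sigma>" "\<And>p. p \<in> S \<Longrightarrow> pi_perm \<sigma> p = on_S \<tau> p"
      using pres_faut[OF \<tau>(2) on_S_bij[OF \<tau>(1)] m] by blast
    define \<sigma>' where "\<sigma>' = inv_into UNIV \<sigma>"
    have s': "faut \<sigma>'" unfolding \<sigma>'_def using faut_inv[OF s(1)] .
    have i: "inv_into UNIV \<sigma>' = \<sigma>" unfolding \<sigma>'_def using \<sigma>_bij[OF s(1)] by (rule inv_inv_eq)
    have "\<Phi> \<sigma>' j = \<tau> j" for j
    proof (cases "j < N")
      case True
      have "pt (\<Phi> \<sigma>' j) = pt (\<tau> j)" using pt\<Phi>[OF s' True] i s(2)[OF pt_S[OF True]] on_S_pt[OF True]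
        by simp
      then show ?thesis using pt_inj \<Phi>N[OF s' True] perm_N[OF \<tau>(1) True] by blast
    next
      case False then show ?thesis using \<tau>(1) by (simp add: \<Phi>_def permutes_not_in)
    qed
    then show ?thesis using s' by blast
  qed
  show "\<Phi> \<in> iso (field_aut emb) (code_aut N (enc ` L (int m)))"
    unfolding iso_iff
  proof (intro conjI)
    show "\<Phi> \<in> hom (field_aut emb) (code_aut N (enc ` L (int m)))"
      using into hom car by (auto simp: hom_def field_aut_def code_aut_def)
    show "\<Phi> ` carrier (field_aut emb) = carrier (code_aut N (enc ` L (int m)))" using into surj car
      by blast
    show "inj_on \<Phi> (carrier (field_aut emb))" using inj car by (auto intro: inj_onI)
  qed
  show "a \<otimes>\<^bsub>field_aut emb\<^esub> b \<in> carrier (field_aut emb)"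
    if "a \<in> carrier (field_aut emb)" "b \<in> carrier (field_aut emb)" for a b
    using fcomp that unfolding car by (simp add: field_aut_def)
qed

end

end

text \<open>Quotient and remainder by \<open>r\<close> give block and index of a position; both are
  raised by one because the enumerations \<open>xs\<close> and \<open>ys\<close> start at 1.\<close>

lemma concat_blocks:
  "concat (map (\<lambda>j. map (\<lambda>l. g j l) [1..<r + 1]) [1..<k + 1]) =
   map (\<lambda>i. g (i div r + 1) (i mod r + 1)) [0..<k * r]"
proof (induction k)
  case (Suc k)
  have block: "map (\<lambda>l. g (k + 1) l) [1..<r + 1] = map (\<lambda>i. g (i div r + 1) (i mod r + 1)) [k * r..<k * r + r]"
  proof -
    have 1: "[1..<r + 1] = map Suc [0..<r]" by (metis map_Suc_upt One_nat_def Suc_eq_plus1)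
    have 2: "[k * r..<k * r + r] = map (\<lambda>i. i + k * r) [0..<r]"
      by (simp add: map_add_upt add.commute)
    show ?thesis unfolding 1 2 map_map by (rule map_cong) auto
  qed
  have "[0..<Suc k * r] = [0..<k * r] @ [k * r..<k * r + r]"
    by (metis add.commute le_add1 mult_Suc upt_add_eq_append zero_le)
  then show ?case using Suc block by simp
qed simp

theorem theorem5p2:
  fixes n q m :: nat
    and emb :: "'k::{field,finite} \<Rightarrow> 'f::field"
    and x y :: 'f
    and xs :: "nat \<Rightarrow> 'k"
    and ys :: "nat \<Rightarrow> nat \<Rightarrow> 'k"
  assumes "n \<ge> 2"
    and "q = 2 ^ n"
    and "CARD('k) = q ^ 2"
    and "Y2_function_field n emb x y"
    and "bij_betw xs {1..q ^ 2} UNIV"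
    and "\<forall>j\<in>{1..q ^ 2}. bij_betw (ys j) {1..q div 2} {b. h_poly n b = xs j ^ (q + 1)}"
  shows
    "(real m \<le> real q / 2 - 1 \<or>
      (real q ^ 3 + real q ^ 2 - 3 * real q - 2) / 2 \<le> real m
        \<longrightarrow> code_aut (q ^ 3 div 2) (Y2_code q emb x y xs ys m) \<cong> sym_group (q ^ 3 div 2))
     \<and>
     (real q / 2 \<le> real m \<and> m \<le> q \<or>
      (real q ^ 3 + real q ^ 2 - 4 * real q - 4) / 2 \<le> real m \<and>
      real m \<le> (real q ^ 3 + real q ^ 2 - 3 * real q - 4) / 2
        \<longrightarrow> code_aut (q ^ 3 div 2) (Y2_code q emb x y xs ys m)
              \<cong> (sym_affine_group (q div 2) :: (('k \<Rightarrow> nat \<Rightarrow> nat) \<times> ('k \<Rightarrow> 'k)) monoid))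
     \<and>
     (q + 1 \<le> m \<and> real m \<le> real q ^ 3 / 4 - 1 \<or>
      (real q ^ 3 + 2 * real q ^ 2 - 4 * real q - 4) / 4 \<le> real m \<and>
      real m \<le> (real q ^ 3 + real q ^ 2 - 4 * real q - 6) / 2
        \<longrightarrow> code_aut (q ^ 3 div 2) (Y2_code q emb x y xs ys m) \<cong> field_aut emb)"
proof -
  define r where "r = (2::nat) ^ (n - 1)"
  have q2: "q = 2 * r" using assms(1,2) by (simp add: r_def power_Suc[symmetric] Suc_diff_le)
  have rq: "q div 2 = r" by (simp add: q2)
  have ysb: "bij_betw (ys j) {1..r} {b. h_poly n b = xs j ^ (2 * r + 1)}" if "j \<in> {1..q ^ 2}" for j
    using assms(6) that by (simp add: rq q2)
  interpret Y2_curve n r emb x y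
  proof
    show "CARD('k) = (2 * r)\<^sup>2" using assms(3) q2 by simp
    fix a :: 'k
    obtain j where "j \<in> {1..q ^ 2}" "a = xs j" using assms(5)
      by (metis UNIV_I bij_betw_imp_surj_on imageE)
    then show "card {b. h_poly n b = a ^ (2 * r + 1)} = r" using bij_betw_same_card[OF ysb] by simp
  qed (use assms r_def in auto)
  define N where "N = q ^ 2 * r"
  have N: "q ^ 3 div 2 = N" by (simp add: N_def q2 power2_eq_square power3_eq_cube)
  have NQ: "N = Q * r" by (simp add: N_def Q_def assms(3))
  define jj where "jj i = i div r + 1" for i
  define ll where "ll i = i mod r + 1" for i
  define pt where "pt i = (xs (jj i), ys (jj i) (ll i))" for i
  \<comment> \<open>The labels for the semidirect product: the index in the fibre replaces the
    second coordinate.\<close>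
  define e where "e i = (xs (jj i), ll i)" for i
  have r0: "r > 0" using r2 by simp
  have jl: "jj i \<in> {1..q ^ 2}" "ll i \<in> {1..r}" if "i < N" for i
    using that r0 unfolding jj_def ll_def N_def by (auto simp: less_mult_imp_div_less Suc_le_eq)
  have jl_inj: "i = i'" if "jj i = jj i'" "ll i = ll i'" for i i'
    using that unfolding jj_def ll_def by (metis add_right_cancel div_mult_mod_eq)
  have jl_surj: "\<exists>i<N. jj i = j \<and> ll i = l" if "j \<in> {1..q ^ 2}" "l \<in> {1..r}" for j l
  proof (intro exI[of _ "(j - 1) * r + (l - 1)"] conjI)
    have l: "l - 1 < r" using that by auto
    have "(j - 1) * r + (l - 1) < (j - 1) * r + r" using l by simp
    also have "\<dots> = j * r" using that
      by (metis add.commute atLeastAtMost_iff le_add_diff_inverse mult_Suc plus_1_eq_Suc)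
    also have "\<dots> \<le> N" using that by (simp add: N_def)
    finally show "(j - 1) * r + (l - 1) < N" .
    obtain j0 l0 where "j = Suc j0" "l = Suc l0" "l0 < r" using \<open>j \<in> {1..q ^ 2}\<close> \<open>l \<in> {1..r}\<close>
      by (cases j; cases l) auto
    then show "jj ((j - 1) * r + (l - 1)) = j" "ll ((j - 1) * r + (l - 1)) = l"
      by (auto simp: jj_def ll_def)
  qed
  have xs_inj: "j = j'" if "j \<in> {1..q ^ 2}" "j' \<in> {1..q ^ 2}" "xs j = xs j'" for j j'
    using assms(5) that by (auto simp: bij_betw_def inj_on_def)
  have xs_surj: "\<exists>j\<in>{1..q ^ 2}. a = xs j" for a using assms(5)
    by (metis UNIV_I bij_betw_imp_surj_on imageE)
  have ptb: "bij_betw pt {..<N} S"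
    unfolding bij_betw_def
  proof
    show "inj_on pt {..<N}"
    proof (rule inj_onI)
      fix i i' assume i: "i \<in> {..<N}" "i' \<in> {..<N}" "pt i = pt i'"
      then have j: "jj i = jj i'" using xs_inj jl by (auto simp: pt_def)
      have "ys (jj i) (ll i) = ys (jj i) (ll i')" using i j by (simp add: pt_def)
      then have "ll i = ll i'" using ysb[OF jl(1)] jl(2) i unfolding bij_betw_def inj_on_def
        by (metis lessThan_iff)
      then show "i = i'" using jl_inj j by blast
    qed
    show "pt ` {..<N} = S"
    proof
      show "pt ` {..<N} \<subseteq> S"
      proof (rule image_subsetI)
        fix i assume "i \<in> {..<N}"
        then have "i < N" by simp
        then have "ys (jj i) (ll i) \<in> {b. h_poly n b = xs (jj i) ^ (2 * r + 1)}"
          using ysb[OF jl(1)] jl(2) unfolding bij_betw_def by blast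
        then show "pt i \<in> S" by (simp add: pt_def S_def fiber_def)
      qed
      show "S \<subseteq> pt ` {..<N}"
      proof
        fix p assume "p \<in> S"
        then obtain a b where p: "p = (a, b)" "h_poly n b = a ^ (2 * r + 1)"
          by (auto simp: S_def fiber_def)
        obtain j where j: "j \<in> {1..q ^ 2}" "a = xs j" using xs_surj by blast
        then obtain l where l: "l \<in> {1..r}" "b = ys j l" using ysb[OF j(1)] p(2)
          unfolding bij_betw_def by blast
        obtain i where "i < N" "jj i = j" "ll i = l" using jl_surj j l by blast
        then show "p \<in> pt ` {..<N}" using p j l by (auto simp: pt_def)
      qed
    qed
  qed
  have eb: "bij_betw e {..<N} (UNIV \<times> {1..r})"
    unfolding bij_betw_def
  proof
    show "inj_on e {..<N}"
    proof (rule inj_onI)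
      fix i i' assume i: "i \<in> {..<N}" "i' \<in> {..<N}" "e i = e i'"
      then have "jj i = jj i'" using xs_inj[OF jl(1) jl(1), of i i'] by (auto simp: e_def)
      moreover have "ll i = ll i'" using i by (simp add: e_def)
      ultimately show "i = i'" using jl_inj by blast
    qed
    show "e ` {..<N} = UNIV \<times> {1..r}"
    proof
      show "e ` {..<N} \<subseteq> UNIV \<times> {1..r}" using jl(2) by (auto simp: e_def)
      show "UNIV \<times> {1..r} \<subseteq> e ` {..<N}"
      proof
        fix w :: "'k \<times> nat" assume "w \<in> UNIV \<times> {1..r}"
        then obtain a l where w: "w = (a, l)" and l: "l \<in> {1..r}" by auto
        obtain j where j: "j \<in> {1..q ^ 2}" "a = xs j" using xs_surj by blast
        obtain i where "i < N" "jj i = j" "ll i = l" using jl_surj j l by blast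
        then show "w \<in> e ` {..<N}" using j w by (auto simp: e_def intro!: image_eqI[of _ _ i])
      qed
    qed
  qed
  have efst: "fst (e i) = fst (pt i)" for i by (simp add: e_def pt_def)
  have "Y2_places q emb x y xs ys = map (\<lambda>i. P_affine emb x y (fst (pt i)) (snd (pt i))) [0..<N]"
    unfolding Y2_places_def rq concat_blocks N_def pt_def jj_def ll_def fst_conv snd_conv ..
  also have "\<dots> = map (\<lambda>i. max_ideal (Rpt (pt i))) [0..<N]"
  proof (rule map_cong)
    fix i assume "i \<in> set [0..<N]"
    then have "pt i \<in> S" using ptb by (auto simp: bij_betw_def)
    then show "P_affine emb x y (fst (pt i)) (snd (pt i)) = max_ideal (Rpt (pt i))"
      using P_affine_eq[of "fst (pt i)" "snd (pt i)"] by simp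
  qed simp
  finally have code: "Y2_code q emb x y xs ys m = enc N pt ` L (int m)"
    unfolding Y2_code_def AG_code_def RR_eq enc_def[OF ptb] ev_def by (simp add: comp_def)
  \<comment> \<open>Duality reflects each upper range of \<open>m\<close> onto the corresponding
    range of small orders. For large \<open>m\<close> the result is negative, which only meets the
    case of constants.\<close>
  define m' where "m' = M - 1 - int m"
  note dual = code_aut_dual[OF ptb, of "int m", folded m'_def]
  have Mr: "of_int M = 4 * real r ^ 3 + 2 * real r ^ 2 - 2 * real r - 1" by (simp add: M_eq)
  have m'r: "of_int m' = 4 * real r ^ 3 + 2 * real r ^ 2 - 2 * real r - 2 - real m"
    by (simp add: m'_def Mr)
  have qr: "real q = 2 * real r" by (simp add: q2)
  have q3: "real q ^ 3 = 8 * real r ^ 3" "real q ^ 2 = 4 * real r ^ 2"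
    by (simp_all add: qr power_mult_distrib)
  have Qr: "real (Q * r) = 4 * real r ^ 3" by (simp add: Q_eq power3_eq_cube)
  show ?thesis
    unfolding N rq code
  proof (intro conjI impI)
    assume "real m \<le> real q / 2 - 1 \<or> (real q ^ 3 + real q ^ 2 - 3 * real q - 2) / 2 \<le> real m"
    then show "code_aut N (enc N pt ` L (int m)) \<cong> sym_group N"
    proof
      assume "real m \<le> real q / 2 - 1"
      then have "real m < real r" by (simp add: qr)
      then have "int m < int r" by simp
      then show ?thesis using code_aut_constant[OF ptb] by blast
    next
      assume "(real q ^ 3 + real q ^ 2 - 3 * real q - 2) / 2 \<le> real m"
      then have "of_int m' < real r" by (simp add: m'r q3 qr field_simps)
      then have "of_int m' < (of_int (int r) :: real)" by simp
      then have "m' < int r" by (simp only: of_int_less_iff)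
      then show ?thesis unfolding dual using code_aut_constant[OF ptb] by blast
    qed
  next
    assume "real q / 2 \<le> real m \<and> m \<le> q \<or>
      (real q ^ 3 + real q ^ 2 - 4 * real q - 4) / 2 \<le> real m \<and>
      real m \<le> (real q ^ 3 + real q ^ 2 - 3 * real q - 4) / 2"
    then show "code_aut N (enc N pt ` L (int m)) \<cong> (sym_affine_group r :: (('k \<Rightarrow> nat \<Rightarrow> nat) \<times> ('k \<Rightarrow> 'k)) monoid)"
    proof
      assume "real q / 2 \<le> real m \<and> m \<le> q"
      then have "r \<le> m" "m \<le> 2 * r" by (auto simp: qr q2)
      then show ?thesis using code_aut_affine[OF ptb _ _ eb efst] by blast
    next
      assume "(real q ^ 3 + real q ^ 2 - 4 * real q - 4) / 2 \<le> real m \<and>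
        real m \<le> (real q ^ 3 + real q ^ 2 - 3 * real q - 4) / 2"
      then have "of_int m' \<le> 2 * real r" "real r \<le> of_int m'"
        by (simp_all add: m'r q3 qr field_simps)
      then have "of_int m' \<le> (of_int (2 * int r) :: real)" "(of_int (int r) :: real) \<le> of_int m'"
        by simp_all
      then have *: "m' \<le> 2 * int r" "int r \<le> m'" by (simp_all only: of_int_le_iff)
      then obtain k where k: "m' = int k" by (metis nonneg_int_cases of_nat_0_le_iff order.trans)
      then have "r \<le> k" "k \<le> 2 * r" using * by auto
      then show ?thesis unfolding dual k using code_aut_affine[OF ptb _ _ eb efst] by blast
    qed
  next
    assume "q + 1 \<le> m \<and> real m \<le> real q ^ 3 / 4 - 1 \<or>
      (real q ^ 3 + 2 * real q ^ 2 - 4 * real q - 4) / 4 \<le> real m \<and>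
      real m \<le> (real q ^ 3 + real q ^ 2 - 4 * real q - 6) / 2"
    then show "code_aut N (enc N pt ` L (int m)) \<cong> field_aut emb"
    proof
      assume a: "q + 1 \<le> m \<and> real m \<le> real q ^ 3 / 4 - 1"
      \<comment> \<open>The bound \<open>q ^ 3 / 4 - 1\<close> says that \<open>2 * m\<close> is
        less than the number \<open>4 * r ^ 3\<close> of points.\<close>
      then have "real (2 * m) < real (Q * r)" unfolding Qr by (simp add: q3)
      then have "2 * m < Q * r" by (simp only: of_nat_less_iff)
      moreover have "2 * r + 1 \<le> m" using a q2 by simp
      ultimately show ?thesis using code_aut_field_aut[OF ptb] by blast
    next
      assume "(real q ^ 3 + 2 * real q ^ 2 - 4 * real q - 4) / 4 \<le> real m \<and>
        real m \<le> (real q ^ 3 + real q ^ 2 - 4 * real q - 6) / 2"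
      \<comment> \<open>The reflected bounds: \<open>m' \<le> 2 * r ^ 3 - 1\<close> from the lower
        one and \<open>m' \<ge> 2 * r + 1\<close> from the upper one.\<close>
      then have a: "2 * of_int m' < 4 * real r ^ 3" "2 * real r + 1 \<le> of_int m'"
        by (simp_all add: m'r q3 qr field_simps)
      then have "(of_int (2 * int r + 1) :: real) \<le> of_int m'" by simp
      then have *: "2 * int r + 1 \<le> m'" by (simp only: of_int_le_iff)
      then obtain k where k: "m' = int k"
        by (metis nonneg_int_cases of_nat_0_le_iff order.trans zero_le_numeral add_nonneg_nonneg mult_nonneg_nonneg zero_le_one)
      then have "real (2 * k) < real (Q * r)" unfolding Qr using a(1) by simp
      then have "2 * k < Q * r" by (simp only: of_nat_less_iff)
      moreover have "2 * r + 1 \<le> k" using * k by simp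
      ultimately show ?thesis unfolding dual k using code_aut_field_aut[OF ptb] by blast
    qed
  qed
qed

end
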